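(* In the setting described in the context (Stubble model with smoothness $\beta\in\mathbb N$ and estimator $\hat f(x_0)=\dot{\hat p}(x_0,0)$ built from an arbitrary regression estimator $\mathcal E$ with maximal risk $r$), assume $\Delta t\preccurlyeq 1$. Then, for $x_0\in[0,1]^d$, $$\mathbf{E}\big[\|\hat f(x_0)-f^\star(x_0)\|_2^2\big]\preccurlyeq \Delta t^{-2}\, r\big(d,\beta,C\Delta t,\sigma,(x_j)_{j\in\{1,\dots,m\}}\big)+\Delta t^{2\beta}$$ for some constant $C>0$ depending only on $\beta$ and $L_0,\dots,L_\beta$.
   Context: Asymptotic notation (as $n\to\infty$): $a_n\preccurlyeq b_n$ means $\limsup_{n\to\infty} a_n/b_n<\infty$. The quantities $d,\beta,L_0,\dots,L_\beta,\sigma$ are fixed; all other quantities (in particular $\Delta t$) may vary with $n$. Flow and increment: for a Lipschitz $f\colon\mathbb R^d\to\mathbb R^d$, $U(f,x,\cdot)$ is the unique solution $u$ of $\dot u(t)=f(u(t))$, $u(0)=x$; $\Upsilon(f,t,x):=U(f,x,t)-x$. Smoothness class of model functions: $\mathcal F_{d,\beta}$ is the set of $\beta$-times continuously differentiable $f\colon\mathbb R^d\to\mathbb R^d$ with $\sup_{x}\|D^kf(x)\|_{\mathsf{op}}\le L_k$ for $k=0,\dots,\beta$, where $L_0,\dots,L_\beta>0$, $\|D^kf(x)\|_{\mathsf{op}}=\sup\|D^kf(x)[v_1,\dots,v_k]\|_2$ over unit vectors $v_i$, and $D^0f=f$. Model: $d,\beta\in\mathbb N$, $f^\star\in\mathcal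 F_{d,\beta}$, $m\in\mathbb N$, $x_1,\dots,x_m\in[0,1]^d$, $\Delta t>0$, $t_i=i\Delta t$ for $i=0,\dots,\beta$, total number of observations $n=\beta m$. Let $\sigma\ge0$ and let $\varepsilon_{j,i}$ ($1\le j\le m$, $1\le i\le\beta$) be independent $\mathbb R^d$-valued with $\mathbf E[\varepsilon_{j,i}]=0$, $\mathbf E[\|\varepsilon_{j,i}\|_2^2]\le\sigma^2$. Observe $Y_{j,i}=U(f^\star,x_j,i\Delta t)+\varepsilon_{j,i}$; the points $x_j$ and $\Delta t$ are known, $f^\star$ is unknown. Standard regression model and risk: for $L>0$, $\Sigma^{d\to d}(\beta,L)$ is the set of functions $g=(g_1,\dots,g_d)\colon\mathbb R^d\to\mathbb R^d$ such that each $g_k$ is $(\beta-1)$-times differentiable with $\|D^{\beta-1}g_k(x)-D^{\beta-1}g_k(\tilde x)\|_{\mathsf{op}}\le L\|x-\tilde x\|_2$ for all $x,\tilde x$. The regression model $\mathfrak P(L)$ consists of all laws of data $(x_j,Z_j)_{j=1}^m$ with $Z_j=g(x_j)+\xi_j$, $g\in\Sigma^{d\to d}(\beta,L)$, and $\xi_j$ independent, $\mathbb R^d$-valued, centered with $\mathbf E[\|\xi_j\|_2^2]\le\sigma^2$. A regression estimator $\mathcal E$ is an arbitrary measurable map $(\mathbb R^d\times\mathbb R^d)^m\times\mathbb R^d\to\mathbb R^d$, estimating $g(x)$ by $\mathcal E((x_j,Z_j)_j,x)$. Its maximal risk is $$r(d,\beta,L,\sigma,(x_j)_j):=\sup_{x\in[0,1]^d}\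 \sup_{\mathbf P\in\mathfrak P(L)}\mathbf E_{\mathbf P}\big[\|\mathcal E((x_j,Z_j)_j,x)-g(x)\|_2^2\big].$$ Estimator of $f^\star$: fix a regression estimator $\mathcal E$. For $i=1,\dots,\beta$ set $\hat\iota_i(x):=\mathcal E((x_j,Y_{j,i}-x_j)_{j},x)$ (an estimator of $\Upsilon(f^\star,t_i,x)$) and $\hat\iota_0:=0$. For $x_0\in\mathbb R^d$ let $\hat p(x_0,\cdot)\colon\mathbb R\to\mathbb R^d$ be the componentwise polynomial of degree at most $\beta$ interpolating the points $(t_i,\hat\iota_i(x_0))$, $i=0,\dots,\beta$. Define $\hat f(x_0):=\dot{\hat p}(x_0,0)$, the derivative in $t$ at $t=0$.
   Formalization: The constant C is allowed to depend also on an upper bound T for limsup Δt (the constant implicit in Δt ≼ 1), besides β and L_0,…,L_β; with C depending only on β and L_0,…,L_β for all bounded Δt the claim is false. *)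

theory Defs
  imports "HOL-Probability.Probability"
begin

section \<open>The spaces $R^d$ inside one type\<close>

text \<open>
  The constant of the theorem must not depend on the dimension, so the dimension is a natural
  number that is quantified after that constant and cannot be the cardinality of an index type.
  All spaces $R^d$ are therefore represented isometrically in the type \<open>ell2\<close> of square-summable
  sequences, \<open>Rn d\<close> being the set of those sequences whose coordinates with index at least
  \<open>d\<close> vanish.  On \<open>Rn d\<close>, \<open>norm\<close> is the Euclidean norm.
\<close>

typedef ell2 = "{x :: nat \<Rightarrow> real. summable (\<lambda>i. (x i)\<^sup>2)}"
  morphisms coord Ell2
  by (rule exI[of _ "\<lambda>_. 0"]) simp

lemma summable_coord_sq [simp]: "summable (\<lambda>i. (coord x i)\<^sup>2)"
  using coord[of x] by simp

lemma coord_Ell2: "summable (\<lambda>i. (f i)\<^sup>2) \<Longrightarrow> coord (Ell2 f) = f"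
  by (simp add: Ell2_inverse)

lemma ell2_eq_iff: "x = y \<longleftrightarrow> (\<forall>i. coord x i = coord y i)"
  by (metis coord_inject ext)

lemma summable_mult_sq:
  fixes f g :: "nat \<Rightarrow> real"
  assumes "summable (\<lambda>i. (f i)\<^sup>2)" "summable (\<lambda>i. (g i)\<^sup>2)"
  shows "summable (\<lambda>i. f i * g i)"
proof (rule summable_comparison_test)
  show "summable (\<lambda>i. (f i)\<^sup>2 + (g i)\<^sup>2)"
    using assms by (rule summable_add)
  have "norm (f i * g i) \<le> (f i)\<^sup>2 + (g i)\<^sup>2" for i
  proof -
    have "0 \<le> (\<bar>f i\<bar> - \<bar>g i\<bar>)\<^sup>2" by simp
    then have "2 * (\<bar>f i\<bar> * \<bar>g i\<bar>) \<le> (f i)\<^sup>2 + (g i)\<^sup>2"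
      by (simp add: power2_diff)
    moreover have "0 \<le> \<bar>f i\<bar> * \<bar>g i\<bar>" by simp
    ultimately show ?thesis unfolding real_norm_def abs_mult by linarith
  qed
  then show "\<exists>N. \<forall>n\<ge>N. norm (f n * g n) \<le> (f n)\<^sup>2 + (g n)\<^sup>2" by blast
qed

lemma summable_add_sq:
  fixes f g :: "nat \<Rightarrow> real"
  assumes "summable (\<lambda>i. (f i)\<^sup>2)" "summable (\<lambda>i. (g i)\<^sup>2)"
  shows "summable (\<lambda>i. (f i + g i)\<^sup>2)"
  unfolding power2_sum
  by (intro summable_add assms) (simp add: mult.assoc summable_mult summable_mult_sq assms)

instantiation ell2 :: real_inner
begin

definition zero_ell2 :: ell2 where "0 = Ell2 (\<lambda>_. 0)"
definition plus_ell2 :: "ell2 \<Rightarrow> ell2 \<Rightarrow> ell2" where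
  "x + y = Ell2 (\<lambda>i. coord x i + coord y i)"
definition scaleR_ell2 :: "real \<Rightarrow> ell2 \<Rightarrow> ell2" where
  "c *\<^sub>R x = Ell2 (\<lambda>i. c * coord x i)"
definition uminus_ell2 :: "ell2 \<Rightarrow> ell2" where "- x = (-1) *\<^sub>R (x :: ell2)"
definition minus_ell2 :: "ell2 \<Rightarrow> ell2 \<Rightarrow> ell2" where "x - y = x + - (y :: ell2)"
definition inner_ell2 :: "ell2 \<Rightarrow> ell2 \<Rightarrow> real" where
  "inner x y = (\<Sum>i. coord x i * coord y i)"
definition norm_ell2 :: "ell2 \<Rightarrow> real" where "norm x = sqrt (inner x (x :: ell2))"
definition dist_ell2 :: "ell2 \<Rightarrow> ell2 \<Rightarrow> real" where "dist x y = norm (x - y :: ell2)"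
definition sgn_ell2 :: "ell2 \<Rightarrow> ell2" where "sgn x = inverse (norm x) *\<^sub>R (x :: ell2)"
definition uniformity_ell2 :: "(ell2 \<times> ell2) filter" where
  "uniformity = (INF e\<in>{0 <..}. principal {(x, y). dist x (y :: ell2) < e})"
definition open_ell2 :: "ell2 set \<Rightarrow> bool" where
  "open S \<longleftrightarrow> (\<forall>x\<in>S. \<forall>\<^sub>F (x', y) in uniformity. x' = (x :: ell2) \<longrightarrow> y \<in> S)"

lemma coord_0 [simp]: "coord 0 i = 0"
  by (simp add: zero_ell2_def coord_Ell2)

lemma coord_add [simp]: "coord (x + y) i = coord x i + coord y i"
  by (simp add: plus_ell2_def coord_Ell2 summable_add_sq)

lemma coord_scaleR [simp]: "coord (c *\<^sub>R x) i = c * coord x i"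
  by (simp add: scaleR_ell2_def coord_Ell2 power_mult_distrib summable_mult)

lemma coord_uminus [simp]: "coord (- x) i = - coord x i"
  by (simp add: uminus_ell2_def)

lemma coord_diff [simp]: "coord (x - y) i = coord x i - coord y i"
  by (simp add: minus_ell2_def)

instance
proof
  fix x y z :: ell2 and r :: real
  show "inner (x + y) z = inner x z + inner y z"
    by (simp add: inner_ell2_def distrib_right suminf_add summable_mult_sq)
  show "inner (r *\<^sub>R x) y = r * inner x y"
    by (simp add: inner_ell2_def mult.assoc suminf_mult summable_mult_sq)
  show "0 \<le> inner x x"
    unfolding inner_ell2_def by (intro suminf_nonneg summable_mult_sq) auto
  show "inner x x = 0 \<longleftrightarrow> x = 0"
    unfolding inner_ell2_def
    by (subst suminf_eq_zero_iff) (auto intro: summable_mult_sq simp: ell2_eq_iff)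
qed (auto simp: ell2_eq_iff algebra_simps inner_ell2_def norm_ell2_def dist_ell2_def
    sgn_ell2_def uniformity_ell2_def open_ell2_def)

end

lemma norm_ell2_eq: "norm x = sqrt (\<Sum>i. (coord x i)\<^sup>2)"
  by (simp add: norm_ell2_def inner_ell2_def power2_eq_square)

lemma norm_ell2_sq: "(norm x)\<^sup>2 = (\<Sum>i. (coord x i)\<^sup>2)"
  by (simp add: norm_ell2_eq suminf_nonneg)

lemma abs_coord_le: "\<bar>coord x i\<bar> \<le> norm x"
proof -
  have "(\<Sum>j\<in>{i}. (coord x j)\<^sup>2) \<le> (\<Sum>j. (coord x j)\<^sup>2)"
    by (intro sum_le_suminf) auto
  then have "\<bar>coord x i\<bar>\<^sup>2 \<le> (norm x)\<^sup>2"
    by (simp add: norm_ell2_sq)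
  then show ?thesis by (rule power2_le_imp_le) simp
qed

lemma bounded_linear_coord: "bounded_linear (\<lambda>x. coord x i)"
  by (rule bounded_linear_intro[where K = 1]) (auto simp: abs_coord_le)

lemma sum_coord_sq_le: "(\<Sum>i<n. (coord x i)\<^sup>2) \<le> (norm x)\<^sup>2"
  unfolding norm_ell2_sq by (intro sum_le_suminf) auto

instance ell2 :: banach
proof
  fix X :: "nat \<Rightarrow> ell2"
  assume X: "Cauchy X"
  have "Cauchy (\<lambda>n. coord (X n) i)" for i
    using bounded_linear.Cauchy[OF bounded_linear_coord X] .
  then have l: "(\<lambda>n. coord (X n) i) \<longlonglongrightarrow> lim (\<lambda>n. coord (X n) i)" for i
    by (intro iffD1[OF convergent_LIMSEQ_iff] real_Cauchy_convergent)
  define l where "l = (\<lambda>i. lim (\<lambda>n. coord (X n) i))"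
  have l: "(\<lambda>n. coord (X n) i) \<longlonglongrightarrow> l i" for i
    using l by (simp add: l_def)
  have key: "\<exists>N. \<forall>m\<ge>N. summable (\<lambda>i. (coord (X m) i - l i)\<^sup>2) \<and>
      (\<Sum>i. (coord (X m) i - l i)\<^sup>2) \<le> e\<^sup>2" if "e > 0" for e :: real
  proof -
    obtain N where N: "\<And>m n. m \<ge> N \<Longrightarrow> n \<ge> N \<Longrightarrow> norm (X m - X n) < e"
      using CauchyD[OF X \<open>e > 0\<close>] by blast
    have "summable (\<lambda>i. (coord (X m) i - l i)\<^sup>2) \<and> (\<Sum>i. (coord (X m) i - l i)\<^sup>2) \<le> e\<^sup>2"
      if "m \<ge> N" for m
    proof -
      have le: "(\<Sum>i<k. (coord (X m) i - l i)\<^sup>2) \<le> e\<^sup>2" for k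
      proof (rule LIMSEQ_le_const2)
        show "(\<lambda>n. \<Sum>i<k. (coord (X m) i - coord (X n) i)\<^sup>2)
            \<longlonglongrightarrow> (\<Sum>i<k. (coord (X m) i - l i)\<^sup>2)"
          by (intro tendsto_intros l)
        have "(\<Sum>i<k. (coord (X m) i - coord (X n) i)\<^sup>2) \<le> e\<^sup>2" if "n \<ge> N" for n
        proof -
          have "(\<Sum>i<k. (coord (X m) i - coord (X n) i)\<^sup>2) \<le> (norm (X m - X n))\<^sup>2"
            using sum_coord_sq_le[of "X m - X n" k] by simp
          also have "\<dots> \<le> e\<^sup>2"
            using N[OF \<open>m \<ge> N\<close> that] by (intro power_mono) auto
          finally show ?thesis .
        qed
        then show "\<exists>N. \<forall>n\<ge>N. (\<Sum>i<k. (coord (X m) i - coord (X n) i)\<^sup>2) \<le> e\<^sup>2" by blast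
      qed
      have "summable (\<lambda>i. (coord (X m) i - l i)\<^sup>2)"
        by (rule summableI_nonneg_bounded[where x = "e\<^sup>2"]) (auto simp: le)
      then show ?thesis using suminf_le_const[OF _ le] by blast
    qed
    then show ?thesis by blast
  qed
  obtain M where M: "summable (\<lambda>i. (coord (X M) i - l i)\<^sup>2)"
    using key[OF zero_less_one] by blast
  have "summable (\<lambda>i. (l i - coord (X M) i)\<^sup>2)"
    using M by (subst power2_commute)
  then have "summable (\<lambda>i. ((l i - coord (X M) i) + coord (X M) i)\<^sup>2)"
    by (rule summable_add_sq) simp
  then have cl: "coord (Ell2 l) = l" by (intro coord_Ell2) simp
  have "X \<longlonglongrightarrow> Ell2 l"
  proof (rule metric_LIMSEQ_I)
    fix r :: real assume "r > 0"
    then obtain N where N: "\<And>m. m \<ge> N \<Longrightarrow> (\<Sum>i. (coord (X m) i - l i)\<^sup>2) \<le> (r / 2)\<^sup>2"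
      using key[of "r / 2"] by (metis half_gt_zero)
    have "dist (X m) (Ell2 l) < r" if "m \<ge> N" for m
    proof -
      have "(norm (X m - Ell2 l))\<^sup>2 \<le> (r / 2)\<^sup>2"
        using N[OF that] by (simp add: norm_ell2_sq cl)
      then have "norm (X m - Ell2 l) \<le> r / 2"
        by (rule power2_le_imp_le) (use \<open>r > 0\<close> in simp)
      then show ?thesis using \<open>r > 0\<close> by (simp add: dist_norm)
    qed
    then show "\<exists>N. \<forall>m\<ge>N. dist (X m) (Ell2 l) < r"
      by (intro exI[of _ N] allI impI)
  qed
  then show "convergent X" by (auto simp: convergent_def)
qed

definition unit_ell2 :: "nat \<Rightarrow> ell2" where
  "unit_ell2 k = Ell2 (\<lambda>i. if i = k then 1 else 0)"

lemma coord_unit_ell2 [simp]: "coord (unit_ell2 k) i = (if i = k then 1 else 0)"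
proof -
  have "summable (\<lambda>i. (if i = k then 1 else 0 :: real)\<^sup>2)"
    by (rule summable_finite[of "{k}"]) auto
  then show ?thesis by (simp add: unit_ell2_def coord_Ell2)
qed

lemma coord_sum [simp]: "coord (\<Sum>a\<in>A. f a) i = (\<Sum>a\<in>A. coord (f a) i)"
  by (induction A rule: infinite_finite_induct) auto

lemma ell2_truncate: "(\<lambda>n. \<Sum>k<n. coord x k *\<^sub>R unit_ell2 k) \<longlonglongrightarrow> x"
proof -
  let ?S = "\<lambda>n. \<Sum>k<n. coord x k *\<^sub>R unit_ell2 k"
  have cS: "coord (?S n) i = (if i < n then coord x i else 0)" for n i
    by (simp add: if_distrib[of "\<lambda>t. coord x _ * t"] cong: if_cong)
  have eq: "(norm (?S n - x))\<^sup>2 = (\<Sum>i. (coord x i)\<^sup>2) - (\<Sum>i<n. (coord x i)\<^sup>2)" for n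
  proof -
    have "(\<lambda>i. if i < n then (coord x i)\<^sup>2 else 0) sums (\<Sum>i<n. (coord x i)\<^sup>2)"
      using sums_If_finite_set[of "{..<n}" "\<lambda>i. (coord x i)\<^sup>2"] by simp
    from sums_diff[OF summable_sums[OF summable_coord_sq[of x]] this]
    have "(\<lambda>i. (coord x i)\<^sup>2 - (if i < n then (coord x i)\<^sup>2 else 0))
        sums ((\<Sum>i. (coord x i)\<^sup>2) - (\<Sum>i<n. (coord x i)\<^sup>2))" .
    also have "(\<lambda>i. (coord x i)\<^sup>2 - (if i < n then (coord x i)\<^sup>2 else 0))
        = (\<lambda>i. (coord (?S n - x) i)\<^sup>2)"
      unfolding coord_diff cS by auto
    finally show ?thesis by (simp only: norm_ell2_sq sums_iff)
  qed
  have "(\<lambda>n. (\<Sum>i. (coord x i)\<^sup>2) - (\<Sum>i<n. (coord x i)\<^sup>2))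
      \<longlonglongrightarrow> (\<Sum>i. (coord x i)\<^sup>2) - (\<Sum>i. (coord x i)\<^sup>2)"
    by (intro tendsto_intros summable_LIMSEQ) simp
  then have "(\<lambda>n. (norm (?S n - x))\<^sup>2) \<longlonglongrightarrow> 0" by (simp only: eq) simp
  then have "(\<lambda>n. sqrt ((norm (?S n - x))\<^sup>2)) \<longlonglongrightarrow> sqrt 0" by (rule tendsto_real_sqrt)
  then have "(\<lambda>n. norm (?S n - x)) \<longlonglongrightarrow> 0" by simp
  then show ?thesis by (simp add: tendsto_norm_zero_iff LIM_zero_iff)
qed

instance ell2 :: second_countable_topology
proof
  define D :: "ell2 set" where
    "D = (\<lambda>qs. \<Sum>k<length qs. real_of_rat (qs ! k) *\<^sub>R unit_ell2 k) ` UNIV"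
  have "countable D" unfolding D_def by (intro countable_image) simp
  have dense: "\<exists>y\<in>D. dist y x < e" if "e > 0" for x :: ell2 and e :: real
  proof -
    have "\<exists>n. dist (\<Sum>k<n. coord x k *\<^sub>R unit_ell2 k) x < e / 2"
      using metric_LIMSEQ_D[OF ell2_truncate, of "e / 2" x] that by auto
    then obtain n where n: "dist (\<Sum>k<n. coord x k *\<^sub>R unit_ell2 k) x < e / 2" by blast
    have "\<exists>q. \<bar>real_of_rat q - coord x k\<bar> < e / (2 * (real n + 1))" for k
    proof -
      have "e / (2 * (real n + 1)) > 0" using that by simp
      then obtain r where "coord x k < real_of_rat r"
          "real_of_rat r < coord x k + e / (2 * (real n + 1))"
        using of_rat_dense[of "coord x k" "coord x k + e / (2 * (real n + 1))"] by auto
      then show ?thesis by (intro exI[of _ r]) linarith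
    qed
    then obtain q where q: "\<And>k. \<bar>real_of_rat (q k) - coord x k\<bar> < e / (2 * (real n + 1))"
      by metis
    have nu: "norm (unit_ell2 k) = 1" for k
    proof -
      have "(\<lambda>i. if i = k then (1::real) else 0) sums 1"
        using sums_single[of k "\<lambda>_. 1 :: real"] by simp
      moreover have "(\<lambda>i. (coord (unit_ell2 k) i)\<^sup>2) = (\<lambda>i. if i = k then (1::real) else 0)"
        by auto
      ultimately show ?thesis by (simp only: norm_ell2_eq sums_iff) simp
    qed
    define y where "y = (\<Sum>k<n. real_of_rat (q k) *\<^sub>R unit_ell2 k)"
    have "y = (\<Sum>k<length (map q [0..<n]). real_of_rat (map q [0..<n] ! k) *\<^sub>R unit_ell2 k)"
      by (auto simp: y_def)
    then have "y \<in> D" unfolding D_def by blast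
    have "dist y (\<Sum>k<n. coord x k *\<^sub>R unit_ell2 k)
        = norm (\<Sum>k<n. (real_of_rat (q k) - coord x k) *\<^sub>R unit_ell2 k)"
      by (simp add: y_def dist_norm sum_subtractf scaleR_diff_left)
    also have "\<dots> \<le> (\<Sum>k<n. \<bar>real_of_rat (q k) - coord x k\<bar>)"
      by (rule order_trans[OF norm_sum]) (simp add: nu)
    also have "\<dots> \<le> (\<Sum>k<n. e / (2 * (real n + 1)))"
      by (intro sum_mono less_imp_le q)
    also have "\<dots> \<le> e / 2" using that by (simp add: field_simps)
    finally have "dist y x < e"
      using n dist_triangle[of y x "\<Sum>k<n. coord x k *\<^sub>R unit_ell2 k"] by linarith
    with \<open>y \<in> D\<close> show ?thesis by blast
  qed
  define B where "B = (\<lambda>(y, n). ball y (1 / real (Suc n))) ` (D \<times> UNIV)"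
  have "countable B" unfolding B_def using \<open>countable D\<close> by (intro countable_image) auto
  moreover have "topological_basis B"
  proof (rule topological_basisI)
    show "open b" if "b \<in> B" for b using that by (auto simp: B_def)
    fix S :: "ell2 set" and x assume "open S" "x \<in> S"
    then obtain e where e: "e > 0" "ball x e \<subseteq> S" by (auto simp: open_contains_ball)
    obtain n where n: "1 / real (Suc n) < e / 2"
      using e by (metis half_gt_zero nat_approx_posE)
    obtain y where y: "y \<in> D" "dist y x < 1 / real (Suc n)"
      using dense[of "1 / real (Suc n)" x] by auto
    have "ball y (1 / real (Suc n)) \<subseteq> S"
    proof
      fix z assume "z \<in> ball y (1 / real (Suc n))"
      then have "dist x z < e"
        using y n dist_triangle[of x z y] by (simp add: dist_commute)
      then show "z \<in> S" using e by auto
    qed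
    then show "\<exists>B'\<in>B. x \<in> B' \<and> B' \<subseteq> S"
      using y by (intro bexI[of _ "ball y (1 / real (Suc n))"]) (auto simp: B_def)
  qed
  ultimately show "\<exists>B :: ell2 set set. countable B \<and> open = generate_topology B"
    using topological_basis_imp_subbasis by blast
qed

definition Rn :: "nat \<Rightarrow> ell2 set" where
  "Rn d = {x. \<forall>i\<ge>d. coord x i = 0}"

lemma norm_Rn: "x \<in> Rn d \<Longrightarrow> norm x = L2_set (coord x) {..<d}"
  unfolding norm_ell2_eq L2_set_def by (subst suminf_finite[of "{..<d}"]) (auto simp: Rn_def)

abbreviation borel_Rn :: "nat \<Rightarrow> ell2 measure" where
  "borel_Rn d \<equiv> restrict_space borel (Rn d)"

definition unit_cube :: "nat \<Rightarrow> ell2 set" where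
  "unit_cube d = {x \<in> Rn d. \<forall>i<d. 0 \<le> coord x i \<and> coord x i \<le> 1}"


section \<open>Higher derivatives on $R^d$\<close>

text \<open>
  \<open>Dk d f [v\<^sub>1, \<dots>, v\<^sub>k] x\<close> is $D^k f(x)[v_1,\dots,v_k]$ for $v_i \in R^d$, $x \in R^d$.
\<close>

fun Dk :: "nat \<Rightarrow> (ell2 \<Rightarrow> 'b::real_normed_vector) \<Rightarrow> ell2 list \<Rightarrow> ell2 \<Rightarrow> 'b" where
  "Dk d f [] = f"
| "Dk d f (v # vs) = (\<lambda>x. frechet_derivative (Dk d f vs) (at x within Rn d) v)"

text \<open>
  The space of $k$-linear maps on $R^d$ is finite-dimensional, so differentiability (continuity)
  of $D^k f$ as a map into this space is that of $D^k f(\cdot)[v_1,\dots,v_k]$ for all fixed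
  $v_1,\dots,v_k$.
\<close>

definition k_times_differentiable :: "nat \<Rightarrow> nat \<Rightarrow> (ell2 \<Rightarrow> 'b::real_normed_vector) \<Rightarrow> bool" where
  "k_times_differentiable d k f \<longleftrightarrow>
     (\<forall>vs. set vs \<subseteq> Rn d \<and> length vs < k \<longrightarrow> Dk d f vs differentiable_on Rn d)"

definition k_times_cont_differentiable ::
    "nat \<Rightarrow> nat \<Rightarrow> (ell2 \<Rightarrow> 'b::real_normed_vector) \<Rightarrow> bool" where
  "k_times_cont_differentiable d k f \<longleftrightarrow> k_times_differentiable d k f \<and>
     (\<forall>vs. set vs \<subseteq> Rn d \<and> length vs \<le> k \<longrightarrow> continuous_on (Rn d) (Dk d f vs))"

definition opnorm :: "nat \<Rightarrow> nat \<Rightarrow> (ell2 list \<Rightarrow> 'b::real_normed_vector) \<Rightarrow> ennreal" where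
  "opnorm d k A =
     (SUP vs \<in> {vs. length vs = k \<and> (\<forall>v\<in>set vs. v \<in> Rn d \<and> norm v = 1)}. ennreal (norm (A vs)))"


section \<open>Model\<close>

definition smooth_class :: "nat \<Rightarrow> nat \<Rightarrow> (nat \<Rightarrow> real) \<Rightarrow> (ell2 \<Rightarrow> ell2) set" where
  "smooth_class d \<beta> L = {f. f \<in> Rn d \<rightarrow> Rn d \<and> k_times_cont_differentiable d \<beta> f \<and>
     (\<forall>k\<le>\<beta>. (SUP x\<in>Rn d. opnorm d k (\<lambda>vs. Dk d f vs x)) \<le> ennreal (L k))}"

definition flow :: "nat \<Rightarrow> (ell2 \<Rightarrow> ell2) \<Rightarrow> ell2 \<Rightarrow> real \<Rightarrow> ell2" where
  "flow d f x = (THE u. u 0 = x \<and> range u \<subseteq> Rn d \<and>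
     (\<forall>t. (u has_vector_derivative f (u t)) (at t)))"

text \<open>
  Independent noise vectors enter only through their joint law, which is the product of the
  individual laws \<open>\<nu>\<close>.
\<close>

definition noise_law :: "nat \<Rightarrow> real \<Rightarrow> ell2 measure \<Rightarrow> bool" where
  "noise_law d \<sigma> \<nu> \<longleftrightarrow> prob_space \<nu> \<and> sets \<nu> = sets (borel_Rn d) \<and>
     integrable \<nu> (\<lambda>e. e) \<and> (\<integral>e. e \<partial>\<nu>) = 0 \<and>
     (\<integral>\<^sup>+e. ennreal ((norm e)\<^sup>2) \<partial>\<nu>) \<le> ennreal (\<sigma>\<^sup>2)"

definition observation ::
    "nat \<Rightarrow> (ell2 \<Rightarrow> ell2) \<Rightarrow> (nat \<Rightarrow> ell2) \<Rightarrow> real \<Rightarrow> (nat \<times> nat \<Rightarrow> ell2) \<Rightarrow> nat \<Rightarrow> nat \<Rightarrow> ell2" where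
  "observation d f x \<Delta>t \<epsilon> j i = flow d f (x j) (real i * \<Delta>t) + \<epsilon> (j, i)"


section \<open>Standard regression\<close>

definition holder_class :: "nat \<Rightarrow> nat \<Rightarrow> real \<Rightarrow> (ell2 \<Rightarrow> ell2) set" where
  "holder_class d \<beta> L = {g. g \<in> Rn d \<rightarrow> Rn d \<and>
     (\<forall>k<d. k_times_differentiable d (\<beta> - 1) (\<lambda>x. coord (g x) k) \<and>
       (\<forall>x\<in>Rn d. \<forall>y\<in>Rn d.
          opnorm d (\<beta> - 1) (\<lambda>vs. Dk d (\<lambda>x. coord (g x) k) vs x - Dk d (\<lambda>x. coord (g x) k) vs y)
            \<le> ennreal (L * norm (x - y))))}"

type_synonym estimator = "(nat \<Rightarrow> ell2 \<times> ell2) \<times> ell2 \<Rightarrow> ell2"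

definition regression_estimator :: "nat \<Rightarrow> nat \<Rightarrow> estimator \<Rightarrow> bool" where
  "regression_estimator d m E \<longleftrightarrow>
     E \<in> ((\<Pi>\<^sub>M j\<in>{1..m}. borel_Rn d \<Otimes>\<^sub>M borel_Rn d) \<Otimes>\<^sub>M borel_Rn d) \<rightarrow>\<^sub>M borel_Rn d"

definition max_risk ::
    "nat \<Rightarrow> nat \<Rightarrow> real \<Rightarrow> real \<Rightarrow> nat \<Rightarrow> estimator \<Rightarrow> (nat \<Rightarrow> ell2) \<Rightarrow> ennreal" where
  "max_risk d \<beta> L \<sigma> m E x =
     (SUP x\<^sub>0 \<in> unit_cube d.
      SUP (g, \<nu>) \<in> holder_class d \<beta> L \<times> {\<nu>. \<forall>j\<in>{1..m}. noise_law d \<sigma> (\<nu> j)}.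
        \<integral>\<^sup>+\<xi>. ennreal ((norm (E (\<lambda>j\<in>{1..m}. (x j, g (x j) + \<xi> j), x\<^sub>0) - g x\<^sub>0))\<^sup>2)
          \<partial>(\<Pi>\<^sub>M j\<in>{1..m}. \<nu> j))"


section \<open>Estimator of the model function\<close>

definition iota_hat ::
    "nat \<Rightarrow> estimator \<Rightarrow> (nat \<Rightarrow> ell2) \<Rightarrow> (nat \<Rightarrow> nat \<Rightarrow> ell2) \<Rightarrow> nat \<Rightarrow> ell2 \<Rightarrow> ell2" where
  "iota_hat m E x Y i x\<^sub>0 =
     (if i = 0 then 0 else E (\<lambda>j\<in>{1..m}. (x j, Y j i - x j), x\<^sub>0))"

text \<open>The polynomial of degree at most \<open>\<beta>\<close> with vector coefficients \<open>a k\<close>, that is, each of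
  its components is a polynomial of degree at most \<open>\<beta>\<close>.\<close>

definition interpolation_poly :: "nat \<Rightarrow> nat \<Rightarrow> real \<Rightarrow> (nat \<Rightarrow> ell2) \<Rightarrow> real \<Rightarrow> ell2" where
  "interpolation_poly d \<beta> \<Delta>t y = (THE p.
     (\<exists>a. (\<forall>k. a k \<in> Rn d) \<and> p = (\<lambda>t. \<Sum>k\<le>\<beta>. t ^ k *\<^sub>R a k)) \<and>
     (\<forall>i\<le>\<beta>. p (real i * \<Delta>t) = y i))"

definition p_hat :: "nat \<Rightarrow> nat \<Rightarrow> nat \<Rightarrow> estimator \<Rightarrow> (nat \<Rightarrow> ell2) \<Rightarrow> real \<Rightarrow>
    (nat \<Rightarrow> nat \<Rightarrow> ell2) \<Rightarrow> ell2 \<Rightarrow> real \<Rightarrow> ell2" where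
  "p_hat d \<beta> m E x \<Delta>t Y x\<^sub>0 = interpolation_poly d \<beta> \<Delta>t (\<lambda>i. iota_hat m E x Y i x\<^sub>0)"

definition f_hat :: "nat \<Rightarrow> nat \<Rightarrow> nat \<Rightarrow> estimator \<Rightarrow> (nat \<Rightarrow> ell2) \<Rightarrow> real \<Rightarrow>
    (nat \<Rightarrow> nat \<Rightarrow> ell2) \<Rightarrow> ell2 \<Rightarrow> ell2" where
  "f_hat d \<beta> m E x \<Delta>t Y x\<^sub>0 = vector_derivative (p_hat d \<beta> m E x \<Delta>t Y x\<^sub>0) (at 0)"

definition mean_squared_error :: "nat \<Rightarrow> nat \<Rightarrow> nat \<Rightarrow> (ell2 \<Rightarrow> ell2) \<Rightarrow> (nat \<Rightarrow> ell2) \<Rightarrow> real \<Rightarrow>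
    (nat \<Rightarrow> nat \<Rightarrow> ell2 measure) \<Rightarrow> estimator \<Rightarrow> ell2 \<Rightarrow> ennreal" where
  "mean_squared_error d \<beta> m f x \<Delta>t \<nu> E x\<^sub>0 =
     (\<integral>\<^sup>+\<epsilon>. ennreal ((norm (f_hat d \<beta> m E x \<Delta>t (observation d f x \<Delta>t \<epsilon>) x\<^sub>0 - f x\<^sub>0))\<^sup>2)
        \<partial>(\<Pi>\<^sub>M (j, i) \<in> {1..m} \<times> {1..\<beta>}. \<nu> j i))"


section \<open>Asymptotic comparison\<close>

text \<open>
  In \<open>ennreal\<close>, \<open>a / \<infinity> = 0\<close> for all \<open>a\<close> (so a comparison with an infinite risk is void) and
  \<open>a / 0 = \<infinity>\<close> for \<open>a \<noteq> 0\<close>.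
\<close>

definition asymp_le :: "(nat \<Rightarrow> ennreal) \<Rightarrow> (nat \<Rightarrow> ennreal) \<Rightarrow> bool" (infix \<open>\<preceq>\<^sub>\<infinity>\<close> 50) where
  "a \<preceq>\<^sub>\<infinity> b \<longleftrightarrow> limsup (\<lambda>n. a n / b n) < \<infinity>"

text \<open>
  Sequences are indexed by the number \<open>m\<close> of initial points; the number of observations is
  \<open>n = \<beta> * m\<close> with \<open>\<beta>\<close> fixed, so \<open>n \<rightarrow> \<infinity>\<close> means \<open>m \<rightarrow> \<infinity>\<close>.

  A constant \<open>C\<close> that serves all bounded sequences \<open>\<Delta>t\<close> at once does not exist, since the
  Lipschitz constant of \<open>x \<mapsto> flow d f x t - x\<close> can grow exponentially in \<open>t\<close>.  In the theorem,
  \<open>T\<close> bounds the limes superior implicit in \<open>\<Delta>t \<preceq>\<^sub>\<infinity> 1\<close>, and \<open>C\<close> is chosen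
  after \<open>\<beta>\<close>, \<open>L\<close> and \<open>T\<close> only.
\<close>

end

theory Submission
  imports Defs
begin

text \<open>
  The derivative at $0$ of the interpolating polynomial is $\Delta t^{-1} \sum_i w_i \hat\iota_i$
  with weights that depend on $\beta$ only and are exact on polynomials of degree at most $\beta$.
  Hence the error splits into the regression errors at the times $t_i$, multiplied by
  $\Delta t^{-1}$, and the Taylor remainder of the trajectory, which is of order
  $\Delta t^{\beta}$ because $\dot u = f \circ u$ has $\beta$ bounded derivatives.

  It remains to see that the increments of the flow over a time $t$ lie in the Hoelder class with
  constant $C t$.  By the formula of Faa di Bruno and a discrete Gronwall argument, the
  derivatives up to order $\beta$ of the increments of the Euler scheme are bounded by $C t$
  independently of the step size and the dimension.  The scheme converges uniformly to the flow,
  and by Landau's inequality its derivatives up to order $\beta - 1$ converge uniformly as well,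
  so that the bound on the last derivative becomes a Lipschitz bound in the limit.
\<close>

section \<open>Derivatives on $R^d$\<close>

text \<open>The obstacle is a Hoelder bound for the increments that is proportional to
  \<open>t\<close> and free of \<open>d\<close>. Differentiating the flow in its initial value would
  call for linearised equations of every order along a trajectory. An Euler iterate is a finite
  composition of maps \<open>x + h f(x)\<close>, so its derivatives exist by the chain rule and only
  bounds have to be found. The factor \<open>t\<close> stems from the increments: their derivatives
  vanish at time 0, whereas those of the flow start from the identity. Independence of the dimension
  comes from estimating \<open>Dk\<close> as a multilinear form on unit vectors; coordinates serve
  only to differentiate expressions with varying arguments and are contracted again before norms are
  taken. On the side of the approximation in time, a trajectory has one derivative more than the
  field, and this extra order pays for the division by the time step.\<close>

lemma subspace_Rn: "subspace (Rn d)"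
  by (auto simp: subspace_def Rn_def)

lemmas Rn_add = subspace_add[OF subspace_Rn]
  and Rn_diff = subspace_diff[OF subspace_Rn]
  and Rn_scale = subspace_scale[OF subspace_Rn]
  and Rn_0 [simp] = subspace_0[OF subspace_Rn]

lemma convex_Rn: "convex (Rn d)"
  by (rule subspace_imp_convex[OF subspace_Rn])

lemma unit_ell2_in_Rn: "k < d \<Longrightarrow> unit_ell2 k \<in> Rn d"
  by (auto simp: Rn_def)

lemma norm_unit_ell2 [simp]: "norm (unit_ell2 k) = 1"
proof -
  have "norm (unit_ell2 k) = L2_set (coord (unit_ell2 k)) {..<Suc k}"
    by (rule norm_Rn[OF unit_ell2_in_Rn]) simp
  also have "\<dots> = 1"
    by (simp add: L2_set_def)
  finally show ?thesis .
qed

definition proj :: "nat \<Rightarrow> ell2 \<Rightarrow> ell2" where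
  "proj d x = (\<Sum>i<d. coord x i *\<^sub>R unit_ell2 i)"

lemma coord_proj [simp]: "coord (proj d x) i = (if i < d then coord x i else 0)"
  by (simp add: proj_def if_distrib[of "\<lambda>t. coord x _ * t"] cong: if_cong)

lemma proj_in_Rn [simp]: "proj d x \<in> Rn d"
  by (simp add: Rn_def)

lemma proj_id [simp]: "x \<in> Rn d \<Longrightarrow> proj d x = x"
  by (auto simp: Rn_def ell2_eq_iff)

lemma norm_proj_le: "norm (proj d x) \<le> norm x"
proof -
  have "(norm (proj d x))\<^sup>2 \<le> (norm x)\<^sup>2"
    unfolding norm_ell2_sq by (rule suminf_le[OF _ summable_coord_sq summable_coord_sq]) auto
  then show ?thesis by (rule power2_le_imp_le) simp
qed

lemma bounded_linear_proj: "bounded_linear (proj d)"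
  by (rule bounded_linear_intro[where K = 1]) (auto simp: ell2_eq_iff norm_proj_le)

lemma Rn_eq_sum: "x \<in> Rn d \<Longrightarrow> x = (\<Sum>i<d. coord x i *\<^sub>R unit_ell2 i)"
  by (metis proj_def proj_id)

text \<open>\<open>Rn d\<close> has no interior points in \<open>ell2\<close>, so a derivative
  within it is not unique as a linear map on \<open>ell2\<close>, and
  \<open>frechet_derivative\<close> picks an arbitrary one. Its values in directions of
  \<open>Rn d\<close> are unique: along the line through \<open>x\<close> in direction
  \<open>v\<close>, every candidate becomes an ordinary derivative in one real variable.\<close>

lemma frechet_derivative_Rn_eq:
  assumes "(f has_derivative f') (at x within Rn d)" "x \<in> Rn d" "v \<in> Rn d"
  shows "frechet_derivative f (at x within Rn d) v = f' v"
proof -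
  have line: "((\<lambda>s. f (x + s *\<^sub>R v)) has_derivative (\<lambda>s. D (s *\<^sub>R v))) (at (0::real))"
    if "(f has_derivative D) (at x within Rn d)" for D
  proof -
    have "(f has_derivative D) (at (x + 0 *\<^sub>R v) within range (\<lambda>s. x + s *\<^sub>R v))"
      using that by (auto intro!: has_derivative_subset[where s = "Rn d"] Rn_add Rn_scale assms)
    then show ?thesis
      by (rule has_derivative_in_compose[rotated]) (auto intro!: derivative_eq_intros)
  qed
  have "(f has_derivative frechet_derivative f (at x within Rn d)) (at x within Rn d)"
    using assms(1) frechet_derivative_works differentiableI by blast
  then have "(\<lambda>s. frechet_derivative f (at x within Rn d) (s *\<^sub>R v)) = (\<lambda>s. f' (s *\<^sub>R v))"
    using line assms(1) has_derivative_unique by blast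
  then have "frechet_derivative f (at x within Rn d) (1 *\<^sub>R v) = f' (1 *\<^sub>R v)"
    by metis
  then show ?thesis by simp
qed

text \<open>A normal form that annihilates the coordinates of index at least \<open>d\<close>. It
  allows the derivative of \<open>Dk d f vs\<close> to be written by means of \<open>Dk\<close>
  itself, which is meaningful in directions of \<open>Rn d\<close> only.\<close>

lemma has_derivative_Rn_proj:
  assumes "(f has_derivative D) (at x within Rn d)" "x \<in> Rn d"
  shows "(f has_derivative (\<lambda>h. D (proj d h))) (at x within Rn d)"
proof -
  have "(f has_derivative D) (at (proj d x) within proj d ` Rn d)"
    using assms by (auto intro: has_derivative_subset)
  then have "((\<lambda>x. f (proj d x)) has_derivative (\<lambda>h. D (proj d h))) (at x within Rn d)"
    by (rule has_derivative_in_compose[rotated])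
      (rule bounded_linear_imp_has_derivative[OF bounded_linear_proj])
  then show ?thesis
    by (rule has_derivative_transform[rotated -1]) (auto simp: assms)
qed

lemma Dk_Cons_eq:
  assumes "(Dk d f vs has_derivative D) (at x within Rn d)" "x \<in> Rn d" "v \<in> Rn d"
  shows "Dk d f (v # vs) x = D v"
  using frechet_derivative_Rn_eq[OF assms] by simp

lemma Dk_has_derivative:
  assumes "Dk d f vs differentiable_on Rn d" "x \<in> Rn d"
  shows "(Dk d f vs has_derivative (\<lambda>h. Dk d f (proj d h # vs) x)) (at x within Rn d)"
proof -
  have "(Dk d f vs has_derivative frechet_derivative (Dk d f vs) (at x within Rn d))
      (at x within Rn d)"
    using assms frechet_derivative_works unfolding differentiable_on_def by blast
  then show ?thesis using has_derivative_Rn_proj assms(2) by fastforce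
qed

section \<open>Calculus rules for iterated directional derivatives\<close>

lemma Dk_append: "Dk d f (us @ vs) = Dk d (Dk d f vs) us"
  by (induction us) auto

lemma k_times_differentiableD:
  "k_times_differentiable d k f \<Longrightarrow> set vs \<subseteq> Rn d \<Longrightarrow> length vs < k \<Longrightarrow>
    Dk d f vs differentiable_on Rn d"
  by (simp add: k_times_differentiable_def)

lemma k_times_differentiable_has_derivative:
  "k_times_differentiable d k f \<Longrightarrow> set vs \<subseteq> Rn d \<Longrightarrow> length vs < k \<Longrightarrow> x \<in> Rn d \<Longrightarrow>
    (Dk d f vs has_derivative (\<lambda>h. Dk d f (proj d h # vs) x)) (at x within Rn d)"
  by (intro Dk_has_derivative k_times_differentiableD)

lemma k_times_differentiable_mono:
  "k_times_differentiable d k f \<Longrightarrow> j \<le> k \<Longrightarrow> k_times_differentiable d j f"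
  by (simp add: k_times_differentiable_def)

text \<open>Verification of a guessed formula: a family \<open>G\<close> indexed by lists of
  directions and closed under differentiation must be the family of iterated derivatives.
  Differentiability and the formula come together, since the former is known for the guess and is
  transferred by the latter. The rules for linear images, sums, the identity and compositions are
  instances.\<close>

lemma Dk_eqI:
  fixes f :: "ell2 \<Rightarrow> 'b::real_normed_vector"
  assumes f: "\<And>x. x \<in> Rn d \<Longrightarrow> f x = G [] x"
    and G: "\<And>vs x. set vs \<subseteq> Rn d \<Longrightarrow> length vs < k \<Longrightarrow> x \<in> Rn d \<Longrightarrow>
      \<exists>D. (G vs has_derivative D) (at x within Rn d) \<and> (\<forall>v\<in>Rn d. D v = G (v # vs) x)"
  shows "k_times_differentiable d k f"
    and "set vs \<subseteq> Rn d \<Longrightarrow> length vs \<le> k \<Longrightarrow> x \<in> Rn d \<Longrightarrow> Dk d f vs x = G vs x"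
proof -
  have step: "\<exists>D. (Dk d f vs has_derivative D) (at x within Rn d) \<and> (\<forall>v\<in>Rn d. D v = G (v # vs) x)"
    if eq: "\<And>x. x \<in> Rn d \<Longrightarrow> Dk d f vs x = G vs x"
      and vs: "set vs \<subseteq> Rn d" "length vs < k" "x \<in> Rn d" for vs x
  proof -
    obtain D where D: "(G vs has_derivative D) (at x within Rn d)" "\<forall>v\<in>Rn d. D v = G (v # vs) x"
      using G[OF vs] by blast
    have "(Dk d f vs has_derivative D) (at x within Rn d)"
      by (rule has_derivative_transform[rotated -1, OF D(1)]) (auto simp: eq vs)
    with D(2) show ?thesis by blast
  qed
  have eq: "set vs \<subseteq> Rn d \<Longrightarrow> length vs \<le> k \<Longrightarrow> x \<in> Rn d \<Longrightarrow> Dk d f vs x = G vs x" for vs x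
  proof (induction vs arbitrary: x)
    case Nil
    then show ?case by (simp add: f)
  next
    case (Cons v vs)
    obtain D where "(Dk d f vs has_derivative D) (at x within Rn d)" "\<forall>v\<in>Rn d. D v = G (v # vs) x"
      using step[of vs x] Cons by auto
    then show ?case using Dk_Cons_eq[of d f vs D x v] Cons.prems by simp
  qed
  then show "set vs \<subseteq> Rn d \<Longrightarrow> length vs \<le> k \<Longrightarrow> x \<in> Rn d \<Longrightarrow> Dk d f vs x = G vs x" .
  show "k_times_differentiable d k f"
    unfolding k_times_differentiable_def differentiable_on_def
    using step eq by (metis differentiableI nless_le)
qed

lemma Dk_cong:
  assumes fg: "\<And>x. x \<in> Rn d \<Longrightarrow> f x = g x" and "x \<in> Rn d"
  shows "Dk d f vs x = Dk d g vs x"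
  using assms(2)
proof (induction vs arbitrary: x)
  case (Cons v vs)
  have "(Dk d f vs has_derivative D) (at x within Rn d) \<longleftrightarrow>
      (Dk d g vs has_derivative D) (at x within Rn d)" for D
    using has_derivative_transform[OF Cons.prems, of "Dk d f vs" "Dk d g vs"]
      has_derivative_transform[OF Cons.prems, of "Dk d g vs" "Dk d f vs"] Cons.IH by metis
  then show ?case by (simp add: frechet_derivative_def)
qed (simp add: fg)

lemma Dk_linear_image:
  assumes f: "k_times_differentiable d k f" and A: "bounded_linear A"
  shows "k_times_differentiable d k (\<lambda>x. A (f x))"
    and "set vs \<subseteq> Rn d \<Longrightarrow> length vs \<le> k \<Longrightarrow> x \<in> Rn d \<Longrightarrow> Dk d (\<lambda>x. A (f x)) vs x = A (Dk d f vs x)"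
proof -
  have *: "\<exists>D. ((\<lambda>x. A (Dk d f vs x)) has_derivative D) (at x within Rn d) \<and>
      (\<forall>v\<in>Rn d. D v = A (Dk d f (v # vs) x))"
    if "set vs \<subseteq> Rn d" "length vs < k" "x \<in> Rn d" for vs x
    using bounded_linear.has_derivative[OF A k_times_differentiable_has_derivative[OF f that]]
    by (intro exI conjI) (assumption, simp)
  show "k_times_differentiable d k (\<lambda>x. A (f x))"
    by (rule Dk_eqI(1)[where G = "\<lambda>vs x. A (Dk d f vs x)", OF _ *]) auto
  show "set vs \<subseteq> Rn d \<Longrightarrow> length vs \<le> k \<Longrightarrow> x \<in> Rn d \<Longrightarrow> Dk d (\<lambda>x. A (f x)) vs x = A (Dk d f vs x)"
    by (rule Dk_eqI(2)[where G = "\<lambda>vs x. A (Dk d f vs x)", OF _ *]) auto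
qed

lemma Dk_add_scaled:
  assumes f: "k_times_differentiable d k f" and g: "k_times_differentiable d k g"
  shows "k_times_differentiable d k (\<lambda>x. f x + c *\<^sub>R g x)"
    and "set vs \<subseteq> Rn d \<Longrightarrow> length vs \<le> k \<Longrightarrow> x \<in> Rn d \<Longrightarrow>
      Dk d (\<lambda>x. f x + c *\<^sub>R g x) vs x = Dk d f vs x + c *\<^sub>R Dk d g vs x"
proof -
  have *: "\<exists>D. ((\<lambda>x. Dk d f vs x + c *\<^sub>R Dk d g vs x) has_derivative D) (at x within Rn d) \<and>
      (\<forall>v\<in>Rn d. D v = Dk d f (v # vs) x + c *\<^sub>R Dk d g (v # vs) x)"
    if "set vs \<subseteq> Rn d" "length vs < k" "x \<in> Rn d" for vs x
    using has_derivative_add[OF k_times_differentiable_has_derivative[OF f that]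
        has_derivative_scaleR_right[OF k_times_differentiable_has_derivative[OF g that], of c]]
    by (intro exI conjI) (assumption, simp)
  show "k_times_differentiable d k (\<lambda>x. f x + c *\<^sub>R g x)"
    by (rule Dk_eqI(1)[where G = "\<lambda>vs x. Dk d f vs x + c *\<^sub>R Dk d g vs x", OF _ *]) auto
  show "set vs \<subseteq> Rn d \<Longrightarrow> length vs \<le> k \<Longrightarrow> x \<in> Rn d \<Longrightarrow>
      Dk d (\<lambda>x. f x + c *\<^sub>R g x) vs x = Dk d f vs x + c *\<^sub>R Dk d g vs x"
    by (rule Dk_eqI(2)[where G = "\<lambda>vs x. Dk d f vs x + c *\<^sub>R Dk d g vs x", OF _ *]) auto
qed

lemma Dk_id:
  shows "k_times_differentiable d k (\<lambda>x. x)"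
    and "set vs \<subseteq> Rn d \<Longrightarrow> x \<in> Rn d \<Longrightarrow>
      Dk d (\<lambda>x. x) vs x = (case vs of [] \<Rightarrow> x | [v] \<Rightarrow> v | _ \<Rightarrow> 0)"
proof -
  let ?G = "\<lambda>vs x::ell2. case vs of [] \<Rightarrow> x | [v] \<Rightarrow> v | _ \<Rightarrow> 0"
  have *: "\<exists>D. (?G vs has_derivative D) (at x within Rn d) \<and> (\<forall>v\<in>Rn d. D v = ?G (v # vs) x)" for vs x
  proof (cases vs)
    case Nil
    then show ?thesis by (intro exI[of _ "\<lambda>v. v"]) (auto intro: derivative_eq_intros)
  next
    case (Cons v ws)
    then show ?thesis by (intro exI[of _ "\<lambda>v. 0"]) (auto intro: derivative_eq_intros split: list.split)
  qed
  show "k_times_differentiable d k (\<lambda>x. x)"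
    by (rule Dk_eqI(1)[where G = ?G, OF _ *]) auto
  show "set vs \<subseteq> Rn d \<Longrightarrow> x \<in> Rn d \<Longrightarrow>
      Dk d (\<lambda>x. x) vs x = (case vs of [] \<Rightarrow> x | [v] \<Rightarrow> v | _ \<Rightarrow> 0)"
    by (rule Dk_eqI(2)[where G = ?G and k = "length vs", OF _ *]) auto
qed

text \<open>On \<open>Rn d'\<close> each coordinate of \<open>g\<close> of index at least
  \<open>d\<close> is the zero function, and taking coordinates commutes with
  \<open>Dk\<close>.\<close>

lemma Dk_in_Rn:
  assumes g: "k_times_differentiable d' k g" "g \<in> Rn d' \<rightarrow> Rn d"
    and "set vs \<subseteq> Rn d'" "length vs \<le> k" "x \<in> Rn d'"
  shows "Dk d' g vs x \<in> Rn d"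
proof -
  have "coord (Dk d' g vs x) i = 0" if "i \<ge> d" for i
  proof -
    have "coord (Dk d' g vs x) i = Dk d' (\<lambda>x. coord (g x) i) vs x"
      using Dk_linear_image(2)[OF g(1) bounded_linear_coord assms(3-5)] by simp
    also have "\<dots> = Dk d' (\<lambda>x. 0) vs x"
      by (rule Dk_cong) (use g(2) that assms(5) in \<open>auto simp: Rn_def\<close>)
    also have "\<dots> = 0"
      by (rule Dk_eqI(2)[where G = "\<lambda>vs x. 0" and k = k])
        (use assms in \<open>auto intro!: exI[of _ "\<lambda>_. 0"]\<close>)
    finally show ?thesis .
  qed
  then show ?thesis by (simp add: Rn_def)
qed

section \<open>Multilinearity of the iterated derivatives and their norms\<close>

lemma Dk_slot_linear:
  assumes f: "k_times_differentiable d k f"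
    and vs: "set vs \<subseteq> Rn d" "a \<in> Rn d" "b \<in> Rn d"
  shows "set us \<subseteq> Rn d \<Longrightarrow> length (us @ a # vs) \<le> k \<Longrightarrow> x \<in> Rn d \<Longrightarrow>
    Dk d f (us @ (a + c *\<^sub>R b) # vs) x = Dk d f (us @ a # vs) x + c *\<^sub>R Dk d f (us @ b # vs) x"
proof (induction us arbitrary: x)
  case Nil
  have D: "(Dk d f vs has_derivative (\<lambda>h. Dk d f (proj d h # vs) x)) (at x within Rn d)"
    using f vs Nil by (intro k_times_differentiable_has_derivative) auto
  have "Dk d f (proj d (a + c *\<^sub>R b) # vs) x = Dk d f (proj d a # vs) x + c *\<^sub>R Dk d f (proj d b # vs) x"
    using has_derivative_linear[OF D] linear_add linear_scale by fastforce
  then show ?case using vs by (simp add: Rn_add Rn_scale del: Dk.simps)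
next
  case (Cons u us)
  have D: "(Dk d f (us @ w # vs) has_derivative (\<lambda>h. Dk d f (proj d h # us @ w # vs) x))
      (at x within Rn d)" if "w \<in> Rn d" for w
    using f vs Cons.prems that by (intro k_times_differentiable_has_derivative) auto
  \<comment> \<open>The identity for the shorter list holds at every point of \<open>Rn d\<close>,
    so both of its sides may be differentiated once more.\<close>
  have "((\<lambda>x. Dk d f (us @ a # vs) x + c *\<^sub>R Dk d f (us @ b # vs) x) has_derivative
      (\<lambda>h. Dk d f (proj d h # us @ a # vs) x + c *\<^sub>R Dk d f (proj d h # us @ b # vs) x))
      (at x within Rn d)"
    by (intro has_derivative_add has_derivative_scaleR_right D vs)
  then have "(Dk d f (us @ (a + c *\<^sub>R b) # vs) has_derivative
      (\<lambda>h. Dk d f (proj d h # us @ a # vs) x + c *\<^sub>R Dk d f (proj d h # us @ b # vs) x))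
      (at x within Rn d)"
    by (rule has_derivative_transform[rotated -1]) (use Cons in auto)
  from Dk_Cons_eq[OF this, of u] show ?case using Cons.prems by (simp del: Dk.simps)
qed

lemma Dk_slot_scale:
  assumes "k_times_differentiable d k f" "set us \<subseteq> Rn d" "set vs \<subseteq> Rn d" "a \<in> Rn d"
    "length (us @ a # vs) \<le> k" "x \<in> Rn d"
  shows "Dk d f (us @ (c *\<^sub>R a) # vs) x = c *\<^sub>R Dk d f (us @ a # vs) x"
proof -
  have z: "Dk d f (us @ 0 # vs) x = 0"
    using Dk_slot_linear[OF assms(1,3), of 0 0 us x 1] assms by simp
  then show ?thesis
    using Dk_slot_linear[OF assms(1,3), of 0 a us x c] assms by simp
qed

text \<open>If an argument varies with the point, this expansion moves the variation into scalar
  coefficients in front of derivatives with constant directions, which the product rule can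
  handle.\<close>

lemma Dk_slot_sum:
  assumes f: "k_times_differentiable d k f" and "set us \<subseteq> Rn d" "set vs \<subseteq> Rn d"
    "length us + length vs < k" "x \<in> Rn d" and a: "a \<in> Rn d"
  shows "Dk d f (us @ a # vs) x = (\<Sum>i<d. coord a i *\<^sub>R Dk d f (us @ unit_ell2 i # vs) x)"
proof -
  have "Dk d f (us @ (\<Sum>i<n. coord a i *\<^sub>R unit_ell2 i) # vs) x =
      (\<Sum>i<n. coord a i *\<^sub>R Dk d f (us @ unit_ell2 i # vs) x)" if "n \<le> d" for n
    using that
  proof (induction n)
    case 0
    show ?case using Dk_slot_scale[of d k f us vs 0 x 0] assms by simp
  next
    case (Suc n)
    have "(\<Sum>i<n. coord a i *\<^sub>R unit_ell2 i) \<in> Rn d"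
      using Suc.prems by (intro subspace_sum[OF subspace_Rn] Rn_scale unit_ell2_in_Rn) auto
    then show ?case
      using Dk_slot_linear[OF f assms(3), of "\<Sum>i<n. coord a i *\<^sub>R unit_ell2 i" "unit_ell2 n" us x "coord a n"]
        Suc assms by (simp add: unit_ell2_in_Rn)
  qed
  from this[of d] show ?thesis using a Rn_eq_sum[of a d] by simp
qed

definition usph :: "nat \<Rightarrow> ell2 set" where "usph d = {v \<in> Rn d. norm v = 1}"

lemma usph_subset: "usph d \<subseteq> Rn d"
  by (auto simp: usph_def)

text \<open>The slots are normalised one after the other, \<open>us\<close> collecting those already
  on the sphere, and homogeneity pulls out the norms. The constant stays \<open>K\<close>, where an
  expansion in coordinates would bring in the dimension.\<close>

lemma Dk_norm_le:
  assumes f: "k_times_differentiable d k f" and "x \<in> Rn d"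
    and K: "\<And>vs. set vs \<subseteq> usph d \<Longrightarrow> length vs = n \<Longrightarrow> norm (Dk d f vs x) \<le> K"
    and "n \<le> k" "set vs \<subseteq> Rn d" "length vs = n"
  shows "norm (Dk d f vs x) \<le> K * prod_list (map norm vs)"
proof -
  have "norm (Dk d f (us @ ws) x) \<le> K * prod_list (map norm ws)"
    if "set us \<subseteq> usph d" "set ws \<subseteq> Rn d" "length (us @ ws) = n" for us ws
    using that
  proof (induction ws arbitrary: us)
    case Nil
    then show ?case using K by simp
  next
    case (Cons w ws)
    have us: "set us \<subseteq> Rn d" using Cons.prems usph_subset by blast
    show ?case
    proof (cases "w = 0")
      case True
      then show ?thesis
        using Dk_slot_scale[OF f us, of ws 0 x 0] Cons.prems assms by simp
    next
      case False
      have "Dk d f (us @ w # ws) x = Dk d f (us @ (norm w *\<^sub>R sgn w) # ws) x"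
        using False by (simp add: sgn_div_norm)
      also have "\<dots> = norm w *\<^sub>R Dk d f (us @ sgn w # ws) x"
        using Cons.prems assms us by (intro Dk_slot_scale[OF f]) (auto simp: sgn_div_norm Rn_scale)
      finally have "norm (Dk d f (us @ w # ws) x) = norm w * norm (Dk d f ((us @ [sgn w]) @ ws) x)"
        by simp
      also have "\<dots> \<le> norm w * (K * prod_list (map norm ws))"
        using Cons.prems False
        by (intro mult_left_mono Cons.IH) (auto simp: usph_def norm_sgn, simp add: sgn_div_norm Rn_scale)
      finally show ?thesis by (simp add: mult_ac)
    qed
  qed
  from this[of "[]" vs] show ?thesis using assms by simp
qed

section \<open>Derivatives of compositions\<close>

text \<open>Combinatorial image of the product rule: each entry of the result stands for the term in
  which one factor is differentiated in the new direction \<open>v\<close>.\<close>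

fun bump_each :: "'a \<Rightarrow> 'a list list \<Rightarrow> 'a list list list" where
  "bump_each v [] = []"
| "bump_each v (w # ws) = ((v # w) # ws) # map ((#) w) (bump_each v ws)"

text \<open>
  \<open>parts vs\<close> lists the set partitions of the positions of \<open>vs\<close>: the new element \<open>v\<close> either joins
  a block or forms a block of its own.  They index the terms of the formula of Faa di Bruno.
\<close>

fun parts :: "'a list \<Rightarrow> 'a list list list" where
  "parts [] = [[]]"
| "parts (v # vs) = concat (map (\<lambda>ws. bump_each v ws @ [[v] # ws]) (parts vs))"

lemma length_bump_each [simp]: "length (bump_each v ws) = length ws"
  by (induction ws) auto

lemma bump_eachD:
  assumes "ws' \<in> set (bump_each v ws)"
  shows "length ws' = length ws" and "w' \<in> set ws' \<Longrightarrow> w' \<in> set ws \<or> (\<exists>w\<in>set ws. w' = v # w)"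
  using assms by (induction ws arbitrary: ws') fastforce+

lemma partsD:
  assumes "ws \<in> set (parts vs)"
  shows "length ws \<le> length vs" and "w \<in> set ws \<Longrightarrow> w \<noteq> [] \<and> set w \<subseteq> set vs \<and> length w \<le> length vs"
  using assms
proof (induction vs arbitrary: ws w)
  case (Cons v vs)
  {
    case 1
    then show ?case using Cons.IH(1) by (fastforce dest: bump_eachD(1))
  next
    case 2
    then obtain ws0 where ws0: "ws0 \<in> set (parts vs)" "ws \<in> set (bump_each v ws0) \<or> ws = [v] # ws0"
      by auto
    then have "w \<in> set ws0 \<or> (\<exists>w0\<in>set ws0. w = v # w0) \<or> w = [v]"
      using 2(1) bump_eachD(2)[of ws v ws0 w] by auto
    then show ?case using Cons.IH(2)[OF _ ws0(1)] by fastforce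
  }
qed auto

text \<open>The exact count is a Bell number. The factorial bounds it because a partition of
  \<open>n\<close> positions has at most \<open>n\<close> blocks and hence at most
  \<open>n + 1\<close> successors in the recursion.\<close>

lemma length_parts: "length (parts vs) \<le> fact (length vs)"
proof (induction vs)
  case (Cons v vs)
  have "length (parts (v # vs)) = (\<Sum>ws\<leftarrow>parts vs. length ws + 1)"
    by (simp add: length_concat comp_def)
  also have "\<dots> \<le> (\<Sum>ws\<leftarrow>parts vs. length vs + 1)"
    by (rule sum_list_mono) (use partsD in auto)
  also have "\<dots> = length (parts vs) * (length vs + 1)"
    by (simp add: sum_list_triv)
  also have "\<dots> \<le> fact (length vs) * (length vs + 1)"
    by (intro mult_right_mono Cons.IH) simp
  finally show ?case by (simp add: algebra_simps)
qed simp

text \<open>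
  Isolates the only term with a derivative of full order of the inner function.  That derivative
  enters linearly, which makes the Gronwall argument for the Euler scheme possible.
\<close>

lemma parts_eq_Cons:
  assumes "vs \<noteq> []"
  obtains rest where "parts vs = [vs] # rest"
    "\<And>ws w. ws \<in> set rest \<Longrightarrow> w \<in> set ws \<Longrightarrow> length w < length vs"
proof -
  have "\<exists>rest. parts vs = [vs] # rest \<and> (\<forall>ws\<in>set rest. \<forall>w\<in>set ws. length w < length vs)"
    using assms
  proof (induction vs)
    case (Cons v vs)
    show ?case
    proof (cases "vs = []")
      case False
      then obtain rest where rest: "parts vs = [vs] # rest"
          "\<forall>ws\<in>set rest. \<forall>w\<in>set ws. length w < length vs"
        using Cons.IH by blast
      show ?thesis
      proof (intro exI conjI ballI)
        \<comment> \<open>The coarsest partition \<open>[vs]\<close> has two successors: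
          \<open>v\<close> joins its block or stays alone. In the second one, \<open>[v]\<close> is
          shorter than \<open>v # vs\<close> because \<open>vs\<close> is nonempty.\<close>
        show "parts (v # vs) =
            [v # vs] # [[v], vs] # concat (map (\<lambda>ws. bump_each v ws @ [[v] # ws]) rest)"
          by (simp add: rest(1))
        fix ws w
        assume ws: "ws \<in> set ([[v], vs] # concat (map (\<lambda>ws. bump_each v ws @ [[v] # ws]) rest))"
          and w: "w \<in> set ws"
        from ws consider "ws = [[v], vs]" |
            ws0 where "ws0 \<in> set rest" "ws \<in> set (bump_each v ws0) \<or> ws = [v] # ws0"
          by auto
        then show "length w < length (v # vs)"
        proof cases
          case 1
          then show ?thesis using w False by auto
        next
          case (2 ws0)
          then have "w \<in> set ws0 \<or> (\<exists>w0\<in>set ws0. w = v # w0) \<or> w = [v]"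
            using w bump_eachD(2)[of ws v ws0 w] by auto
          then show ?thesis using rest(2) 2(1) False by fastforce
        qed
      qed
    qed simp
  qed simp
  then show thesis using that by blast
qed

lemma has_derivative_sum_list:
  assumes "\<And>z. z \<in> set zs \<Longrightarrow> (f z has_derivative f' z) F"
  shows "((\<lambda>x. \<Sum>z\<leftarrow>zs. f z x) has_derivative (\<lambda>h. \<Sum>z\<leftarrow>zs. f' z h)) F"
  using assms by (induction zs) (auto intro!: has_derivative_add)

lemma sum_list_map_concat:
  "(\<Sum>y\<leftarrow>concat (map h zs). g y) = (\<Sum>z\<leftarrow>zs. \<Sum>y\<leftarrow>h z. (g y :: 'b::comm_monoid_add))"
  by (induction zs) auto

lemma sum_scaleR_sum_list:
  "(\<Sum>i\<in>A. c i *\<^sub>R (\<Sum>z\<leftarrow>zs. f i z)) = (\<Sum>z\<leftarrow>zs. \<Sum>i\<in>A. c i *\<^sub>R (f i z :: 'b::real_vector))"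
  by (induction zs) (auto simp: scaleR_add_right sum.distrib)

text \<open>\<open>us\<close> holds constant directions, \<open>ws\<close> the arguments that vary.
  The induction expands the first varying argument in unit vectors: its coordinates become scalar
  factors, and the unit vector joins the constant directions. The first term of the derivative stems
  from the base point \<open>g y\<close>, the others from the arguments. The strict length bounds
  leave room for one more derivative of \<open>f\<close> and of every inner factor.\<close>

lemma Dk_args_has_derivative:
  fixes f :: "ell2 \<Rightarrow> 'b::real_normed_vector"
  assumes f: "k_times_differentiable d k f"
    and g: "k_times_differentiable d' k g" "g \<in> Rn d' \<rightarrow> Rn d"
    and x: "x \<in> Rn d'"
  shows "set us \<subseteq> Rn d \<Longrightarrow> length us + length ws < k \<Longrightarrow>
      (\<And>w. w \<in> set ws \<Longrightarrow> set w \<subseteq> Rn d' \<and> length w < k) \<Longrightarrow>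
    ((\<lambda>y. Dk d f (us @ map (\<lambda>w. Dk d' g w y) ws) (g y)) has_derivative
      (\<lambda>v. Dk d f (Dk d' g [proj d' v] x # us @ map (\<lambda>w. Dk d' g w x) ws) (g x)
        + (\<Sum>ws'\<leftarrow>bump_each (proj d' v) ws. Dk d f (us @ map (\<lambda>w. Dk d' g w x) ws') (g x))))
      (at x within Rn d')"
proof (induction ws arbitrary: us)
  case Nil
  have gx: "g x \<in> Rn d" using g x by auto
  have "(Dk d f us has_derivative (\<lambda>h. Dk d f (proj d h # us) (g x))) (at (g x) within g ` Rn d')"
    by (rule has_derivative_subset[OF k_times_differentiable_has_derivative[OF f]])
      (use Nil g gx in auto)
  moreover have "(g has_derivative (\<lambda>h. Dk d' g [proj d' h] x)) (at x within Rn d')"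
    using k_times_differentiable_has_derivative[OF g(1), of "[]" x] Nil x by (simp del: Dk.simps(2))
  moreover have "proj d (Dk d' g [proj d' h] x) = Dk d' g [proj d' h] x" for h
    using Nil x by (intro proj_id Dk_in_Rn[OF g]) auto
  ultimately show ?case
    using has_derivative_in_compose[of g _ x "Rn d'" "Dk d f us"] by (fastforce simp del: Dk.simps(2))
next
  case (Cons w ws)
  let ?c = "Dk d' g w" and ?cs = "\<lambda>y. map (\<lambda>w. Dk d' g w y) ws" and ?e = unit_ell2
  have in_Rn: "Dk d' g u y \<in> Rn d" if "set u \<subseteq> Rn d'" "length u \<le> k" "y \<in> Rn d'" for u y
    using Dk_in_Rn[OF g that] .
  have cs: "set (map (\<lambda>w. Dk d' g w y) ws') \<subseteq> Rn d"
    if "y \<in> Rn d'" "\<And>u. u \<in> set ws' \<Longrightarrow> set u \<subseteq> Rn d' \<and> length u \<le> k" for y ws'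
    using that in_Rn by auto
  have ws: "set u \<subseteq> Rn d' \<and> length u \<le> k" if "u \<in> set ws" for u
    using Cons.prems(3)[of u] that by auto
  have w: "set w \<subseteq> Rn d'" "length w < k" using Cons.prems(3)[of w] by auto
  have slot: "Dk d f (us @ a # map (\<lambda>w. Dk d' g w y) ws') (g y)
      = (\<Sum>i<d. coord a i *\<^sub>R Dk d f (us @ ?e i # map (\<lambda>w. Dk d' g w y) ws') (g y))"
    if "a \<in> Rn d" "y \<in> Rn d'" "length ws' = length ws"
      "\<And>u. u \<in> set ws' \<Longrightarrow> set u \<subseteq> Rn d' \<and> length u \<le> k" for a y ws'
    using Cons.prems that g(2) by (intro Dk_slot_sum[OF f] cs) auto
  have slot': "Dk d f (b # us @ a # map (\<lambda>w. Dk d' g w y) ws) (g y)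
      = (\<Sum>i<d. coord a i *\<^sub>R Dk d f (b # us @ ?e i # map (\<lambda>w. Dk d' g w y) ws) (g y))"
    if "a \<in> Rn d" "b \<in> Rn d" "y \<in> Rn d'" for a b y
    using Dk_slot_sum[OF f, of "b # us" "map (\<lambda>w. Dk d' g w y) ws" "g y" a] Cons.prems that g(2) cs[OF _ ws]
    by auto
  have dc: "((\<lambda>y. coord (?c y) i) has_derivative (\<lambda>h. coord (Dk d' g (proj d' h # w) x) i))
      (at x within Rn d')" for i
    by (rule bounded_linear.has_derivative[OF bounded_linear_coord
          k_times_differentiable_has_derivative[OF g(1) w x]])
  have IH: "((\<lambda>y. Dk d f (us @ ?e i # ?cs y) (g y)) has_derivative
      (\<lambda>v. Dk d f (Dk d' g [proj d' v] x # us @ ?e i # ?cs x) (g x)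
        + (\<Sum>ws'\<leftarrow>bump_each (proj d' v) ws.
            Dk d f (us @ ?e i # map (\<lambda>w. Dk d' g w x) ws') (g x))))
      (at x within Rn d')" if "i < d" for i
    using Cons.IH[of "us @ [?e i]"] Cons.prems that unit_ell2_in_Rn by auto
  have main: "((\<lambda>y. \<Sum>i<d. coord (?c y) i *\<^sub>R Dk d f (us @ ?e i # ?cs y) (g y)) has_derivative
      (\<lambda>v. \<Sum>i<d. coord (?c x) i *\<^sub>R (Dk d f (Dk d' g [proj d' v] x # us @ ?e i # ?cs x) (g x)
        + (\<Sum>ws'\<leftarrow>bump_each (proj d' v) ws.
            Dk d f (us @ ?e i # map (\<lambda>w. Dk d' g w x) ws') (g x)))
        + coord (Dk d' g (proj d' v # w) x) i *\<^sub>R Dk d f (us @ ?e i # ?cs x) (g x)))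
      (at x within Rn d')"
    by (intro has_derivative_sum has_derivative_scaleR dc IH) auto
  \<comment> \<open>The coordinate sums produced by the product rule are contracted slot by slot, so
    no sum over the dimension survives in the formula.\<close>
  have eq: "(\<Sum>i<d. coord (?c x) i *\<^sub>R (Dk d f (Dk d' g [proj d' v] x # us @ ?e i # ?cs x) (g x)
        + (\<Sum>ws'\<leftarrow>bump_each (proj d' v) ws.
            Dk d f (us @ ?e i # map (\<lambda>w. Dk d' g w x) ws') (g x)))
        + coord (Dk d' g (proj d' v # w) x) i *\<^sub>R Dk d f (us @ ?e i # ?cs x) (g x))
      = Dk d f (Dk d' g [proj d' v] x # us @ map (\<lambda>w. Dk d' g w x) (w # ws)) (g x)
        + (\<Sum>ws'\<leftarrow>bump_each (proj d' v) (w # ws). Dk d f (us @ map (\<lambda>w. Dk d' g w x) ws') (g x))"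
    (is "?lhs = _") for v
  proof -
    have ws': "length ws' = length ws" "\<And>u. u \<in> set ws' \<Longrightarrow> set u \<subseteq> Rn d' \<and> length u \<le> k"
      if "ws' \<in> set (bump_each (proj d' v) ws)" for ws'
      using bump_eachD[OF that] Cons.prems(3) by (fastforce)+
    have "?lhs = (\<Sum>i<d. coord (?c x) i *\<^sub>R Dk d f (Dk d' g [proj d' v] x # us @ ?e i # ?cs x) (g x))
        + (\<Sum>ws'\<leftarrow>bump_each (proj d' v) ws. \<Sum>i<d. coord (?c x) i *\<^sub>R
            Dk d f (us @ ?e i # map (\<lambda>w. Dk d' g w x) ws') (g x))
        + (\<Sum>i<d. coord (Dk d' g (proj d' v # w) x) i *\<^sub>R Dk d f (us @ ?e i # ?cs x) (g x))"
      by (simp add: sum.distrib scaleR_add_right sum_scaleR_sum_list del: Dk.simps)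
    also have "(\<Sum>i<d. coord (?c x) i *\<^sub>R Dk d f (Dk d' g [proj d' v] x # us @ ?e i # ?cs x) (g x))
        = Dk d f (Dk d' g [proj d' v] x # us @ ?c x # ?cs x) (g x)"
      using Cons.prems by (intro slot'[symmetric] in_Rn w x less_imp_le[OF w(2)]) auto
    also have "(\<Sum>ws'\<leftarrow>bump_each (proj d' v) ws. \<Sum>i<d. coord (?c x) i *\<^sub>R
            Dk d f (us @ ?e i # map (\<lambda>w. Dk d' g w x) ws') (g x))
        = (\<Sum>ws'\<leftarrow>bump_each (proj d' v) ws. Dk d f (us @ ?c x # map (\<lambda>w. Dk d' g w x) ws') (g x))"
      using w x ws' by (intro arg_cong[where f = sum_list] map_cong refl slot[symmetric] in_Rn) auto
    also have "(\<Sum>i<d. coord (Dk d' g (proj d' v # w) x) i *\<^sub>R Dk d f (us @ ?e i # ?cs x) (g x))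
        = Dk d f (us @ Dk d' g (proj d' v # w) x # ?cs x) (g x)"
      using w x ws by (intro slot[symmetric] in_Rn) auto
    finally show ?thesis
      by (simp add: comp_def add_ac del: Dk.simps)
  qed
  have "((\<lambda>y. \<Sum>i<d. coord (?c y) i *\<^sub>R Dk d f (us @ ?e i # ?cs y) (g y)) has_derivative
      (\<lambda>v. Dk d f (Dk d' g [proj d' v] x # us @ map (\<lambda>w. Dk d' g w x) (w # ws)) (g x)
        + (\<Sum>ws'\<leftarrow>bump_each (proj d' v) (w # ws). Dk d f (us @ map (\<lambda>w. Dk d' g w x) ws') (g x))))
      (at x within Rn d')"
    using main by (simp only: eq)
  then show ?case
  proof (rule has_derivative_transform[OF x, rotated])
    fix y assume y: "y \<in> Rn d'"
    show "Dk d f (us @ map (\<lambda>w. Dk d' g w y) (w # ws)) (g y)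
        = (\<Sum>i<d. coord (?c y) i *\<^sub>R Dk d f (us @ ?e i # ?cs y) (g y))"
      using slot[OF in_Rn[OF w(1) _ y] y refl ws] w by simp
  qed
qed

text \<open>Differentiating the term of one partition gives a term in which the new direction is a
  block of its own, from the base point, and a term for every block that it joins. This is the
  recursion of \<open>parts\<close>, so the sum over \<open>parts vs\<close> is closed under
  differentiation and \<open>Dk_eqI\<close> applies.\<close>

lemma Dk_compose:
  fixes f :: "ell2 \<Rightarrow> 'b::real_normed_vector"
  assumes f: "k_times_differentiable d k f"
    and g: "k_times_differentiable d' k g" "g \<in> Rn d' \<rightarrow> Rn d"
  shows "k_times_differentiable d' k (\<lambda>x. f (g x))"
    and "set vs \<subseteq> Rn d' \<Longrightarrow> length vs \<le> k \<Longrightarrow> x \<in> Rn d' \<Longrightarrow>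
      Dk d' (\<lambda>x. f (g x)) vs x = (\<Sum>ws\<leftarrow>parts vs. Dk d f (map (\<lambda>w. Dk d' g w x) ws) (g x))"
proof -
  let ?G = "\<lambda>vs x. \<Sum>ws\<leftarrow>parts vs. Dk d f (map (\<lambda>w. Dk d' g w x) ws) (g x)"
  have *: "\<exists>D. (?G vs has_derivative D) (at x within Rn d') \<and> (\<forall>v\<in>Rn d'. D v = ?G (v # vs) x)"
    if vs: "set vs \<subseteq> Rn d'" "length vs < k" "x \<in> Rn d'" for vs x
  proof (intro exI conjI ballI)
    show "(?G vs has_derivative (\<lambda>v. \<Sum>ws\<leftarrow>parts vs.
          Dk d f (Dk d' g [proj d' v] x # [] @ map (\<lambda>w. Dk d' g w x) ws) (g x)
        + (\<Sum>ws'\<leftarrow>bump_each (proj d' v) ws. Dk d f ([] @ map (\<lambda>w. Dk d' g w x) ws') (g x))))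
        (at x within Rn d')"
    proof (rule has_derivative_sum_list)
      fix ws assume "ws \<in> set (parts vs)"
      then have "length ws \<le> length vs"
          "\<And>w. w \<in> set ws \<Longrightarrow> set w \<subseteq> set vs \<and> length w \<le> length vs"
        using partsD by blast+
      then show "((\<lambda>y. Dk d f (map (\<lambda>w. Dk d' g w y) ws) (g y)) has_derivative
          (\<lambda>v. Dk d f (Dk d' g [proj d' v] x # [] @ map (\<lambda>w. Dk d' g w x) ws) (g x)
        + (\<Sum>ws'\<leftarrow>bump_each (proj d' v) ws. Dk d f ([] @ map (\<lambda>w. Dk d' g w x) ws') (g x))))
        (at x within Rn d')"
        using Dk_args_has_derivative[OF f g vs(3), of "[]" ws] vs by fastforce
    qed
    fix v assume "v \<in> Rn d'"
    then show "(\<Sum>ws\<leftarrow>parts vs. Dk d f (Dk d' g [proj d' v] x # [] @ map (\<lambda>w. Dk d' g w x) ws) (g x)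
        + (\<Sum>ws'\<leftarrow>bump_each (proj d' v) ws. Dk d f ([] @ map (\<lambda>w. Dk d' g w x) ws') (g x)))
        = ?G (v # vs) x"
      by (simp add: sum_list_map_concat comp_def add_ac del: Dk.simps)
  qed
  show "k_times_differentiable d' k (\<lambda>x. f (g x))"
    by (rule Dk_eqI(1)[where G = ?G, OF _ *]) auto
  show "set vs \<subseteq> Rn d' \<Longrightarrow> length vs \<le> k \<Longrightarrow> x \<in> Rn d' \<Longrightarrow>
      Dk d' (\<lambda>x. f (g x)) vs x = (\<Sum>ws\<leftarrow>parts vs. Dk d f (map (\<lambda>w. Dk d' g w x) ws) (g x))"
    by (rule Dk_eqI(2)[where G = ?G, OF _ *]) auto
qed

lemma norm_sum_list_le: "norm (\<Sum>z\<leftarrow>zs. f z) \<le> (\<Sum>z\<leftarrow>zs. norm (f z :: 'b::real_normed_vector))"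
  by (induction zs) (auto intro: norm_triangle_le)

lemma prod_list_norm_le:
  assumes "A \<ge> 1" "\<And>c. c \<in> set cs \<Longrightarrow> norm c \<le> A" "length cs \<le> n"
  shows "prod_list (map norm cs) \<le> A ^ n"
proof -
  have "prod_list (map norm cs) \<le> A ^ length cs \<and> 0 \<le> prod_list (map norm cs)"
    using assms(2) by (induction cs) (use assms(1) in \<open>auto intro!: mult_mono\<close>)
  then show ?thesis using power_increasing[OF assms(3,1)] by linarith
qed

text \<open>The bound is affine in the derivative of full order of \<open>g\<close>, and lower
  orders enter through \<open>A\<close> alone. Applied to an Euler step, it gives a linear recursion
  for that derivative. The condition \<open>A \<ge> 1\<close> allows the same power of
  \<open>A\<close> for every number of blocks.\<close>

lemma norm_Dk_compose_le:
  fixes f :: "ell2 \<Rightarrow> 'b::real_normed_vector"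
  assumes f: "k_times_differentiable d k f"
    and f_le: "\<And>vs x. set vs \<subseteq> usph d \<Longrightarrow> 1 \<le> length vs \<Longrightarrow> length vs \<le> k \<Longrightarrow> x \<in> Rn d \<Longrightarrow>
      norm (Dk d f vs x) \<le> M"
    and g: "k_times_differentiable d' k g" "g \<in> Rn d' \<rightarrow> Rn d"
    and vs: "set vs \<subseteq> usph d'" "1 \<le> length vs" "length vs \<le> k" and x: "x \<in> Rn d'"
    and A: "A \<ge> 1" "\<And>w. set w \<subseteq> usph d' \<Longrightarrow> 1 \<le> length w \<Longrightarrow> length w < length vs \<Longrightarrow>
      norm (Dk d' g w x) \<le> A"
    and M: "M \<ge> 0"
  shows "norm (Dk d' (\<lambda>x. f (g x)) vs x)
    \<le> M * norm (Dk d' g vs x) + fact (length vs) * (M * A ^ length vs)"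
proof -
  let ?T = "\<lambda>ws. Dk d f (map (\<lambda>w. Dk d' g w x) ws) (g x)"
  have vsR: "set vs \<subseteq> Rn d'" using vs(1) usph_subset by blast
  have gx: "g x \<in> Rn d" using g(2) x by auto
  have T: "norm (?T ws) \<le> M * prod_list (map (\<lambda>w. norm (Dk d' g w x)) ws)"
    if "ws \<in> set (parts vs)" for ws
  proof -
    have ws: "length ws \<le> length vs" "\<And>w. w \<in> set ws \<Longrightarrow> set w \<subseteq> set vs \<and> length w \<le> length vs"
      using partsD[OF that] by blast+
    \<comment> \<open>A nonempty list has no partition into zero blocks, so only derivatives of
      \<open>f\<close> of order at least one occur, and these are the ones that \<open>M\<close>
      bounds.\<close>
    have "ws \<noteq> []"
    proof -
      obtain v vs' where "vs = v # vs'" using vs(2) by (cases vs) auto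
      then show ?thesis using that bump_eachD(1) by fastforce
    qed
    then have "1 \<le> length ws" by (cases ws) auto
    then have "norm (?T ws) \<le> M * prod_list (map norm (map (\<lambda>w. Dk d' g w x) ws))"
      using ws vs vsR x by (intro Dk_norm_le[OF f gx, of "length ws"] f_le gx)
        (fastforce intro!: Dk_in_Rn[OF g])+
    then show ?thesis by (simp add: comp_def)
  qed
  obtain rest where rest: "parts vs = [vs] # rest"
      "\<And>ws w. ws \<in> set rest \<Longrightarrow> w \<in> set ws \<Longrightarrow> length w < length vs"
    using parts_eq_Cons[of vs] vs(2) by (metis One_nat_def list.size(3) not_one_le_zero)
  have Tr: "norm (?T ws) \<le> M * A ^ length vs" if "ws \<in> set rest" for ws
  proof -
    have ws: "length ws \<le> length vs" "\<And>w. w \<in> set ws \<Longrightarrow> w \<noteq> [] \<and> set w \<subseteq> set vs"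
      using partsD[of ws vs] that rest(1) by auto
    have "prod_list (map norm (map (\<lambda>w. Dk d' g w x) ws)) \<le> A ^ length vs"
    proof (rule prod_list_norm_le[OF A(1)])
      fix c assume "c \<in> set (map (\<lambda>w. Dk d' g w x) ws)"
      then obtain w where w: "w \<in> set ws" "c = Dk d' g w x" by auto
      then show "norm c \<le> A"
        using A(2)[of w] ws(2)[OF w(1)] rest(2)[OF that w(1)] vs(1)
        by (metis One_nat_def Suc_leI length_greater_0_conv subset_trans)
    qed (use ws in auto)
    then have "M * prod_list (map (\<lambda>w. norm (Dk d' g w x)) ws) \<le> M * A ^ length vs"
      using M by (intro mult_left_mono) (auto simp: comp_def)
    with T[of ws] that rest(1) show ?thesis by fastforce
  qed
  have "norm (Dk d' (\<lambda>x. f (g x)) vs x) = norm (?T [vs] + (\<Sum>ws\<leftarrow>rest. ?T ws))"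
    using Dk_compose(2)[OF f g vsR vs(3) x] rest(1) by simp
  also have "\<dots> \<le> norm (?T [vs]) + (\<Sum>ws\<leftarrow>rest. norm (?T ws))"
    using norm_sum_list_le[of ?T rest] by (intro norm_triangle_le) simp
  also have "\<dots> \<le> M * norm (Dk d' g vs x) + (\<Sum>ws\<leftarrow>rest. M * A ^ length vs)"
    using T[of "[vs]"] rest(1) Tr by (intro add_mono sum_list_mono) auto
  also have "(\<Sum>ws\<leftarrow>rest. M * A ^ length vs) = real (length rest) * (M * A ^ length vs)"
    by (simp add: sum_list_triv)
  also have "\<dots> \<le> fact (length vs) * (M * A ^ length vs)"
  proof (rule mult_right_mono)
    have "length rest \<le> fact (length vs)" using length_parts[of vs] rest(1) by simp
    then show "real (length rest) \<le> fact (length vs)"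
      by (metis of_nat_fact of_nat_le_iff)
  qed (use M A in auto)
  finally show ?thesis by simp
qed

section \<open>Derivatives of the Euler scheme\<close>

definition bounded_smooth :: "nat \<Rightarrow> nat \<Rightarrow> real \<Rightarrow> (ell2 \<Rightarrow> ell2) \<Rightarrow> bool" where
  "bounded_smooth d k M f \<longleftrightarrow> f \<in> Rn d \<rightarrow> Rn d \<and> k_times_differentiable d k f \<and>
     (\<forall>vs x. set vs \<subseteq> usph d \<longrightarrow> length vs \<le> k \<longrightarrow> x \<in> Rn d \<longrightarrow> norm (Dk d f vs x) \<le> M)"

lemma bounded_smooth_mono: "bounded_smooth d k M f \<Longrightarrow> j \<le> k \<Longrightarrow> bounded_smooth d j M f"
  by (auto simp: bounded_smooth_def k_times_differentiable_mono)

lemma bounded_smoothD: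
  assumes "bounded_smooth d k M f"
  shows "f \<in> Rn d \<rightarrow> Rn d" "k_times_differentiable d k f"
    "set vs \<subseteq> usph d \<Longrightarrow> length vs \<le> k \<Longrightarrow> x \<in> Rn d \<Longrightarrow> norm (Dk d f vs x) \<le> M"
  using assms by (auto simp: bounded_smooth_def)

lemma bounded_smooth_norm_le: "bounded_smooth d k M f \<Longrightarrow> x \<in> Rn d \<Longrightarrow> norm (f x) \<le> M"
  using bounded_smoothD(3)[of d k M f "[]" x] by simp

fun euler :: "('a \<Rightarrow> 'a) \<Rightarrow> real \<Rightarrow> nat \<Rightarrow> 'a \<Rightarrow> 'a::real_normed_vector" where
  "euler f h 0 x = x"
| "euler f h (Suc j) x = euler f h j x + h *\<^sub>R f (euler f h j x)"

lemma euler_in_Rn: "f \<in> Rn d \<rightarrow> Rn d \<Longrightarrow> x \<in> Rn d \<Longrightarrow> euler f h j x \<in> Rn d"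
  by (induction j) (auto intro!: Rn_add Rn_scale)

lemma k_times_differentiable_euler:
  assumes "k_times_differentiable d k f" "f \<in> Rn d \<rightarrow> Rn d"
  shows "k_times_differentiable d k (euler f h j)"
proof (induction j)
  case 0
  show ?case using Dk_id(1) by simp
next
  case (Suc j)
  have "k_times_differentiable d k (\<lambda>x. f (euler f h j x))"
    by (rule Dk_compose(1)[OF assms(1) Suc]) (use assms(2) euler_in_Rn in blast)
  from Dk_add_scaled(1)[OF Suc this, of h] show ?case by simp
qed

lemma discrete_gronwall:
  fixes a :: "nat \<Rightarrow> real"
  assumes "\<And>i. i < n \<Longrightarrow> a (Suc i) \<le> (1 + c) * a i + b" "a 0 \<le> a0" "0 \<le> a0" "0 \<le> b" "0 \<le> c"
  shows "a n \<le> (a0 + n * b) * exp (n * c)"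
proof -
  have "j \<le> n \<Longrightarrow> a j \<le> (a0 + j * b) * exp (j * c)" for j
  proof (induction j)
    case (Suc j)
    have "a (Suc j) \<le> (1 + c) * a j + b" using assms(1) Suc.prems by simp
    also have "\<dots> \<le> exp c * ((a0 + j * b) * exp (j * c)) + b * exp (Suc j * c)"
    proof (intro add_mono)
      have "(1 + c) * a j \<le> (1 + c) * ((a0 + j * b) * exp (j * c))"
        using Suc assms by (intro mult_left_mono) auto
      also have "\<dots> \<le> exp c * ((a0 + j * b) * exp (j * c))"
        using assms exp_ge_add_one_self[of c] by (intro mult_right_mono) auto
      finally show "(1 + c) * a j \<le> exp c * ((a0 + j * b) * exp (j * c))" .
      show "b \<le> b * exp (Suc j * c)"
        using assms by (simp add: mult_le_cancel_left1)
    qed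
    also have "\<dots> = (a0 + Suc j * b) * exp (Suc j * c)"
      by (simp add: algebra_simps exp_add)
    finally show ?case .
  qed (use assms in simp)
  then show ?thesis by simp
qed

text \<open>Induction on the order. At order \<open>Suc k\<close> the previous orders bound every
  term but the one of full order, so per step the norm grows by at most a factor
  \<open>1 + h * M\<close> and a summand \<open>h * B\<close>. Iteration leaves only the elapsed
  time \<open>real j * h\<close> in the bound.\<close>

lemma norm_Dk_euler_bounded:
  fixes M T :: real
  assumes "M \<ge> 0" "T \<ge> 0"
  shows "\<exists>A\<ge>1. \<forall>d f h j x vs. bounded_smooth d k M f \<longrightarrow> h \<ge> 0 \<longrightarrow> real j * h \<le> T \<longrightarrow> x \<in> Rn d \<longrightarrow>
    set vs \<subseteq> usph d \<longrightarrow> 1 \<le> length vs \<longrightarrow> length vs \<le> k \<longrightarrow> norm (Dk d (euler f h j) vs x) \<le> A"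
proof (induction k)
  case 0
  then show ?case by (intro exI[of _ 1]) auto
next
  case (Suc k)
  then obtain A where A: "A \<ge> 1" "\<And>d f h j x vs. bounded_smooth d k M f \<Longrightarrow> h \<ge> 0 \<Longrightarrow>
      real j * h \<le> T \<Longrightarrow> x \<in> Rn d \<Longrightarrow> set vs \<subseteq> usph d \<Longrightarrow> 1 \<le> length vs \<Longrightarrow> length vs \<le> k \<Longrightarrow>
      norm (Dk d (euler f h j) vs x) \<le> A"
    by blast
  \<comment> \<open>The partitions into shorter blocks: at most \<open>fact (Suc k)\<close> of them,
    each with at most \<open>Suc k\<close> factors bounded by \<open>A\<close>.\<close>
  define B where "B = fact (Suc k) * (M * A ^ Suc k)"
  have "B \<ge> 0" unfolding B_def using A(1) assms by simp
  define A' where "A' = max A ((1 + T * B) * exp (T * M))"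
  show ?case
  proof (intro exI[of _ A'] conjI allI impI)
    show "1 \<le> A'" using A(1) by (simp add: A'_def)
    fix d f h j x vs
    assume f: "bounded_smooth d (Suc k) M f" and h: "0 \<le> h" "real j * h \<le> T" and x: "x \<in> Rn d"
      and vs: "set vs \<subseteq> usph d" "1 \<le> length vs" "length vs \<le> Suc k"
    note fk = bounded_smooth_mono[OF f, of k, simplified]
    show "norm (Dk d (euler f h j) vs x) \<le> A'"
    proof (cases "length vs \<le> k")
      case True
      then show ?thesis using A(2)[OF fk h x vs(1,2)] by (simp add: A'_def)
    next
      case False
      with vs have len: "length vs = Suc k" by simp
      have vsR: "set vs \<subseteq> Rn d" using vs usph_subset by blast
      define a where "a = (\<lambda>j. norm (Dk d (euler f h j) vs x))"
      have "a j \<le> (1 + real j * (h * B)) * exp (real j * (h * M))"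
      proof (rule discrete_gronwall)
        show "a 0 \<le> 1"
        proof -
          have "euler f h 0 = (\<lambda>x. x)" by auto
          then have "Dk d (euler f h 0) vs x = (case vs of [] \<Rightarrow> x | [v] \<Rightarrow> v | _ \<Rightarrow> 0)"
            using Dk_id(2)[OF vsR x] by simp
          then show ?thesis
            unfolding a_def using vs by (auto simp: usph_def split: list.split)
        qed
        fix i assume "i < j"
        then have "real i * h \<le> real j * h" using h by (intro mult_right_mono) auto
        then have ih: "real i * h \<le> T" using h by simp
        note e = k_times_differentiable_euler[OF bounded_smoothD(2,1)[OF f], of h i]
        have e': "euler f h i \<in> Rn d \<rightarrow> Rn d" using euler_in_Rn[OF bounded_smoothD(1)[OF f]] by blast
        have "norm (Dk d (\<lambda>x. f (euler f h i x)) vs x)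
            \<le> M * norm (Dk d (euler f h i) vs x) + fact (length vs) * (M * A ^ length vs)"
          using vs len A(2)[OF fk h(1) ih x]
          by (intro norm_Dk_compose_le[OF bounded_smoothD(2)[OF f] bounded_smoothD(3)[OF f] e e' _ _ _ x A(1)]
              assms) auto
        then have le: "norm (Dk d (\<lambda>x. f (euler f h i x)) vs x) \<le> M * a i + B"
          unfolding a_def B_def len .
        have "euler f h (Suc i) = (\<lambda>x. euler f h i x + h *\<^sub>R f (euler f h i x))"
          by auto
        then have "Dk d (euler f h (Suc i)) vs x
            = Dk d (euler f h i) vs x + h *\<^sub>R Dk d (\<lambda>x. f (euler f h i x)) vs x"
          using Dk_add_scaled(2)[OF e Dk_compose(1)[OF bounded_smoothD(2)[OF f] e e'] vsR vs(3) x, of h]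
          by simp
        then have "a (Suc i) \<le> a i + h * norm (Dk d (\<lambda>x. f (euler f h i x)) vs x)"
          unfolding a_def using h(1) by (metis norm_scaleR abs_of_nonneg norm_triangle_ineq)
        also have "\<dots> \<le> a i + h * (M * a i + B)"
          using le h(1) by (intro add_left_mono mult_left_mono)
        finally show "a (Suc i) \<le> (1 + h * M) * a i + h * B"
          by (simp add: algebra_simps)
      qed (use h assms \<open>B \<ge> 0\<close> in auto)
      also have "\<dots> = (1 + (real j * h) * B) * exp ((real j * h) * M)"
        by (simp add: mult.assoc)
      also have "\<dots> \<le> (1 + T * B) * exp (T * M)"
        using h assms \<open>B \<ge> 0\<close>
        by (intro mult_mono add_left_mono mult_right_mono) (auto intro: mult_right_mono)
      finally show ?thesis by (simp add: a_def A'_def)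
    qed
  qed
qed

text \<open>The increment telescopes: it vanishes at step zero, and each step adds \<open>h\<close>
  times \<open>f\<close> after an iterate, whose derivatives are bounded by the previous lemma. The
  resulting factor \<open>real n * h\<close> becomes the factor \<open>t\<close> of the Hoelder
  constant.\<close>

lemma norm_Dk_euler_increment_le:
  fixes M T :: real
  assumes "M \<ge> 0" "T \<ge> 0"
  shows "\<exists>C>0. \<forall>d f h n x vs. bounded_smooth d k M f \<longrightarrow> h \<ge> 0 \<longrightarrow> real n * h \<le> T \<longrightarrow> x \<in> Rn d \<longrightarrow>
    set vs \<subseteq> usph d \<longrightarrow> 1 \<le> length vs \<longrightarrow> length vs \<le> k \<longrightarrow>
      k_times_differentiable d k (\<lambda>x. euler f h n x - x) \<and>
      norm (Dk d (\<lambda>x. euler f h n x - x) vs x) \<le> real n * h * C"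
proof -
  obtain A where A: "A \<ge> 1" "\<And>d f h j x vs. bounded_smooth d k M f \<Longrightarrow> h \<ge> 0 \<Longrightarrow>
      real j * h \<le> T \<Longrightarrow> x \<in> Rn d \<Longrightarrow> set vs \<subseteq> usph d \<Longrightarrow> 1 \<le> length vs \<Longrightarrow> length vs \<le> k \<Longrightarrow>
      norm (Dk d (euler f h j) vs x) \<le> A"
    using norm_Dk_euler_bounded[OF assms, of k] by blast
  \<comment> \<open>The first two summands bound the derivatives of \<open>f\<close> after an
    iterate for all orders from 1 to \<open>k\<close>; the last one makes the constant positive even
    for \<open>M = 0\<close>.\<close>
  define C where "C = M * A + fact k * (M * A ^ k) + 1"
  have "C > 0" unfolding C_def using A(1) assms by (intro add_nonneg_pos add_nonneg_nonneg) auto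
  show ?thesis
  proof (intro exI[of _ C] conjI allI impI)
    show "C > 0" by fact
    fix d f h n x vs
    assume f: "bounded_smooth d k M f" and h: "0 \<le> h" "real n * h \<le> T" and x: "x \<in> Rn d"
      and vs: "set vs \<subseteq> usph d" "1 \<le> length vs" "length vs \<le> k"
    have vsR: "set vs \<subseteq> Rn d" using vs usph_subset by blast
    have e: "k_times_differentiable d k (euler f h i)" for i
      by (rule k_times_differentiable_euler[OF bounded_smoothD(2,1)[OF f]])
    have e': "euler f h i \<in> Rn d \<rightarrow> Rn d" for i
      using euler_in_Rn[OF bounded_smoothD(1)[OF f]] by blast
    have i: "k_times_differentiable d k (\<lambda>x. euler f h j x - x)" for j
      using Dk_add_scaled(1)[OF e[of j] Dk_id(1), of "-1"] by simp
    show "k_times_differentiable d k (\<lambda>x. euler f h n x - x)" by (rule i)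
    show "norm (Dk d (\<lambda>x. euler f h n x - x) vs x) \<le> real n * h * C"
      using h(2)
    proof (induction n)
      case 0
      have "Dk d (\<lambda>x. euler f h 0 x - x) vs x = Dk d (\<lambda>x. x) vs x + (-1) *\<^sub>R Dk d (\<lambda>x. x) vs x"
        using Dk_add_scaled(2)[OF Dk_id(1) Dk_id(1) vsR vs(3) x, of "-1"] by simp
      then show ?case by simp
    next
      case (Suc n)
      have nT: "real n * h \<le> T" using Suc.prems h(1) by (simp add: algebra_simps)
      have "norm (Dk d (\<lambda>x. f (euler f h n x)) vs x)
          \<le> M * norm (Dk d (euler f h n) vs x) + fact (length vs) * (M * A ^ length vs)"
        using vs A(2)[OF f h(1) nT x]
        by (intro norm_Dk_compose_le[OF bounded_smoothD(2)[OF f] bounded_smoothD(3)[OF f] e e' _ _ _ x A(1)]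
            assms) auto
      also have "\<dots> \<le> M * A + fact k * (M * A ^ k)"
        using A assms vs A(2)[OF f h(1) nT x vs]
        by (intro add_mono mult_mono mult_left_mono power_increasing fact_mono) auto
      finally have le: "norm (Dk d (\<lambda>x. f (euler f h n x)) vs x) \<le> C"
        by (simp add: C_def)
      have "(\<lambda>x. euler f h (Suc n) x - x) = (\<lambda>x. (euler f h n x - x) + h *\<^sub>R f (euler f h n x))"
        by auto
      then have "Dk d (\<lambda>x. euler f h (Suc n) x - x) vs x
          = Dk d (\<lambda>x. euler f h n x - x) vs x + h *\<^sub>R Dk d (\<lambda>x. f (euler f h n x)) vs x"
        using Dk_add_scaled(2)[OF i Dk_compose(1)[OF bounded_smoothD(2)[OF f] e e'] vsR vs(3) x, of n h]
        by simp
      then have "norm (Dk d (\<lambda>x. euler f h (Suc n) x - x) vs x)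
          \<le> norm (Dk d (\<lambda>x. euler f h n x - x) vs x) + h * norm (Dk d (\<lambda>x. f (euler f h n x)) vs x)"
        using h(1) by (metis norm_scaleR abs_of_nonneg norm_triangle_ineq)
      also have "\<dots> \<le> real n * h * C + h * C"
        using le h(1) Suc.IH[OF nT] by (intro add_mono mult_left_mono)
      finally show ?case by (simp add: algebra_simps)
    qed
  qed
qed

section \<open>Existence and uniqueness of flows\<close>

text \<open>Normalised to vanish at 0, the integral is independent of its left end point as long as
  that lies to the left of 0 and \<open>t\<close>. Hence the antiderivatives on growing intervals
  can be glued to one on the whole line.\<close>

lemma antiderivative_line:
  fixes g :: "real \<Rightarrow> 'a::banach"
  assumes g: "continuous_on UNIV g"
  shows "\<exists>G. G 0 = 0 \<and> (\<forall>t. (G has_vector_derivative g t) (at t))"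
proof -
  define I where "I = (\<lambda>a t. integral {a..t} g - integral {a..0} g)"
  have int: "g integrable_on {a..b}" for a b
    by (rule integrable_continuous_real[OF continuous_on_subset[OF g]]) simp
  have I: "I a t = I b t" if "a \<le> b" "b \<le> t" "b \<le> 0" for a b t
  proof -
    have "integral {a..s} g = integral {a..b} g + integral {b..s} g" if "b \<le> s" for s
      using Henstock_Kurzweil_Integration.integral_combine[OF \<open>a \<le> b\<close> that int] by simp
    from this[OF that(2)] this[OF that(3)] show ?thesis by (simp add: I_def)
  qed
  define G where "G = (\<lambda>t. I (- (\<bar>t\<bar> + 1)) t)"
  have "(G has_vector_derivative g t) (at t)" for t
  proof (rule has_vector_derivative_transform_within_open)
    let ?R = "\<bar>t\<bar> + 1"
    have t: "t \<in> {-?R<..<?R}" by auto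
    have "((\<lambda>u. integral {-?R..u} g) has_vector_derivative g t) (at t within {-?R..?R})"
      using t by (intro integral_has_vector_derivative continuous_on_subset[OF g]) auto
    then have "((\<lambda>u. integral {-?R..u} g) has_vector_derivative g t) (at t within {-?R<..<?R})"
      by (rule has_vector_derivative_within_subset) auto
    then have "((\<lambda>u. integral {-?R..u} g) has_vector_derivative g t) (at t)"
      using at_within_open[OF t open_greaterThanLessThan] by simp
    then show "(I (- ?R) has_vector_derivative g t) (at t)"
      unfolding I_def by (auto intro!: derivative_eq_intros)
    show "open {-?R<..<?R}" by simp
    show "t \<in> {-?R<..<?R}" by (rule t)
    fix s assume s: "s \<in> {-?R<..<?R}"
    show "I (- ?R) s = G s"
    proof (cases "\<bar>t\<bar> \<le> \<bar>s\<bar>")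
      case True
      then show ?thesis unfolding G_def using s by (intro I[symmetric]) auto
    next
      case False
      then show ?thesis unfolding G_def using s by (intro I) auto
    qed
  qed
  moreover have "G 0 = 0" by (simp add: G_def I_def)
  ultimately show ?thesis by blast
qed

lemma has_vector_derivative_reflect:
  assumes "\<And>t. (G has_vector_derivative g t) (at t)"
  shows "((\<lambda>t. G (- t)) has_vector_derivative - g (- t)) (at (t::real))"
proof -
  have "((\<lambda>t::real. - t) has_vector_derivative - 1) (at t)"
    by (auto intro!: derivative_eq_intros)
  from vector_diff_chain_at[OF this assms] show ?thesis by (simp add: comp_def)
qed

text \<open>Integrating the weight \<open>exp (K * \<bar>t\<bar>)\<close> reproduces it with a gain
  of \<open>1 / K\<close>, which is the source of the contraction in the existence proof. Negative
  times follow by reflection.\<close>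

lemma norm_antiderivative_le:
  fixes G :: "real \<Rightarrow> 'a::real_normed_vector"
  assumes "G 0 = 0" and G: "\<And>t. (G has_vector_derivative g t) (at t)"
    and g: "\<And>t. norm (g t) \<le> c * exp (K * \<bar>t\<bar>)" and "K > 0"
  shows "norm (G t) \<le> c / K * exp (K * \<bar>t\<bar>)"
proof -
  have "0 \<le> c" using order_trans[OF norm_ge_zero g[of 0]] by simp
  have pos: "norm (H t) \<le> c / K * exp (K * t)"
    if H0: "H 0 = 0" and H: "\<And>t. (H has_vector_derivative h t) (at t)"
      and h: "\<And>t. norm (h t) \<le> c * exp (K * \<bar>t\<bar>)" and t: "t > 0"
    for H h and t :: real
  proof -
    have "continuous_on {0..t} H"
      by (meson H continuous_at_imp_continuous_on has_vector_derivative_continuous)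
    then have "norm (H t - H 0) \<le> c / K * exp (K * t) - c / K * exp (K * 0)"
    proof (rule differentiable_bound_general[OF t])
      fix s :: real assume "0 < s" "s < t"
      then show "norm (h s) \<le> c * exp (K * s)" using h[of s] by simp
      show "((\<lambda>s. c / K * exp (K * s)) has_vector_derivative c * exp (K * s)) (at s)"
        unfolding has_real_derivative_iff_has_vector_derivative[symmetric]
        using \<open>K > 0\<close> by (auto intro!: derivative_eq_intros)
    qed (use \<open>K > 0\<close> in \<open>auto intro!: continuous_intros H\<close>)
    also have "\<dots> \<le> c / K * exp (K * t)" using \<open>0 \<le> c\<close> \<open>K > 0\<close> by simp
    finally show ?thesis by (simp add: H0)
  qed
  consider "t = 0" | "t > 0" | "t < 0" by linarith
  then show ?thesis
  proof cases
    case 1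
    then show ?thesis using assms \<open>0 \<le> c\<close> by simp
  next
    case 2
    then show ?thesis using pos[OF assms(1) G g] by simp
  next
    case 3
    then show ?thesis
      using pos[of "\<lambda>t. G (- t)" "\<lambda>t. - g (- t)" "- t"] assms(1) g[of "- _"] has_vector_derivative_reflect[OF G]
      by simp
  qed
qed

text \<open>Picard iteration on the whole time axis at once: the solution is sought as
  \<open>x + E t *\<^sub>R y t\<close> with a bounded continuous \<open>y\<close>, so the supremum
  norm of \<open>y\<close> is an exponentially weighted norm of the increment. The bound on
  \<open>F\<close> keeps the image of the integral operator in this space.\<close>

lemma ode_exists:
  fixes F :: "'a::banach \<Rightarrow> 'a"
  assumes "K > 0" and lip: "\<And>x y. norm (F x - F y) \<le> K * norm (x - y)"
    and B: "\<And>x. norm (F x) \<le> B"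
  shows "\<exists>u. u 0 = x \<and> (\<forall>t. (u has_vector_derivative F (u t)) (at t))"
proof -
  \<comment> \<open>The Lipschitz constant \<open>K\<close> against the gain
    \<open>1 / (2 * K)\<close> of this weight yields the contraction factor one half.\<close>
  define E where "E = (\<lambda>t. exp (2 * K * \<bar>t\<bar>) :: real)"
  have E: "E t > 0" "continuous_on UNIV E" for t
    by (auto simp: E_def intro!: continuous_intros)
  have "K-lipschitz_on UNIV F"
    using lip \<open>K > 0\<close> by (auto simp: lipschitz_on_def dist_norm)
  then have contF: "continuous_on UNIV F" by (rule lipschitz_on_continuous_on)
  define g where "g = (\<lambda>(y :: real \<Rightarrow>\<^sub>C 'a) s. F (x + E s *\<^sub>R apply_bcontfun y s))"
  have "continuous_on UNIV (g y)" for y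
    unfolding g_def by (intro continuous_on_compose2[OF contF] continuous_intros E) auto
  then obtain G where G0: "\<And>y. G y 0 = 0" and G: "\<And>y t. (G y has_vector_derivative g y t) (at t)"
    using antiderivative_line[of "g _"] by metis
  have "B \<ge> 0" using B[of 0] norm_ge_zero[of "F 0"] by linarith
  have le: "norm (G y t) \<le> B / (2 * K) * E t" for y t
    unfolding E_def
  proof (rule norm_antiderivative_le[OF G0 G])
    show "norm (g y t) \<le> B * exp (2 * K * \<bar>t\<bar>)" for t
    proof -
      have "norm (g y t) \<le> B * 1" by (simp add: g_def B)
      also have "\<dots> \<le> B * exp (2 * K * \<bar>t\<bar>)"
        using \<open>B \<ge> 0\<close> \<open>K > 0\<close> by (intro mult_left_mono) auto
      finally show ?thesis .
    qed
  qed (use \<open>K > 0\<close> in simp)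
  define T where "T = (\<lambda>y. Bcontfun (\<lambda>t. (1 / E t) *\<^sub>R G y t))"
  have "(\<lambda>t. (1 / E t) *\<^sub>R G y t) \<in> bcontfun" for y
  proof (rule bcontfun_normI)
    have "continuous_on UNIV (G y)"
      by (meson G continuous_at_imp_continuous_on has_vector_derivative_continuous)
    then show "continuous_on UNIV (\<lambda>t. (1 / E t) *\<^sub>R G y t)"
      using E by (intro continuous_intros) (auto simp: less_imp_neq[symmetric])
    show "norm ((1 / E t) *\<^sub>R G y t) \<le> B / (2 * K)" for t
      using le[of y t] E(1)[of t] by (simp add: field_simps)
  qed
  then have T: "apply_bcontfun (T y) t = (1 / E t) *\<^sub>R G y t" for y t
    by (simp add: T_def Bcontfun_inverse)
  have "\<exists>!y. T y = y"
  proof (rule banach_fix_type[of "1/2"])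
    show "\<forall>y z. dist (T y) (T z) \<le> 1 / 2 * dist y z"
    proof (intro allI dist_bound)
      fix y z t
      have "norm (G y t - G z t) \<le> K * dist y z / (2 * K) * exp (2 * K * \<bar>t\<bar>)"
      proof (rule norm_antiderivative_le[where g = "\<lambda>t. g y t - g z t"])
        show "((\<lambda>t. G y t - G z t) has_vector_derivative g y t - g z t) (at t)" for t
          by (intro derivative_intros G)
        fix s
        have "norm (g y s - g z s) \<le> K * norm (E s *\<^sub>R (y s - z s))"
          using lip[of "x + E s *\<^sub>R y s" "x + E s *\<^sub>R z s"]
          by (simp add: g_def scaleR_diff_right)
        also have "\<dots> = K * (E s * dist (y s) (z s))"
          using E(1)[of s] by (simp add: dist_norm)
        also have "\<dots> \<le> K * (E s * dist y z)"
          using E(1)[of s] \<open>K > 0\<close> by (intro mult_left_mono dist_bounded) auto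
        finally show "norm (g y s - g z s) \<le> K * dist y z * exp (2 * K * \<bar>s\<bar>)"
          by (simp add: E_def mult_ac)
      qed (use \<open>K > 0\<close> G0 in auto)
      then have "norm (G y t - G z t) \<le> dist y z / 2 * E t"
        using \<open>K > 0\<close> by (simp add: E_def)
      moreover have "dist (T y t) (T z t) = norm (G y t - G z t) / E t"
        using E(1)[of t] by (simp add: T dist_norm flip: scaleR_diff_right)
      ultimately show "dist (T y t) (T z t) \<le> 1 / 2 * dist y z"
        using E(1)[of t] by (simp add: pos_divide_le_eq)
    qed
  qed auto
  then obtain y where "T y = y" by blast
  then have y: "E t *\<^sub>R y t = G y t" for t
    using T[of y t] E(1)[of t] by simp
  have "((\<lambda>t. x + G y t) has_vector_derivative F (x + G y t)) (at t)" for t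
    using G[of y t] by (auto intro!: derivative_eq_intros simp: g_def y)
  then show ?thesis by (intro exI[of _ "\<lambda>t. x + G y t"]) (simp add: G0)
qed

text \<open>The squared distance damped by \<open>exp (- 2 * K * s)\<close> is nonincreasing for
  positive times; negative times are reflected. The Lipschitz condition is imposed along the two
  curves, because a model function is controlled on \<open>Rn d\<close> and not on all of
  \<open>ell2\<close>.\<close>

lemma ode_unique:
  fixes u v :: "real \<Rightarrow> 'a::real_inner"
  assumes "u 0 = v 0"
    and u: "\<And>t. (u has_vector_derivative F (u t)) (at t)"
    and v: "\<And>t. (v has_vector_derivative F (v t)) (at t)"
    and lip: "\<And>s t. norm (F (u s) - F (v s)) \<le> K * norm (u s - v s)"
  shows "u = v"
proof
  fix t
  have pos: "u t = v t"
    if "u 0 = v 0" "\<And>t. (u has_vector_derivative F (u t)) (at t)"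
      "\<And>t. (v has_vector_derivative F (v t)) (at t)"
      "\<And>s. norm (F (u s) - F (v s)) \<le> K * norm (u s - v s)" "t \<ge> 0"
    for u v :: "real \<Rightarrow> 'a" and F t
  proof -
    define q where "q = (\<lambda>s. ((u s - v s) \<bullet> (u s - v s)) * exp (- 2 * K * s))"
    have "q t \<le> q 0"
    proof (rule DERIV_nonpos_imp_nonincreasing[OF \<open>t \<ge> 0\<close>])
      fix s
      define w where "w = u s - v s"
      define z where "z = F (u s) - F (v s)"
      have "((\<lambda>s. u s - v s) has_vector_derivative z) (at s)"
        unfolding z_def by (intro derivative_intros that)
      then have "((\<lambda>s. u s - v s) has_derivative (\<lambda>h. h *\<^sub>R z)) (at s)"
        by (simp add: has_vector_derivative_def)
      from has_derivative_inner[OF this this]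
      have "((\<lambda>s. (u s - v s) \<bullet> (u s - v s)) has_derivative (\<lambda>h. h * (2 * (w \<bullet> z)))) (at s)"
        by (simp add: w_def inner_commute algebra_simps)
      then have "((\<lambda>s. (u s - v s) \<bullet> (u s - v s)) has_real_derivative 2 * (w \<bullet> z)) (at s)"
        by (simp add: has_field_derivative_def mult_commute_abs)
      then have "(q has_real_derivative 2 * (w \<bullet> z) * exp (- 2 * K * s)
          + (w \<bullet> w) * (exp (- 2 * K * s) * (- 2 * K))) (at s)"
        unfolding q_def by (auto intro!: derivative_eq_intros simp: w_def)
      moreover have "2 * (w \<bullet> z) * exp (- 2 * K * s) + (w \<bullet> w) * (exp (- 2 * K * s) * (- 2 * K)) \<le> 0"
      proof -
        have "w \<bullet> z \<le> norm w * norm z" by (rule norm_cauchy_schwarz)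
        also have "\<dots> \<le> norm w * (K * norm w)"
          unfolding w_def z_def by (intro mult_left_mono that) auto
        also have "\<dots> = K * (w \<bullet> w)" by (simp add: dot_square_norm power2_eq_square)
        finally have "2 * exp (- 2 * K * s) * (w \<bullet> z) \<le> 2 * exp (- 2 * K * s) * (K * (w \<bullet> w))"
          by (intro mult_left_mono) auto
        then show ?thesis by (simp add: mult_ac)
      qed
      ultimately show "\<exists>y. (q has_real_derivative y) (at s) \<and> y \<le> 0" by blast
    qed
    then have "((u t - v t) \<bullet> (u t - v t)) * exp (- 2 * K * t) \<le> 0"
      by (simp add: q_def that)
    then have "(u t - v t) \<bullet> (u t - v t) \<le> 0"
      by (simp add: mult_le_0_iff)
    then show ?thesis by (metis eq_iff_diff_eq_0 inner_gt_zero_iff not_le)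
  qed
  show "u t = v t"
  proof (cases "t \<ge> 0")
    case True
    then show ?thesis using pos[of u v F t] assms by blast
  next
    case False
    have "u (- (- t)) = v (- (- t))"
      by (rule pos[of "\<lambda>t. u (- t)" "\<lambda>t. v (- t)" "\<lambda>x. - F x"])
        (use assms False has_vector_derivative_reflect[OF u] has_vector_derivative_reflect[OF v] in
          \<open>auto simp: norm_minus_commute\<close>)
    then show ?thesis by simp
  qed
qed

section \<open>Uniform limits with bounded derivatives\<close>

lemma k_times_differentiable_Dk:
  assumes "k_times_differentiable d k f" "set vs \<subseteq> Rn d" "length vs + j \<le> k"
  shows "k_times_differentiable d j (Dk d f vs)"
  using assms unfolding k_times_differentiable_def Dk_append[symmetric] by auto

lemma norm_diff_le_vector_derivative:
  fixes w :: "real \<Rightarrow> 'a::real_normed_vector"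
  assumes "\<And>t. (w has_vector_derivative w' t) (at t)" "\<And>t. norm (w' t) \<le> B"
  shows "norm (w a - w b) \<le> B * \<bar>a - b\<bar>"
proof -
  have "norm (w a - w b) \<le> B * norm (a - b)"
  proof (rule differentiable_bound[where S = UNIV and f' = "\<lambda>t h. h *\<^sub>R w' t"])
    show "onorm (\<lambda>h. h *\<^sub>R w' t) \<le> B" for t
      using assms(2)[of t] by (intro onorm_le) (simp add: mult.commute[of B] mult_left_mono)
  qed (use assms(1) in \<open>auto simp: has_vector_derivative_def\<close>)
  then show ?thesis by simp
qed

lemma line_has_vector_derivative:
  assumes "g differentiable_on Rn d" "x \<in> Rn d" "v \<in> Rn d"
  shows "((\<lambda>r. g (x + r *\<^sub>R v)) has_vector_derivative Dk d g [v] (x + r *\<^sub>R v)) (at r)"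
proof -
  have xr: "x + r *\<^sub>R v \<in> Rn d" for r
    using assms by (intro Rn_add Rn_scale)
  let ?D = "\<lambda>h. Dk d g [proj d h] (x + r *\<^sub>R v)"
  have D: "(g has_derivative ?D) (at (x + r *\<^sub>R v) within Rn d)"
    using Dk_has_derivative[of d g "[]"] assms(1) xr by simp
  then have "(g has_derivative ?D) (at (x + r *\<^sub>R v) within range (\<lambda>r. x + r *\<^sub>R v))"
    by (rule has_derivative_subset) (use xr in auto)
  then have "((\<lambda>r. g (x + r *\<^sub>R v)) has_derivative (\<lambda>h. ?D (h *\<^sub>R v))) (at r)"
    by (rule has_derivative_in_compose[rotated]) (auto intro!: derivative_eq_intros)
  moreover have "?D (h *\<^sub>R v) = h *\<^sub>R ?D v" for h
    using linear_scale[OF has_derivative_linear[OF D]] .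
  ultimately show ?thesis
    using assms(3) by (simp add: has_vector_derivative_def del: Dk.simps)
qed

lemma lipschitz_Rn:
  assumes g: "k_times_differentiable d 1 g"
    and K: "\<And>v x. v \<in> usph d \<Longrightarrow> x \<in> Rn d \<Longrightarrow> norm (Dk d g [v] x) \<le> K" "K \<ge> 0"
    and "x \<in> Rn d" "y \<in> Rn d"
  shows "norm (g x - g y) \<le> K * norm (x - y)"
proof (rule differentiable_bound[OF convex_Rn _ _ assms(4,5), where f' = "\<lambda>x h. Dk d g [proj d h] x"])
  fix x assume x: "x \<in> Rn d"
  show "(g has_derivative (\<lambda>h. Dk d g [proj d h] x)) (at x within Rn d)"
    using k_times_differentiable_has_derivative[OF g, of "[]"] x by simp
  show "onorm (\<lambda>h. Dk d g [proj d h] x) \<le> K"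
  proof (rule onorm_bound[OF K(2)])
    fix h
    have "norm (Dk d g [proj d h] x) \<le> K * prod_list (map norm [proj d h])"
    proof (rule Dk_norm_le[OF g x, where n = 1])
      show "norm (Dk d g vs x) \<le> K" if "set vs \<subseteq> usph d" "length vs = 1" for vs
        using that K(1)[OF _ x] by (cases vs) auto
    qed auto
    also have "\<dots> \<le> K * norm h"
      using norm_proj_le K(2) by (simp add: mult_left_mono)
    finally show "norm (Dk d g [proj d h] x) \<le> K * norm h" .
  qed
qed

text \<open>
  Landau's inequality: a derivative is controlled by the function and the second derivative, so
  uniform convergence is inherited by all derivatives but the last bounded one.
\<close>

lemma norm_derivative_le_Landau:
  assumes h: "k_times_differentiable d 2 h"
    and "\<And>x. x \<in> Rn d \<Longrightarrow> norm (h x) \<le> \<eta>"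
    and K: "\<And>x. x \<in> Rn d \<Longrightarrow> norm (Dk d h [v, v] x) \<le> K"
    and x: "x \<in> Rn d" and v: "v \<in> Rn d" and "s > 0"
  shows "norm (Dk d h [v] x) \<le> 2 * \<eta> / s + s * K"
proof -
  have xr: "x + r *\<^sub>R v \<in> Rn d" for r
    using x v by (intro Rn_add Rn_scale)
  have d1: "((\<lambda>r. h (x + r *\<^sub>R v)) has_vector_derivative Dk d h [v] (x + r *\<^sub>R v)) (at r)" for r
    using k_times_differentiableD[OF h, of "[]"] by (intro line_has_vector_derivative x v) simp
  have d2: "((\<lambda>r. Dk d h [v] (x + r *\<^sub>R v)) has_vector_derivative Dk d h [v, v] (x + r *\<^sub>R v)) (at r)" for r
    using line_has_vector_derivative[OF k_times_differentiableD[OF h, of "[v]"] x v, of r] v by simp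
  have "norm (h (x + s *\<^sub>R v) - h (x + 0 *\<^sub>R v) - (s - 0) *\<^sub>R Dk d h [v] (x + 0 *\<^sub>R v)) \<le> norm (s - 0) * (K * s)"
  proof (rule vector_differentiable_bound_linearization[where S = "{0..s}"])
    fix r assume r: "r \<in> {0..s}"
    show "((\<lambda>r. h (x + r *\<^sub>R v)) has_vector_derivative Dk d h [v] (x + r *\<^sub>R v)) (at r within {0..s})"
      by (rule has_vector_derivative_at_within[OF d1])
    have "norm (Dk d h [v] (x + r *\<^sub>R v) - Dk d h [v] (x + 0 *\<^sub>R v)) \<le> K * \<bar>r - 0\<bar>"
      using norm_diff_le_vector_derivative[OF d2 K[OF xr], of r 0] .
    also have "\<dots> \<le> K * s"
      using r order_trans[OF norm_ge_zero K[OF x]] by (intro mult_left_mono) auto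
    finally show "norm (Dk d h [v] (x + r *\<^sub>R v) - Dk d h [v] (x + 0 *\<^sub>R v)) \<le> K * s" .
  qed (use \<open>s > 0\<close> in \<open>auto simp: closed_segment_eq_real_ivl\<close>)
  then have *: "norm (h (x + s *\<^sub>R v) - h x - s *\<^sub>R Dk d h [v] x) \<le> s * (K * s)"
    using \<open>s > 0\<close> by simp
  have "s *\<^sub>R Dk d h [v] x = h (x + s *\<^sub>R v) - h x - (h (x + s *\<^sub>R v) - h x - s *\<^sub>R Dk d h [v] x)"
    by simp
  then have "norm (s *\<^sub>R Dk d h [v] x)
      \<le> norm (h (x + s *\<^sub>R v)) + norm (h x) + norm (h (x + s *\<^sub>R v) - h x - s *\<^sub>R Dk d h [v] x)"
    by (metis (no_types, opaque_lifting) add_right_mono norm_triangle_ineq4 order_trans)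
  also have "\<dots> \<le> \<eta> + \<eta> + s * (K * s)"
    using * assms(2)[OF xr] assms(2)[OF x] by (intro add_mono) auto
  finally show ?thesis
    using \<open>s > 0\<close> by (simp add: field_simps del: Dk.simps)
qed

text \<open>Landau's inequality for \<open>H n - H m\<close> makes the first derivatives uniformly
  Cauchy, the second ones being bounded. The theorem on termwise differentiation then identifies
  their limit as the derivative of \<open>G\<close>.\<close>

lemma uniform_limit_derivative:
  fixes H :: "nat \<Rightarrow> ell2 \<Rightarrow> 'b::banach"
  assumes H: "\<And>n. k_times_differentiable d 2 (H n)"
    and K: "\<And>n v x. v \<in> usph d \<Longrightarrow> x \<in> Rn d \<Longrightarrow> norm (Dk d (H n) [v, v] x) \<le> K"
    and lim: "uniform_limit (Rn d) H G sequentially" and "K \<ge> 0"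
  shows "G differentiable_on Rn d"
    and "v \<in> Rn d \<Longrightarrow> uniform_limit (Rn d) (\<lambda>n. Dk d (H n) [v]) (Dk d G [v]) sequentially"
proof -
  have diff: "k_times_differentiable d 2 (\<lambda>x. H n x - H m x)"
    "set vs \<subseteq> Rn d \<Longrightarrow> length vs \<le> 2 \<Longrightarrow> x \<in> Rn d \<Longrightarrow>
      Dk d (\<lambda>x. H n x - H m x) vs x = Dk d (H n) vs x - Dk d (H m) vs x" for n m vs x
    using Dk_add_scaled(1)[OF H[of n] H[of m], of "-1"]
      Dk_add_scaled(2)[OF H[of n] H[of m], of vs x "-1"] by simp_all
  define f' where "f' = (\<lambda>n x h. Dk d (H n) [proj d h] x)"
  have cauchy: "\<exists>N. \<forall>n\<ge>N. \<forall>m\<ge>N. \<forall>x\<in>Rn d. \<forall>h. norm (f' n x h - f' m x h) \<le> e * norm h"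
    if "e > 0" for e
  proof -
    \<comment> \<open>The difference of two members has second derivative at most
      \<open>2 * K\<close>. This \<open>s\<close> makes the term \<open>s * (2 * K)\<close> at most
      \<open>e / 2\<close>, and \<eta> then makes the other term equal to \<open>e / 2\<close>;
      \<open>K + 1\<close> avoids a division by zero.\<close>
    define s where "s = e / (4 * (K + 1))"
    define \<eta> where "\<eta> = s * e / 4"
    have s: "s > 0" "\<eta> > 0"
      using that \<open>K \<ge> 0\<close> by (auto simp: s_def \<eta>_def)
    have "2 * \<eta> / s + s * (2 * K) \<le> e"
    proof -
      have "2 * \<eta> / s = e / 2" using s by (simp add: \<eta>_def)
      moreover have "s * (2 * K) \<le> e / 2"
        using that \<open>K \<ge> 0\<close> by (simp add: s_def field_simps)
      ultimately show ?thesis by linarith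
    qed
    obtain N where N: "\<And>n x. n \<ge> N \<Longrightarrow> x \<in> Rn d \<Longrightarrow> dist (H n x) (G x) < \<eta> / 2"
      using uniform_limitD[OF lim, of "\<eta> / 2"] s unfolding eventually_sequentially by auto
    have "norm (f' n x h - f' m x h) \<le> e * norm h" if nm: "n \<ge> N" "m \<ge> N" and x: "x \<in> Rn d" for n m x h
    proof -
      let ?h = "\<lambda>x. H n x - H m x"
      have unit: "norm (Dk d ?h [v] x) \<le> e" if "v \<in> usph d" for v
      proof -
        have v: "v \<in> Rn d" using that usph_subset by blast
        have "norm (Dk d ?h [v] x) \<le> 2 * \<eta> / s + s * (2 * K)"
        proof (rule norm_derivative_le_Landau[OF diff(1) _ _ x v s(1)])
          fix y assume y: "y \<in> Rn d"
          have "dist (H n y) (H m y) < \<eta>"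
            by (rule dist_triangle_half_l[OF N[OF nm(1) y] N[OF nm(2) y]])
          then show "norm (H n y - H m y) \<le> \<eta>" by (simp add: dist_norm)
          have "norm (Dk d ?h [v, v] y) \<le> norm (Dk d (H n) [v, v] y) + norm (Dk d (H m) [v, v] y)"
            using diff(2)[of "[v, v]" y n m] v y norm_triangle_ineq4 by (simp del: Dk.simps)
          also have "\<dots> \<le> 2 * K" using K[OF that y, of n] K[OF that y, of m] by linarith
          finally show "norm (Dk d ?h [v, v] y) \<le> 2 * K" .
        qed
        with \<open>2 * \<eta> / s + s * (2 * K) \<le> e\<close> show ?thesis by linarith
      qed
      have "norm (Dk d ?h [proj d h] x) \<le> e * prod_list (map norm [proj d h])"
      proof (rule Dk_norm_le[OF diff(1) x, where n = 1])
        show "norm (Dk d ?h vs x) \<le> e" if "set vs \<subseteq> usph d" "length vs = 1" for vs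
          using that unit by (cases vs) (auto simp del: Dk.simps)
      qed auto
      also have "\<dots> \<le> e * norm h"
        using norm_proj_le \<open>e > 0\<close> by simp
      finally show ?thesis
        using diff(2)[of "[proj d h]" x n m] x by (simp add: f'_def del: Dk.simps)
    qed
    then show ?thesis by blast
  qed
  define g' where "g' = (\<lambda>x h. lim (\<lambda>n. f' n x h))"
  have g': "(\<lambda>n. f' n x h) \<longlonglongrightarrow> g' x h" if x: "x \<in> Rn d" for x h
  proof -
    have "Cauchy (\<lambda>n. f' n x h)"
    proof (rule CauchyI)
      fix e :: real assume "e > 0"
      then obtain N where "\<And>n m. n \<ge> N \<Longrightarrow> m \<ge> N \<Longrightarrow>
          norm (f' n x h - f' m x h) \<le> e / (norm h + 1) * norm h"
        using cauchy[of "e / (norm h + 1)"] x by (metis add_nonneg_pos divide_pos_pos norm_ge_zero zero_less_one)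
      moreover have "e / (norm h + 1) * norm h < e"
        using \<open>e > 0\<close> by (simp add: pos_divide_less_eq add_nonneg_pos)
      ultimately show "\<exists>M. \<forall>m\<ge>M. \<forall>n\<ge>M. norm (f' m x h - f' n x h) < e"
        by (meson order_le_less_trans)
    qed
    then show ?thesis
      unfolding g'_def by (simp add: Cauchy_convergent_iff convergent_LIMSEQ_iff)
  qed
  have nle: "\<exists>N. \<forall>n\<ge>N. \<forall>x\<in>Rn d. \<forall>h. norm (f' n x h - g' x h) \<le> e * norm h" if "e > 0" for e
  proof -
    obtain N where N: "\<And>n m x h. n \<ge> N \<Longrightarrow> m \<ge> N \<Longrightarrow> x \<in> Rn d \<Longrightarrow>
        norm (f' n x h - f' m x h) \<le> e * norm h"
      using cauchy[OF \<open>e > 0\<close>] by blast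
    have "norm (f' n x h - g' x h) \<le> e * norm h" if "n \<ge> N" "x \<in> Rn d" for n x h
    proof (rule LIMSEQ_le_const2)
      show "(\<lambda>m. norm (f' n x h - f' m x h)) \<longlonglongrightarrow> norm (f' n x h - g' x h)"
        by (intro tendsto_intros g' that)
      show "\<exists>N. \<forall>m\<ge>N. norm (f' n x h - f' m x h) \<le> e * norm h"
        using N[OF that(1) _ that(2)] by blast
    qed
    then show ?thesis by blast
  qed
  have "\<exists>g. \<forall>x\<in>Rn d. (\<lambda>n. H n x) \<longlonglongrightarrow> g x \<and> (g has_derivative g' x) (at x within Rn d)"
  proof (rule has_derivative_sequence[OF convex_Rn, where f' = f'])
    show "(H n has_derivative f' n x) (at x within Rn d)" if "x \<in> Rn d" for n x
      using k_times_differentiable_has_derivative[OF H, of "[]"] that by (simp add: f'_def)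
    show "\<forall>\<^sub>F n in sequentially. \<forall>x\<in>Rn d. \<forall>h. norm (f' n x h - g' x h) \<le> e * norm h" if "e > 0" for e
      using nle[OF that] by (simp add: eventually_sequentially)
    show "0 \<in> Rn d" by simp
    show "(\<lambda>n. H n 0) \<longlonglongrightarrow> G 0" by (rule tendsto_uniform_limitI[OF lim]) simp
  qed
  then obtain g where g: "\<And>x. x \<in> Rn d \<Longrightarrow> (\<lambda>n. H n x) \<longlonglongrightarrow> g x"
      "\<And>x. x \<in> Rn d \<Longrightarrow> (g has_derivative g' x) (at x within Rn d)"
    by blast
  have "G x = g x" if "x \<in> Rn d" for x
    using LIMSEQ_unique[OF tendsto_uniform_limitI[OF lim that] g(1)[OF that]] .
  then have G: "(G has_derivative g' x) (at x within Rn d)" if "x \<in> Rn d" for x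
    using has_derivative_transform[OF that _ g(2)[OF that], of G] that by blast
  then show "G differentiable_on Rn d"
    by (auto simp: differentiable_on_def intro: differentiableI)
  assume v: "v \<in> Rn d"
  have Gv: "Dk d G [v] x = g' x v" if "x \<in> Rn d" for x
    using Dk_Cons_eq[of d G "[]"] G that v by simp
  show "uniform_limit (Rn d) (\<lambda>n. Dk d (H n) [v]) (Dk d G [v]) sequentially"
  proof (rule uniform_limitI)
    fix e :: real assume "e > 0"
    then have "e / (norm v + 1) > 0" by (simp add: add_nonneg_pos)
    then obtain N where N: "\<And>n x. n \<ge> N \<Longrightarrow> x \<in> Rn d \<Longrightarrow>
        norm (f' n x v - g' x v) \<le> e / (norm v + 1) * norm v"
      using nle by blast
    moreover have "e / (norm v + 1) * norm v < e"
      using \<open>e > 0\<close> by (simp add: pos_divide_less_eq add_nonneg_pos)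
    ultimately show "\<forall>\<^sub>F n in sequentially. \<forall>x\<in>Rn d. dist (Dk d (H n) [v] x) (Dk d G [v] x) < e"
      unfolding eventually_sequentially
      by (intro exI[of _ N]) (use v in \<open>auto simp: dist_norm Gv f'_def simp del: Dk.simps intro: order_le_less_trans\<close>)
  qed
qed

text \<open>Passing from one order of the limit to the next uses bounds two orders above the current
  one, so \<open>Suc k\<close> orders of the approximations yield \<open>k\<close> of the limit. At
  order \<open>k\<close> all approximations share the Lipschitz constant \<open>K\<close>, which a
  pointwise limit inherits.\<close>

lemma uniform_limit_Dk:
  fixes g :: "nat \<Rightarrow> ell2 \<Rightarrow> 'b::banach"
  assumes g: "\<And>n. k_times_differentiable d (Suc k) (g n)"
    and K: "\<And>n vs x. set vs \<subseteq> usph d \<Longrightarrow> 1 \<le> length vs \<Longrightarrow> length vs \<le> Suc k \<Longrightarrow> x \<in> Rn d \<Longrightarrow>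
      norm (Dk d (g n) vs x) \<le> K"
    and lim: "uniform_limit (Rn d) g G sequentially" and "K \<ge> 0"
  shows "k_times_differentiable d k G"
    and "set vs \<subseteq> usph d \<Longrightarrow> length vs = k \<Longrightarrow> x \<in> Rn d \<Longrightarrow> y \<in> Rn d \<Longrightarrow>
      norm (Dk d G vs x - Dk d G vs y) \<le> K * norm (x - y)"
proof -
  have step: "Dk d G vs differentiable_on Rn d"
    "v \<in> Rn d \<Longrightarrow> uniform_limit (Rn d) (\<lambda>n. Dk d (g n) (v # vs)) (Dk d G (v # vs)) sequentially"
    if vs: "set vs \<subseteq> Rn d" "length vs < k"
      and l: "uniform_limit (Rn d) (\<lambda>n. Dk d (g n) vs) (Dk d G vs) sequentially" for vs v
  proof -
    have 1: "k_times_differentiable d 2 (Dk d (g n) vs)" for n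
      using vs by (intro k_times_differentiable_Dk[OF g]) auto
    have 2: "norm (Dk d (Dk d (g n) vs) [v, v] x) \<le> K * prod_list (map norm vs)"
      if "v \<in> usph d" "x \<in> Rn d" for n v x
    proof -
      have "norm (Dk d (g n) ([v, v] @ vs) x) \<le> K * prod_list (map norm ([v, v] @ vs))"
        using vs that usph_subset by (intro Dk_norm_le[OF g, where n = "length ([v, v] @ vs)"] K) auto
      then show ?thesis using that by (simp add: usph_def)
    qed
    have 3: "0 \<le> K * prod_list (map norm vs)"
      using \<open>K \<ge> 0\<close> by (intro mult_nonneg_nonneg prod_list_nonneg) auto
    show "Dk d G vs differentiable_on Rn d"
      by (rule uniform_limit_derivative(1)[OF 1 2 l 3])
    show "v \<in> Rn d \<Longrightarrow> uniform_limit (Rn d) (\<lambda>n. Dk d (g n) (v # vs)) (Dk d G (v # vs)) sequentially"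
      using uniform_limit_derivative(2)[OF 1 2 l 3] by simp
  qed
  have lim': "set vs \<subseteq> Rn d \<Longrightarrow> length vs \<le> k \<Longrightarrow>
      uniform_limit (Rn d) (\<lambda>n. Dk d (g n) vs) (Dk d G vs) sequentially" for vs
    by (induction vs) (use lim step(2) in \<open>auto simp del: Dk.simps(2)\<close>)
  then show "k_times_differentiable d k G"
    using step(1) by (auto simp: k_times_differentiable_def)
  assume vs: "set vs \<subseteq> usph d" "length vs = k" and x: "x \<in> Rn d" "y \<in> Rn d"
  have vsR: "set vs \<subseteq> Rn d" using vs usph_subset by blast
  show "norm (Dk d G vs x - Dk d G vs y) \<le> K * norm (x - y)"
  proof (rule LIMSEQ_le_const2)
    show "(\<lambda>n. norm (Dk d (g n) vs x - Dk d (g n) vs y)) \<longlonglongrightarrow> norm (Dk d G vs x - Dk d G vs y)"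
      using vs vsR by (intro tendsto_intros tendsto_uniform_limitI[OF lim'] x) auto
    have "norm (Dk d (g n) vs x - Dk d (g n) vs y) \<le> K * norm (x - y)" for n
    proof (rule lipschitz_Rn[OF _ _ \<open>K \<ge> 0\<close> x])
      show "k_times_differentiable d 1 (Dk d (g n) vs)"
        using vs vsR by (intro k_times_differentiable_Dk[OF g]) auto
      show "norm (Dk d (Dk d (g n) vs) [v] z) \<le> K" if "v \<in> usph d" "z \<in> Rn d" for v z
        using K[of "v # vs" z n] vs that by simp
    qed
    then show "\<exists>N. \<forall>n\<ge>N. norm (Dk d (g n) vs x - Dk d (g n) vs y) \<le> K * norm (x - y)"
      by blast
  qed
qed

section \<open>Regularity of the flow\<close>

lemma bounded_smooth_lipschitz:
  assumes f: "bounded_smooth d k M f" "k \<ge> 1" "M \<ge> 0" and "x \<in> Rn d" "y \<in> Rn d"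
  shows "norm (f x - f y) \<le> M * norm (x - y)"
proof (rule lipschitz_Rn[OF _ _ assms(3-5)])
  show "k_times_differentiable d 1 f"
    using k_times_differentiable_mono[OF bounded_smoothD(2)[OF f(1)] f(2)] .
  show "norm (Dk d f [v] z) \<le> M" if "v \<in> usph d" "z \<in> Rn d" for v z
    using bounded_smoothD(3)[OF f(1), of "[v]" z] that f(2) by simp
qed

text \<open>The field is meaningful on \<open>Rn d\<close> only, so the equation is solved in
  \<open>ell2\<close> for \<open>f\<close> after the projection. The coordinates of index at least
  \<open>d\<close> have derivative 0 along the solution and stay 0, so the projection acts as the
  identity there. Uniqueness then evaluates the definite description in \<open>flow\<close>.\<close>

lemma flow_solution:
  assumes f: "bounded_smooth d k M f" "k \<ge> 1" "M > 0" and x: "x \<in> Rn d"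
  shows "flow d f x 0 = x" and "flow d f x t \<in> Rn d"
    and "(flow d f x has_vector_derivative f (flow d f x t)) (at t)"
proof -
  note lip = bounded_smooth_lipschitz[OF f(1,2) less_imp_le[OF f(3)]]
  have "\<exists>u. u 0 = x \<and> (\<forall>t. (u has_vector_derivative f (proj d (u t))) (at t))"
  proof (rule ode_exists[OF f(3)])
    show "norm (f (proj d y)) \<le> M" for y
      using bounded_smooth_norm_le[OF f(1)] by simp
    show "norm (f (proj d y) - f (proj d z)) \<le> M * norm (y - z)" for y z
    proof -
      have "norm (f (proj d y) - f (proj d z)) \<le> M * norm (proj d y - proj d z)"
        by (rule lip) auto
      also have "\<dots> = M * norm (proj d (y - z))"
        by (simp add: linear_diff[OF bounded_linear.linear[OF bounded_linear_proj]])
      also have "\<dots> \<le> M * norm (y - z)"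
        using norm_proj_le f(3) by (intro mult_left_mono) auto
      finally show ?thesis .
    qed
  qed
  then obtain u where u0: "u 0 = x"
      and u: "\<And>t. (u has_vector_derivative f (proj d (u t))) (at t)"
    by blast
  have uR: "u t \<in> Rn d" for t
  proof -
    have "coord (u t) i = 0" if "i \<ge> d" for i
    proof -
      have "((\<lambda>t. coord (u t) i) has_real_derivative 0) (at t)" for t
      proof -
        have "f (proj d (u t)) \<in> Rn d" using bounded_smoothD(1)[OF f(1)] by auto
        then have "coord (f (proj d (u t))) i = 0" using that by (simp add: Rn_def)
        with bounded_linear.has_vector_derivative[OF bounded_linear_coord u, of i t]
        show ?thesis by (simp add: has_real_derivative_iff_has_vector_derivative)
      qed
      then have "coord (u t) i = coord (u 0) i" using DERIV_isconst_all[of "\<lambda>t. coord (u t) i" t 0] by blast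
      then show ?thesis using u0 x that by (simp add: Rn_def)
    qed
    then show ?thesis by (simp add: Rn_def)
  qed
  have "flow d f x = u"
    unfolding flow_def
  proof (rule the_equality)
    show "u 0 = x \<and> range u \<subseteq> Rn d \<and> (\<forall>t. (u has_vector_derivative f (u t)) (at t))"
      using u0 uR u by auto
    fix w assume w: "w 0 = x \<and> range w \<subseteq> Rn d \<and> (\<forall>t. (w has_vector_derivative f (w t)) (at t))"
    show "w = u"
      by (rule ode_unique[where F = f and K = M]) (use w u0 u uR in \<open>auto intro!: lip\<close>)
  qed
  then show "flow d f x 0 = x" "flow d f x t \<in> Rn d"
    "(flow d f x has_vector_derivative f (flow d f x t)) (at t)"
    using u0 uR u[of t] by auto
qed

lemma norm_flow_diff_le:
  assumes f: "bounded_smooth d k M f" "k \<ge> 1" "M > 0" and x: "x \<in> Rn d"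
  shows "norm (flow d f x s - flow d f x t) \<le> M * \<bar>s - t\<bar>"
  by (rule norm_diff_le_vector_derivative[OF flow_solution(3)[OF f x]
      bounded_smooth_norm_le[OF f(1) flow_solution(2)[OF f x]]])

text \<open>During one step the field along the trajectory changes by at most
  \<open>M * (M * h)\<close>, hence a local error of order \<open>h\<^sup>2\<close>. Gronwall's
  lemma accumulates these to order \<open>h\<close>, uniformly in the starting point.\<close>

lemma flow_euler_error:
  assumes f: "bounded_smooth d k M f" "k \<ge> 1" "M > 0" and x: "x \<in> Rn d" and h: "h \<ge> 0"
  shows "norm (flow d f x (real n * h) - euler f h n x) \<le> (real n * h) * (M\<^sup>2 * h) * exp ((real n * h) * M)"
proof -
  let ?u = "flow d f x"
  define a where "a = (\<lambda>j. norm (?u (real j * h) - euler f h j x))"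
  have "a n \<le> (0 + real n * (h * (M * (M * h)))) * exp (real n * (h * M))"
  proof (rule discrete_gronwall)
    fix i
    let ?t = "real i * h"
    note eR = euler_in_Rn[OF bounded_smoothD(1)[OF f(1)] x]
    have "norm (?u (?t + h) - ?u ?t - (?t + h - ?t) *\<^sub>R f (?u ?t)) \<le> norm (?t + h - ?t) * (M * (M * h))"
    proof (rule vector_differentiable_bound_linearization[where S = "{?t..?t + h}"])
      fix s assume s: "s \<in> {?t..?t + h}"
      show "(?u has_vector_derivative f (?u s)) (at s within {?t..?t + h})"
        by (rule has_vector_derivative_at_within[OF flow_solution(3)[OF f x]])
      have "norm (f (?u s) - f (?u ?t)) \<le> M * norm (?u s - ?u ?t)"
        using f by (intro bounded_smooth_lipschitz[OF f(1,2)] flow_solution(2)[OF f x]) auto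
      also have "\<dots> \<le> M * (M * \<bar>s - ?t\<bar>)"
        using f by (intro mult_left_mono norm_flow_diff_le[OF f x]) auto
      also have "\<dots> \<le> M * (M * h)"
        using f s by (intro mult_left_mono) auto
      finally show "norm (f (?u s) - f (?u ?t)) \<le> M * (M * h)" .
    qed (use h in \<open>auto simp: closed_segment_eq_real_ivl\<close>)
    then have 1: "norm (?u (?t + h) - ?u ?t - h *\<^sub>R f (?u ?t)) \<le> h * (M * (M * h))"
      using h by simp
    have 2: "norm (h *\<^sub>R (f (?u ?t) - f (euler f h i x))) \<le> h * (M * a i)"
      unfolding norm_scaleR a_def using h f
      by (auto intro!: mult_left_mono bounded_smooth_lipschitz[OF f(1,2)] flow_solution(2)[OF f x] eR)
    have "a (Suc i) = norm ((?u (?t + h) - ?u ?t - h *\<^sub>R f (?u ?t))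
        + ((?u ?t - euler f h i x) + h *\<^sub>R (f (?u ?t) - f (euler f h i x))))"
      by (simp add: a_def algebra_simps)
    also have "\<dots> \<le> h * (M * (M * h)) + (a i + h * (M * a i))"
      using 1 2 by (intro norm_triangle_le add_mono) (auto simp: a_def)
    finally show "a (Suc i) \<le> (1 + h * M) * a i + h * (M * (M * h))"
      by (simp add: algebra_simps)
  next
    show "a 0 \<le> 0" using flow_solution(1)[OF f x] by (simp add: a_def)
  qed (use h f in auto)
  then show ?thesis by (simp add: a_def power2_eq_square mult_ac)
qed

lemma flow_increment_holder:
  assumes "M > 0" "T \<ge> 0" "k \<ge> 1"
  shows "\<exists>C>0. \<forall>d f t. bounded_smooth d k M f \<longrightarrow> 0 < t \<longrightarrow> t \<le> T \<longrightarrow>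
    (\<lambda>x. flow d f x t - x) \<in> holder_class d k (C * t)"
proof -
  obtain C where C: "C > 0" "\<And>d f h n x vs. bounded_smooth d k M f \<Longrightarrow> h \<ge> 0 \<Longrightarrow> real n * h \<le> T \<Longrightarrow>
      x \<in> Rn d \<Longrightarrow> set vs \<subseteq> usph d \<Longrightarrow> 1 \<le> length vs \<Longrightarrow> length vs \<le> k \<Longrightarrow>
      norm (Dk d (\<lambda>x. euler f h n x - x) vs x) \<le> real n * h * C"
    using norm_Dk_euler_increment_le[OF less_imp_le[OF assms(1)] assms(2), of k] by blast
  obtain k' where k': "k = Suc k'" using \<open>k \<ge> 1\<close> by (cases k) auto
  have "(\<lambda>x. flow d f x t - x) \<in> holder_class d k (C * t)"
    if f: "bounded_smooth d k M f" and t: "0 < t" "t \<le> T" for d f t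
  proof -
    let ?G = "\<lambda>x. flow d f x t - x"
    \<comment> \<open>\<open>Suc n\<close> steps of size \<open>t / real (Suc n)\<close> end exactly
      at time \<open>t\<close>, so the derivative bound is \<open>C * t\<close> for every
      \<open>n\<close> while the distance to the flow tends to 0.\<close>
    define g where "g = (\<lambda>n x. euler f (t / real (Suc n)) (Suc n) x - x)"
    have nh: "real (Suc n) * (t / real (Suc n)) = t" for n by simp
    have g: "k_times_differentiable d (Suc k') (g n)" for n
      using Dk_add_scaled(1)[OF k_times_differentiable_euler[OF bounded_smoothD(2,1)[OF f],
            of "t / real (Suc n)" "Suc n"] Dk_id(1), of "-1"]
      by (simp add: g_def k' del: euler.simps of_nat_Suc)
    have K: "norm (Dk d (g n) vs x) \<le> C * t"
      if "set vs \<subseteq> usph d" "1 \<le> length vs" "length vs \<le> Suc k'" "x \<in> Rn d" for n vs x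
      using C(2)[OF f, of "t / real (Suc n)" "Suc n" x vs] that t unfolding nh g_def k'
      by (simp add: mult.commute del: euler.simps of_nat_Suc)
    have lim: "uniform_limit (Rn d) g ?G sequentially"
    proof (rule uniform_limitI)
      fix e :: real assume "e > 0"
      have "(\<lambda>n. t * M\<^sup>2 * t * exp (t * M) * inverse (real (Suc n))) \<longlonglongrightarrow> t * M\<^sup>2 * t * exp (t * M) * 0"
        by (intro tendsto_intros LIMSEQ_inverse_real_of_nat)
      then have "\<forall>\<^sub>F n in sequentially. t * M\<^sup>2 * t * exp (t * M) * inverse (real (Suc n)) < e"
        using \<open>e > 0\<close> by (auto dest: order_tendstoD)
      then show "\<forall>\<^sub>F n in sequentially. \<forall>x\<in>Rn d. dist (g n x) (?G x) < e"
      proof (eventually_elim, intro ballI)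
        fix n x assume n: "t * M\<^sup>2 * t * exp (t * M) * inverse (real (Suc n)) < e" and x: "x \<in> Rn d"
        have "norm (flow d f x t - euler f (t / real (Suc n)) (Suc n) x)
            \<le> t * (M\<^sup>2 * (t / real (Suc n))) * exp (t * M)"
          using flow_euler_error[OF f assms(3,1) x, of "t / real (Suc n)" "Suc n"] t
          unfolding nh by simp
        also have "\<dots> = t * M\<^sup>2 * t * exp (t * M) * inverse (real (Suc n))"
          by (simp add: divide_inverse mult_ac)
        finally show "dist (g n x) (?G x) < e"
          using n by (simp add: dist_norm g_def norm_minus_commute del: euler.simps of_nat_Suc)
      qed
    qed
    have "0 \<le> C * t" using C(1) t by simp
    then have G: "k_times_differentiable d k' ?G"
      and G_lip: "\<And>vs x y. set vs \<subseteq> usph d \<Longrightarrow> length vs = k' \<Longrightarrow> x \<in> Rn d \<Longrightarrow> y \<in> Rn d \<Longrightarrow>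
        norm (Dk d ?G vs x - Dk d ?G vs y) \<le> C * t * norm (x - y)"
      by - (rule uniform_limit_Dk[OF g K lim], assumption+)+
    show ?thesis
      unfolding holder_class_def
    proof (intro CollectI conjI allI impI ballI)
      show "?G \<in> Rn d \<rightarrow> Rn d"
        using flow_solution(2)[OF f assms(3,1)] by (auto intro: Rn_diff)
      fix i assume "i < d"
      note Gi = Dk_linear_image[OF G bounded_linear_coord[of i]]
      show "k_times_differentiable d (k - 1) (\<lambda>x. coord (?G x) i)"
        using Gi(1) by (simp add: k')
      fix x y assume xy: "x \<in> Rn d" "y \<in> Rn d"
      show "opnorm d (k - 1) (\<lambda>vs. Dk d (\<lambda>x. coord (?G x) i) vs x - Dk d (\<lambda>x. coord (?G x) i) vs y)
          \<le> ennreal (C * t * norm (x - y))"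
        unfolding opnorm_def
      proof (rule SUP_least, rule ennreal_leI)
        fix vs assume "vs \<in> {vs. length vs = k - 1 \<and> (\<forall>v\<in>set vs. v \<in> Rn d \<and> norm v = 1)}"
        then have vs: "length vs = k'" "set vs \<subseteq> usph d" "set vs \<subseteq> Rn d"
          by (auto simp: k' usph_def)
        have "Dk d (\<lambda>x. coord (?G x) i) vs x - Dk d (\<lambda>x. coord (?G x) i) vs y
            = coord (Dk d ?G vs x - Dk d ?G vs y) i"
          using Gi(2)[OF vs(3) eq_refl[OF vs(1)]] xy by simp
        then have "norm (Dk d (\<lambda>x. coord (?G x) i) vs x - Dk d (\<lambda>x. coord (?G x) i) vs y)
            \<le> norm (Dk d ?G vs x - Dk d ?G vs y)"
          by (simp only: real_norm_def abs_coord_le)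
        also have "\<dots> \<le> C * t * norm (x - y)"
          by (rule G_lip[OF vs(2,1) xy])
        finally show "norm (Dk d (\<lambda>x. coord (?G x) i) vs x - Dk d (\<lambda>x. coord (?G x) i) vs y)
            \<le> C * t * norm (x - y)" .
      qed
    qed
  qed
  with C(1) show ?thesis by blast
qed

section \<open>Taylor expansion of a trajectory in time\<close>

lemma differentiable_on_eq:
  "f differentiable_on S \<Longrightarrow> (\<And>x. x \<in> S \<Longrightarrow> g x = f x) \<Longrightarrow> g differentiable_on S"
  unfolding differentiable_on_def differentiable_def by (meson has_derivative_transform)

text \<open>
  A curve \<open>u\<close> is regarded as a function on \<open>Rn 1\<close>, so that the derivatives of \<open>f \<circ> u\<close> are covered
  by the formula for compositions.  Since \<open>u' = f \<circ> u\<close>, each derivative of \<open>f\<close> yields one more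
  derivative of \<open>u\<close>.
\<close>

lemma norm_Dk_trajectory_bounded:
  fixes M :: real
  assumes "M \<ge> 1"
  shows "j \<le> k \<Longrightarrow> \<exists>A\<ge>1. \<forall>d f u. bounded_smooth d k M f \<longrightarrow> range u \<subseteq> Rn d \<longrightarrow>
    (\<forall>t. (u has_vector_derivative f (u t)) (at t)) \<longrightarrow>
    k_times_differentiable 1 (Suc j) (\<lambda>y. u (coord y 0)) \<and>
    (\<forall>vs y. set vs \<subseteq> usph 1 \<longrightarrow> 1 \<le> length vs \<longrightarrow> length vs \<le> Suc j \<longrightarrow> y \<in> Rn 1 \<longrightarrow>
      norm (Dk 1 (\<lambda>y. u (coord y 0)) vs y) \<le> A)"
proof (induction j)
  have D1: "((\<lambda>y. u (coord y 0)) has_derivative (\<lambda>h. coord h 0 *\<^sub>R f (u (coord y 0)))) (at y within Rn 1)"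
    if "\<And>t. (u has_vector_derivative f (u t)) (at t)" for u :: "real \<Rightarrow> ell2" and f y
    using has_derivative_compose[OF bounded_linear_imp_has_derivative[OF bounded_linear_coord]
        that[unfolded has_vector_derivative_def]] .
  then have Dv: "Dk 1 (\<lambda>y. u (coord y 0)) [v] y = coord v 0 *\<^sub>R f (u (coord y 0))"
    if "\<And>t. (u has_vector_derivative f (u t)) (at t)" "v \<in> Rn 1" "y \<in> Rn 1"
    for u :: "real \<Rightarrow> ell2" and f y v
  proof -
    have "(Dk 1 (\<lambda>y. u (coord y 0)) [] has_derivative (\<lambda>h. coord h 0 *\<^sub>R f (u (coord y 0))))
        (at y within Rn 1)"
      using D1[OF that(1)] by simp
    from Dk_Cons_eq[OF this that(3,2)] show ?thesis .
  qed
  have diff0: "(\<lambda>y. u (coord y 0)) differentiable_on Rn 1"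
    if "\<And>t. (u has_vector_derivative f (u t)) (at t)" for u :: "real \<Rightarrow> ell2" and f
    using D1[OF that] by (auto simp: differentiable_on_def intro: differentiableI)
  have c1: "\<bar>coord v 0\<bar> \<le> 1" if "v \<in> usph 1" for v
    using abs_coord_le[of v 0] that by (simp add: usph_def)
  {
    case 0
    show ?case
    proof (intro exI[of _ M] conjI allI impI)
      fix d f and u :: "real \<Rightarrow> ell2"
      assume f: "bounded_smooth d k M f" and u: "range u \<subseteq> Rn d"
        "\<forall>t. (u has_vector_derivative f (u t)) (at t)"
      show "k_times_differentiable 1 (Suc 0) (\<lambda>y. u (coord y 0))"
        using diff0 u(2) by (auto simp: k_times_differentiable_def)
      fix vs y assume vs: "set vs \<subseteq> usph 1" "1 \<le> length vs" "length vs \<le> Suc 0" and y: "y \<in> Rn 1"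
      then obtain v where v: "vs = [v]" "v \<in> usph 1" "v \<in> Rn 1"
        using usph_subset by (cases vs) auto
      have "norm (Dk 1 (\<lambda>y. u (coord y 0)) vs y) = \<bar>coord v 0\<bar> * norm (f (u (coord y 0)))"
        using Dv[of u f v y] u(2) v y by (simp del: Dk.simps)
      also have "\<dots> \<le> 1 * M"
        using c1[OF v(2)] u(1) by (intro mult_mono bounded_smooth_norm_le[OF f]) auto
      finally show "norm (Dk 1 (\<lambda>y. u (coord y 0)) vs y) \<le> M" by simp
    qed (use assms in auto)
  next
    case (Suc j)
    obtain A where A: "A \<ge> 1" "\<And>d f u. bounded_smooth d k M f \<Longrightarrow> range u \<subseteq> Rn d \<Longrightarrow>
        \<forall>t. (u has_vector_derivative f (u t)) (at t) \<Longrightarrow>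
        k_times_differentiable 1 (Suc j) (\<lambda>y. u (coord y 0)) \<and>
        (\<forall>vs y. set vs \<subseteq> usph 1 \<longrightarrow> 1 \<le> length vs \<longrightarrow> length vs \<le> Suc j \<longrightarrow> y \<in> Rn 1 \<longrightarrow>
          norm (Dk 1 (\<lambda>y. u (coord y 0)) vs y) \<le> A)"
      using Suc.IH[OF Suc_leD[OF Suc.prems]] by blast
    \<comment> \<open>A common bound for \<open>f\<close> along \<open>u\<close> and its derivatives
      up to order \<open>Suc j\<close>: order zero is covered by \<open>M \<le> B\<close>, the
      others by the estimate for compositions.\<close>
    define B where "B = M * A + fact (Suc j) * (M * A ^ Suc j)"
    have "M \<le> B"
    proof -
      have "M * 1 \<le> M * A" using A(1) assms by (intro mult_left_mono) auto
      moreover have "0 \<le> fact (Suc j) * (M * A ^ Suc j)" using A(1) assms by simp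
      ultimately show ?thesis unfolding B_def by linarith
    qed
    show ?case
    proof (intro exI[of _ B] conjI allI impI)
      show "B \<ge> 1" using \<open>M \<le> B\<close> assms by simp
      fix d f and u :: "real \<Rightarrow> ell2"
      assume f: "bounded_smooth d k M f" and u: "range u \<subseteq> Rn d"
        "\<forall>t. (u has_vector_derivative f (u t)) (at t)"
      let ?u = "\<lambda>y. u (coord y 0)" and ?fu = "\<lambda>y. f (u (coord y 0))"
      have uk: "k_times_differentiable 1 (Suc j) ?u"
        and uA: "\<And>vs y. set vs \<subseteq> usph 1 \<Longrightarrow> 1 \<le> length vs \<Longrightarrow> length vs \<le> Suc j \<Longrightarrow> y \<in> Rn 1 \<Longrightarrow>
          norm (Dk 1 ?u vs y) \<le> A"
        using A(2)[OF f u] by blast+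
      have uR: "?u \<in> Rn 1 \<rightarrow> Rn d" using u(1) by auto
      have fj: "bounded_smooth d (Suc j) M f"
        using bounded_smooth_mono[OF f Suc.prems] .
      have fu: "k_times_differentiable 1 (Suc j) ?fu"
        by (rule Dk_compose(1)[OF bounded_smoothD(2)[OF fj] uk uR])
      have fuB: "norm (Dk 1 ?fu vs y) \<le> B"
        if vs: "set vs \<subseteq> usph 1" "length vs \<le> Suc j" and y: "y \<in> Rn 1" for vs y
      proof (cases "vs = []")
        case True
        have "norm (f (u (coord y 0))) \<le> M"
          using u(1) by (intro bounded_smooth_norm_le[OF f]) auto
        then show ?thesis using True \<open>M \<le> B\<close> by simp
      next
        case False
        then have len: "1 \<le> length vs" by (cases vs) auto
        have "norm (Dk 1 ?fu vs y) \<le> M * norm (Dk 1 ?u vs y) + fact (length vs) * (M * A ^ length vs)"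
          using vs len y assms
          by (intro norm_Dk_compose_le[OF bounded_smoothD(2)[OF fj] bounded_smoothD(3)[OF fj] uk uR]
              A(1) uA) auto
        also have "\<dots> \<le> M * A + fact (Suc j) * (M * A ^ Suc j)"
          using A(1) assms vs
          by (intro add_mono mult_mono mult_left_mono power_increasing fact_mono uA vs len y) auto
        finally show ?thesis by (simp add: B_def)
      qed
      \<comment> \<open>The last entry of a list is the direction differentiated first. Splitting it
        off replaces \<open>u\<close> by \<open>f\<close> along \<open>u\<close>, up to the scalar
        \<open>coord v 0\<close>.\<close>
      have Dk_snoc: "Dk 1 ?u (vs @ [v]) y = coord v 0 *\<^sub>R Dk 1 ?fu vs y"
        if "set vs \<subseteq> Rn 1" "length vs \<le> Suc j" "v \<in> Rn 1" "y \<in> Rn 1" for vs v y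
      proof -
        have "Dk 1 ?u (vs @ [v]) y = Dk 1 (\<lambda>y. coord v 0 *\<^sub>R ?fu y) vs y"
          unfolding Dk_append by (rule Dk_cong) (use Dv u(2) that in auto)
        also have "\<dots> = coord v 0 *\<^sub>R Dk 1 ?fu vs y"
          by (rule Dk_linear_image(2)[OF fu bounded_linear_scaleR_right that(1,2,4)])
        finally show ?thesis .
      qed
      show "k_times_differentiable 1 (Suc (Suc j)) ?u"
        unfolding k_times_differentiable_def
      proof (intro allI impI, elim conjE)
        fix vs assume vs: "set vs \<subseteq> Rn 1" "length vs < Suc (Suc j)"
        show "Dk 1 ?u vs differentiable_on Rn 1"
        proof (cases vs rule: rev_cases)
          case Nil
          then show ?thesis using diff0[of u f] u(2) by simp
        next
          case (snoc ws v)
          have "(\<lambda>y. coord v 0 *\<^sub>R Dk 1 ?fu ws y) differentiable_on Rn 1"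
            using vs snoc by (intro differentiable_on_scaleR differentiable_on_const
                k_times_differentiableD[OF fu]) auto
          moreover have "Dk 1 ?u vs y = coord v 0 *\<^sub>R Dk 1 ?fu ws y" if "y \<in> Rn 1" for y
            unfolding snoc by (rule Dk_snoc) (use vs snoc that in auto)
          ultimately show ?thesis
            by (rule differentiable_on_eq)
        qed
      qed
      fix vs y assume vs: "set vs \<subseteq> usph 1" "1 \<le> length vs" "length vs \<le> Suc (Suc j)" and y: "y \<in> Rn 1"
      obtain ws v where ws: "vs = ws @ [v]" using vs(2) by (cases vs rule: rev_cases) auto
      have "norm (Dk 1 ?u vs y) = \<bar>coord v 0\<bar> * norm (Dk 1 ?fu ws y)"
        unfolding ws using vs ws usph_subset[of 1] y by (subst Dk_snoc) auto
      also have "\<dots> \<le> 1 * B"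
        using vs ws y by (intro mult_mono c1 fuB) auto
      finally show "norm (Dk 1 ?u vs y) \<le> B" by simp
    qed
  }
qed

text \<open>A remainder evaluated at an intermediate point is available for scalar functions only.
  Maclaurin's formula is therefore applied after pairing with the remainder \<open>R\<close> itself,
  and the resulting bound on the square of \<open>norm R\<close> is divided by
  \<open>norm R\<close>. The factor \<open>1 / fact n\<close> is estimated by 1.\<close>

lemma norm_taylor_remainder_le:
  fixes D :: "nat \<Rightarrow> real \<Rightarrow> 'a::real_inner"
  assumes D: "\<And>m t. m < n \<Longrightarrow> (D m has_vector_derivative D (Suc m) t) (at t)"
    and A: "\<And>t. norm (D n t) \<le> A" and "t \<ge> 0" "n > 0"
  shows "norm (D 0 t - (\<Sum>m<n. (t ^ m / fact m) *\<^sub>R D m 0)) \<le> A * t ^ n"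
proof (cases "t = 0")
  case True
  have "A \<ge> 0" using order_trans[OF norm_ge_zero A[of 0]] .
  have "(\<Sum>m<n. ((0::real) ^ m / fact m) *\<^sub>R D m 0) = (\<Sum>m<n. if m = 0 then D 0 0 else 0)"
    by (rule sum.cong) auto
  then show ?thesis using True \<open>n > 0\<close> \<open>A \<ge> 0\<close> by simp
next
  case False
  define R where "R = D 0 t - (\<Sum>m<n. (t ^ m / fact m) *\<^sub>R D m 0)"
  have "A \<ge> 0" using order_trans[OF norm_ge_zero A[of 0]] .
  have "\<exists>s>0. s < t \<and> R \<bullet> D 0 t = (\<Sum>m<n. (R \<bullet> D m 0 / fact m) * t ^ m) + (R \<bullet> D n s / fact n) * t ^ n"
  proof (rule Maclaurin[where diff = "\<lambda>m s. R \<bullet> D m s"])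
    show "\<forall>m s. m < n \<and> 0 \<le> s \<and> s \<le> t \<longrightarrow> ((\<lambda>s. R \<bullet> D m s) has_real_derivative R \<bullet> D (Suc m) s) (at s)"
      using bounded_linear.has_vector_derivative[OF bounded_linear_inner_right D]
      by (simp add: has_real_derivative_iff_has_vector_derivative)
  qed (use assms False in auto)
  then obtain s where s: "R \<bullet> D 0 t = (\<Sum>m<n. (R \<bullet> D m 0 / fact m) * t ^ m) + (R \<bullet> D n s / fact n) * t ^ n"
    by blast
  have "(norm R)\<^sup>2 = R \<bullet> R" by (simp add: dot_square_norm)
  also have "\<dots> = (R \<bullet> D n s / fact n) * t ^ n"
    using s by (subst (2) R_def) (simp add: inner_diff_right inner_sum_right mult_ac)
  also have "\<dots> \<le> (norm R * A) * t ^ n"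
  proof (rule mult_right_mono)
    have "R \<bullet> D n s \<le> norm R * A"
      using norm_cauchy_schwarz A[of s] by (meson mult_left_mono norm_ge_zero order_trans)
    moreover have "norm R * A \<le> norm R * A * fact n"
      using \<open>A \<ge> 0\<close> mult_left_mono[OF fact_ge_1[of n, where 'a = real], of "norm R * A"] by simp
    ultimately show "R \<bullet> D n s / fact n \<le> norm R * A"
      by (simp add: pos_divide_le_eq)
  qed (use assms in simp)
  finally have "norm R * norm R \<le> norm R * (A * t ^ n)"
    by (simp add: power2_eq_square mult_ac)
  then have "norm R \<le> A * t ^ n"
    using \<open>A \<ge> 0\<close> \<open>t \<ge> 0\<close> by (cases "R = 0") auto
  then show ?thesis by (simp add: R_def)
qed

text \<open>Only the coefficients of order 0 and 1 are identified, because the differentiation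
  weights annihilate all other powers up to order \<open>k\<close>. The exponent
  \<open>Suc k\<close> leaves \<open>t ^ k\<close> after the division by the time step.\<close>

lemma flow_taylor:
  assumes "M \<ge> 1" "k \<ge> 1"
  shows "\<exists>A>0. \<forall>d f x. bounded_smooth d k M f \<longrightarrow> x \<in> Rn d \<longrightarrow>
    (\<exists>c. c 0 = 0 \<and> c 1 = f x \<and>
      (\<forall>t\<ge>0. norm (flow d f x t - x - (\<Sum>m\<le>k. t ^ m *\<^sub>R c m)) \<le> A * t ^ Suc k))"
proof -
  obtain A where A: "A \<ge> 1" "\<And>d f u. bounded_smooth d k M f \<Longrightarrow> range u \<subseteq> Rn d \<Longrightarrow>
        \<forall>t. (u has_vector_derivative f (u t)) (at t) \<Longrightarrow>
        k_times_differentiable 1 (Suc k) (\<lambda>y. u (coord y 0)) \<and>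
        (\<forall>vs y. set vs \<subseteq> usph 1 \<longrightarrow> 1 \<le> length vs \<longrightarrow> length vs \<le> Suc k \<longrightarrow> y \<in> Rn 1 \<longrightarrow>
          norm (Dk 1 (\<lambda>y. u (coord y 0)) vs y) \<le> A)"
    using norm_Dk_trajectory_bounded[OF assms(1) order_refl, of k] by blast
  have "\<exists>c. c 0 = 0 \<and> c 1 = f x \<and>
      (\<forall>t\<ge>0. norm (flow d f x t - x - (\<Sum>m\<le>k. t ^ m *\<^sub>R c m)) \<le> A * t ^ Suc k)"
    if f: "bounded_smooth d k M f" and x: "x \<in> Rn d" for d f x
  proof -
    let ?u = "flow d f x" and ?U = "\<lambda>y. flow d f x (coord y 0)" and ?e = "unit_ell2 0"
    have "M > 0" using assms by simp
    note sol = flow_solution[OF f assms(2) this x]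
    have U: "k_times_differentiable 1 (Suc k) ?U"
      and UA: "\<And>vs y. set vs \<subseteq> usph 1 \<Longrightarrow> 1 \<le> length vs \<Longrightarrow> length vs \<le> Suc k \<Longrightarrow> y \<in> Rn 1 \<Longrightarrow>
          norm (Dk 1 ?U vs y) \<le> A"
      using A(2)[OF f, of ?u] sol(2,3) by blast+
    have e: "?e \<in> Rn 1" "?e \<in> usph 1" by (auto simp: unit_ell2_in_Rn usph_def)
    define D where "D = (\<lambda>m t. Dk 1 ?U (replicate m ?e) (0 + t *\<^sub>R ?e))"
    have D: "(D m has_vector_derivative D (Suc m) t) (at t)" if "m < Suc k" for m t
      unfolding D_def using line_has_vector_derivative[OF k_times_differentiableD[OF U] Rn_0 e(1),
          of "replicate m ?e" t] that e by (auto simp: set_replicate_conv_if)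
    have DA: "norm (D (Suc k) t) \<le> A" for t
      unfolding D_def using e by (intro UA Rn_add Rn_scale) auto
    have D0: "D 0 t = ?u t" for t by (simp add: D_def)
    have "D 1 0 = f (?u 0)"
    proof (rule vector_derivative_unique_at)
      show "(D 0 has_vector_derivative D 1 0) (at 0)"
        using D[of 0 0] by simp
      have "D 0 = ?u" using D0 by blast
      then show "(D 0 has_vector_derivative f (?u 0)) (at 0)"
        using sol(3)[of 0] by simp
    qed
    then have D1: "D 1 0 = f x" by (simp add: sol(1))
    \<comment> \<open>The expansion concerns the increment, so the constant term \<open>x\<close> is
      taken out of the coefficients.\<close>
    define c where "c = (\<lambda>m. if m = 0 then 0 else (1 / fact m) *\<^sub>R D m 0)"
    have sum: "(\<Sum>m<Suc k. (t ^ m / fact m) *\<^sub>R D m 0) = x + (\<Sum>m\<le>k. t ^ m *\<^sub>R c m)" for t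
    proof -
      have "(\<Sum>m<Suc k. (t ^ m / fact m) *\<^sub>R D m 0)
          = (\<Sum>m\<le>k. (if m = 0 then D 0 0 else 0) + t ^ m *\<^sub>R c m)"
        unfolding lessThan_Suc_atMost by (rule sum.cong) (auto simp: c_def)
      also have "\<dots> = D 0 0 + (\<Sum>m\<le>k. t ^ m *\<^sub>R c m)"
        by (simp add: sum.distrib)
      finally show ?thesis by (simp add: D0 sol(1))
    qed
    show ?thesis
    proof (intro exI[of _ c] conjI allI impI)
      show "c 1 = f x" using D1 by (simp add: c_def)
      fix t :: real assume "t \<ge> 0"
      then have "norm (D 0 t - (\<Sum>m<Suc k. (t ^ m / fact m) *\<^sub>R D m 0)) \<le> A * t ^ Suc k"
        by (intro norm_taylor_remainder_le D DA) auto
      then show "norm (?u t - x - (\<Sum>m\<le>k. t ^ m *\<^sub>R c m)) \<le> A * t ^ Suc k"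
        unfolding sum D0 by (simp add: algebra_simps)
    qed (simp add: c_def)
  qed
  with A(1) show ?thesis by (intro exI[of _ A]) auto
qed

section \<open>Numerical differentiation by interpolation\<close>

text \<open>The nodes are the integers from 0 to \<open>n\<close> instead of the observation times,
  which keeps the coefficients free of the time step; the step enters later through powers of
  \<open>h\<close>.\<close>

definition lagrange_basis :: "nat \<Rightarrow> nat \<Rightarrow> real poly" where
  "lagrange_basis n i =
     (\<Prod>j\<in>{..n} - {i}. smult (1 / (real i - real j)) [:- real j, 1:])"

lemma poly_lagrange_basis:
  assumes "j \<le> n" "i \<le> n"
  shows "poly (lagrange_basis n i) (real j) = (if i = j then 1 else 0)"
proof (cases "i = j")
  case True
  have "poly (lagrange_basis n i) (real i) = (\<Prod>j\<in>{..n} - {i}. 1)"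
    unfolding lagrange_basis_def poly_prod
    by (rule prod.cong) (auto simp: diff_divide_distrib[symmetric])
  then show ?thesis using True by simp
next
  case False
  then have "\<exists>l\<in>{..n} - {i}. poly (smult (1 / (real i - real l)) [:- real l, 1:]) (real j) = 0"
    using assms by (intro bexI[of _ j]) auto
  then show ?thesis using False by (simp add: lagrange_basis_def poly_prod)
qed

lemma degree_lagrange_basis: "i \<le> n \<Longrightarrow> degree (lagrange_basis n i) \<le> n"
proof -
  assume "i \<le> n"
  have "degree (lagrange_basis n i)
      \<le> (\<Sum>j\<in>{..n} - {i}. degree (smult (1 / (real i - real j)) [:- real j, 1:]))"
    unfolding lagrange_basis_def by (rule degree_prod_sum_le[unfolded comp_def]) simp
  also have "\<dots> \<le> (\<Sum>j\<in>{..n} - {i}. 1)"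
    by (intro sum_mono) auto
  also have "\<dots> = n" using \<open>i \<le> n\<close> by simp
  finally show ?thesis .
qed

lemma poly_eq_sum_coeff: "degree p \<le> n \<Longrightarrow> poly p x = (\<Sum>k\<le>n. coeff p k * x ^ k)"
  for p :: "real poly"
  unfolding poly_altdef by (rule sum.mono_neutral_left) (auto simp: coeff_eq_0)

text \<open>Interpolating the monomial of degree \<open>k \<le> n\<close> at \<open>n + 1\<close>
  nodes reproduces it; the claim compares coefficients of degree \<open>l\<close>. For
  \<open>l = 1\<close> it says that the weights differentiate polynomials of degree at most
  \<open>n\<close> exactly at 0.\<close>

lemma sum_lagrange_basis_coeff:
  assumes "k \<le> n"
  shows "(\<Sum>i\<le>n. coeff (lagrange_basis n i) l * real i ^ k) = (if k = l then 1 else 0)"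
proof -
  have "(\<Sum>i\<le>n. smult (real i ^ k) (lagrange_basis n i)) = monom 1 k"
  proof (rule poly_eqI_degree[where A = "real ` {..n}"])
    fix x assume "x \<in> real ` {..n}"
    then obtain j where "j \<le> n" "x = real j" by auto
    then have "poly (\<Sum>i\<le>n. smult (real i ^ k) (lagrange_basis n i)) x
        = (\<Sum>i\<le>n. if i = j then real i ^ k else 0)"
      unfolding poly_sum by (intro sum.cong) (auto simp: poly_lagrange_basis)
    then show "poly (\<Sum>i\<le>n. smult (real i ^ k) (lagrange_basis n i)) x = poly (monom 1 k) x"
      using \<open>j \<le> n\<close> \<open>x = real j\<close> by (simp add: poly_monom)
  next
    have "degree (\<Sum>i\<le>n. smult (real i ^ k) (lagrange_basis n i)) \<le> n"
      by (intro degree_sum_le order_trans[OF degree_smult_le] degree_lagrange_basis) auto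
    then show "degree (\<Sum>i\<le>n. smult (real i ^ k) (lagrange_basis n i)) < card (real ` {..n})"
      by (simp add: card_image)
    show "degree (monom (1::real) k) < card (real ` {..n})"
      using assms by (simp add: card_image degree_monom_eq)
  qed
  then have "coeff (\<Sum>i\<le>n. smult (real i ^ k) (lagrange_basis n i)) l = coeff (monom 1 k) l"
    by simp
  then show ?thesis by (simp add: coeff_sum mult.commute)
qed

lemma vector_poly_eqI:
  fixes a b :: "nat \<Rightarrow> ell2"
  assumes "h > 0" and eq: "\<And>i. i \<le> n \<Longrightarrow>
    (\<Sum>k\<le>n. (real i * h) ^ k *\<^sub>R a k) = (\<Sum>k\<le>n. (real i * h) ^ k *\<^sub>R b k)"
  shows "(\<Sum>k\<le>n. t ^ k *\<^sub>R a k) = (\<Sum>k\<le>n. t ^ k *\<^sub>R b k)"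
proof -
  have "coord (\<Sum>k\<le>n. t ^ k *\<^sub>R a k) l = coord (\<Sum>k\<le>n. t ^ k *\<^sub>R b k) l" for l
  proof -
    let ?p = "\<lambda>a :: nat \<Rightarrow> ell2. \<Sum>k\<le>n. monom (coord (a k) l) k"
    have p: "poly (?p a) s = coord (\<Sum>k\<le>n. s ^ k *\<^sub>R a k) l" for a s
      by (simp add: poly_sum poly_monom mult.commute)
    have deg: "degree (?p a) < card ((\<lambda>i. real i * h) ` {..n})" for a
    proof -
      have "degree (?p a) \<le> n"
        by (intro degree_sum_le order_trans[OF degree_monom_le]) auto
      moreover have "card ((\<lambda>i. real i * h) ` {..n}) = Suc n"
        using \<open>h > 0\<close> by (subst card_image) (auto simp: inj_on_def)
      ultimately show ?thesis by simp
    qed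
    have "poly (?p a) s = poly (?p b) s" if "s \<in> (\<lambda>i. real i * h) ` {..n}" for s
      unfolding p using that by (auto simp only: eq)
    then have "?p a = ?p b" by (rule poly_eqI_degree[OF _ deg deg])
    then show ?thesis by (simp only: p[symmetric])
  qed
  then show ?thesis by (simp add: ell2_eq_iff)
qed

lemma interpolation_poly_eq:
  assumes h: "h > 0" and y: "\<And>i. i \<le> n \<Longrightarrow> y i \<in> Rn d"
  defines "a \<equiv> \<lambda>k. \<Sum>i\<le>n. (coeff (lagrange_basis n i) k / h ^ k) *\<^sub>R y i"
  shows "interpolation_poly d n h y = (\<lambda>t. \<Sum>k\<le>n. t ^ k *\<^sub>R a k)"
  unfolding interpolation_poly_def
proof (rule the_equality)
  have a: "a k \<in> Rn d" for k
    unfolding a_def by (intro subspace_sum[OF subspace_Rn] Rn_scale y) simp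
  have val: "(\<Sum>k\<le>n. (real j * h) ^ k *\<^sub>R a k) = y j" if "j \<le> n" for j
  proof -
    have c: "(real j * h) ^ k * (c / h ^ k) = c * real j ^ k" for k c
      using h by (simp add: power_mult_distrib)
    have "(\<Sum>k\<le>n. (real j * h) ^ k *\<^sub>R a k)
        = (\<Sum>k\<le>n. \<Sum>i\<le>n. (coeff (lagrange_basis n i) k * real j ^ k) *\<^sub>R y i)"
      unfolding a_def scaleR_sum_right scaleR_scaleR c ..
    also have "\<dots> = (\<Sum>i\<le>n. (\<Sum>k\<le>n. coeff (lagrange_basis n i) k * real j ^ k) *\<^sub>R y i)"
      by (subst sum.swap) (simp add: scaleR_sum_left)
    also have "\<dots> = (\<Sum>i\<le>n. poly (lagrange_basis n i) (real j) *\<^sub>R y i)"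
      by (intro sum.cong refl arg_cong2[where f = scaleR]
          poly_eq_sum_coeff[OF degree_lagrange_basis, symmetric]) simp
    also have "\<dots> = (\<Sum>i\<le>n. if i = j then y i else 0)"
      using that by (intro sum.cong) (auto simp: poly_lagrange_basis)
    finally show ?thesis using that by simp
  qed
  show "(\<exists>b. (\<forall>k. b k \<in> Rn d) \<and> (\<lambda>t. \<Sum>k\<le>n. t ^ k *\<^sub>R a k) = (\<lambda>t. \<Sum>k\<le>n. t ^ k *\<^sub>R b k)) \<and>
      (\<forall>i\<le>n. (\<Sum>k\<le>n. (real i * h) ^ k *\<^sub>R a k) = y i)"
    using a val by (intro conjI exI[of _ a]) auto
  fix p assume "(\<exists>a. (\<forall>k. a k \<in> Rn d) \<and> p = (\<lambda>t. \<Sum>k\<le>n. t ^ k *\<^sub>R a k)) \<and>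
      (\<forall>i\<le>n. p (real i * h) = y i)"
  then obtain b where b: "p = (\<lambda>t. \<Sum>k\<le>n. t ^ k *\<^sub>R b k)" "\<forall>i\<le>n. p (real i * h) = y i"
    by (elim conjE exE)
  have "(\<Sum>k\<le>n. (real i * h) ^ k *\<^sub>R b k) = (\<Sum>k\<le>n. (real i * h) ^ k *\<^sub>R a k)" if "i \<le> n" for i
    using b(2) that val[OF that] unfolding b(1) by simp
  then show "p = (\<lambda>t. \<Sum>k\<le>n. t ^ k *\<^sub>R a k)"
    unfolding b(1) by (rule ext[OF vector_poly_eqI[OF h]])
qed

lemma interpolation_poly_derivative:
  assumes h: "h > 0" and "n \<ge> 1" and y: "\<And>i. i \<le> n \<Longrightarrow> y i \<in> Rn d"
  shows "vector_derivative (interpolation_poly d n h y) (at 0)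
    = (1 / h) *\<^sub>R (\<Sum>i\<le>n. coeff (lagrange_basis n i) 1 *\<^sub>R y i)"
proof (rule vector_derivative_at)
  define a where "a = (\<lambda>k. \<Sum>i\<le>n. (coeff (lagrange_basis n i) k / h ^ k) *\<^sub>R y i)"
  have "((\<lambda>t. \<Sum>k\<le>n. t ^ k *\<^sub>R a k) has_vector_derivative
      (\<Sum>k\<le>n. (real k * 0 ^ (k - 1)) *\<^sub>R a k)) (at 0)"
  proof (intro has_vector_derivative_sum)
    fix k
    have "((\<lambda>t::real. t ^ k) has_real_derivative real k * 0 ^ (k - 1)) (at 0)"
      using DERIV_pow[of k 0 UNIV] by simp
    then show "((\<lambda>t. t ^ k *\<^sub>R a k) has_vector_derivative (real k * 0 ^ (k - 1)) *\<^sub>R a k) (at 0)"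
      by (auto intro!: derivative_eq_intros)
  qed
  \<comment> \<open>For \<open>k = 0\<close> the truncated exponent gives \<open>0 ^ 0 = 1\<close>,
    and it is the factor \<open>real k\<close> that removes this term.\<close>
  also have "(\<Sum>k\<le>n. (real k * 0 ^ (k - 1)) *\<^sub>R a k) = (\<Sum>k\<le>n. if k = 1 then a k else 0)"
    by (rule sum.cong) (auto simp: power_0_left)
  also have "\<dots> = a 1" using \<open>n \<ge> 1\<close> by simp
  also have "a 1 = (1 / h) *\<^sub>R (\<Sum>i\<le>n. coeff (lagrange_basis n i) 1 *\<^sub>R y i)"
    by (simp add: a_def scaleR_sum_right)
  finally show "(interpolation_poly d n h y has_vector_derivative
      (1 / h) *\<^sub>R (\<Sum>i\<le>n. coeff (lagrange_basis n i) 1 *\<^sub>R y i)) (at 0)"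
    by (simp add: a_def interpolation_poly_eq[OF h y])
qed

text \<open>The deterministic core: \<open>y\<close> stands for arbitrary data with
  \<open>y 0 = 0\<close>, so noise and regression enter only through the distance of
  \<open>y\<close> from the true increments.\<close>

lemma interpolation_error:
  assumes "k \<ge> 1" "M \<ge> 1"
  shows "\<exists>K>0. \<forall>d f x h y. bounded_smooth d k M f \<longrightarrow> x \<in> Rn d \<longrightarrow> h > 0 \<longrightarrow>
    (\<forall>i\<le>k. y i \<in> Rn d) \<longrightarrow> y 0 = 0 \<longrightarrow>
    (norm (vector_derivative (interpolation_poly d k h y) (at 0) - f x))\<^sup>2
      \<le> K * (inverse (h\<^sup>2) * (\<Sum>i\<in>{1..k}. (norm (y i - (flow d f x (real i * h) - x)))\<^sup>2) + h ^ (2 * k))"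
proof -
  obtain A where A: "A > 0" "\<And>d f x. bounded_smooth d k M f \<Longrightarrow> x \<in> Rn d \<Longrightarrow>
    (\<exists>c. c 0 = 0 \<and> c 1 = f x \<and>
      (\<forall>t\<ge>0. norm (flow d f x t - x - (\<Sum>m\<le>k. t ^ m *\<^sub>R c m)) \<le> A * t ^ Suc k))"
    using flow_taylor[OF assms(2,1)] by blast
  define w where "w = (\<lambda>i. coeff (lagrange_basis k i) 1)"
  define W where "W = (\<Sum>i\<le>k. \<bar>w i\<bar>)"
  define B where "B = (\<Sum>i\<le>k. \<bar>w i\<bar> * (A * real i ^ Suc k))"
  \<comment> \<open>The factor 2 comes from the square of a sum of two terms, \<open>real k\<close>
    from Cauchy-Schwarz over the \<open>k\<close> data errors, and \<open>B\<close> collects the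
    Taylor remainders without their power of \<open>h\<close>.\<close>
  define K where "K = 2 * (W\<^sup>2 * real k) + 2 * B\<^sup>2 + 1"
  have W: "\<bar>w i\<bar> \<le> W" if "i \<le> k" for i
    unfolding W_def using that by (intro member_le_sum[where f = "\<lambda>i. \<bar>w i\<bar>"]) auto
  have "K > 0" unfolding K_def by (simp add: add_nonneg_pos)
  have "(norm (vector_derivative (interpolation_poly d k h y) (at 0) - f x))\<^sup>2
      \<le> K * (inverse (h\<^sup>2) * (\<Sum>i\<in>{1..k}. (norm (y i - (flow d f x (real i * h) - x)))\<^sup>2) + h ^ (2 * k))"
    if f: "bounded_smooth d k M f" and x: "x \<in> Rn d" and h: "h > 0"
      and y: "\<And>i. i \<le> k \<Longrightarrow> y i \<in> Rn d" "y 0 = 0" for d f x h y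
  proof -
    obtain c where c: "c 0 = 0" "c 1 = f x"
        "\<And>t. t \<ge> 0 \<Longrightarrow> norm (flow d f x t - x - (\<Sum>m\<le>k. t ^ m *\<^sub>R c m)) \<le> A * t ^ Suc k"
      using A(2)[OF f x] by blast
    define e where "e = (\<lambda>i. y i - (flow d f x (real i * h) - x))"
    define R where "R = (\<lambda>i. flow d f x (real i * h) - x - (\<Sum>m\<le>k. (real i * h) ^ m *\<^sub>R c m))"
    define S where "S = (\<Sum>i\<in>{1..k}. (norm (e i))\<^sup>2)"
    \<comment> \<open>At time 0 the increment is known exactly, so the sum of squared errors starts
      at index 1.\<close>
    have e0: "e 0 = 0"
      using flow_solution(1)[OF f assms(1) _ x] assms(2) y(2) by (simp add: e_def)
    have "(\<Sum>i\<le>k. w i *\<^sub>R (\<Sum>m\<le>k. (real i * h) ^ m *\<^sub>R c m))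
        = (\<Sum>m\<le>k. \<Sum>i\<le>k. (h ^ m * (w i * real i ^ m)) *\<^sub>R c m)"
      by (subst sum.swap) (simp add: scaleR_sum_right power_mult_distrib mult_ac)
    also have "\<dots> = (\<Sum>m\<le>k. (h ^ m * (\<Sum>i\<le>k. w i * real i ^ m)) *\<^sub>R c m)"
      by (simp add: scaleR_sum_left sum_distrib_left)
    \<comment> \<open>Exactness of the weights removes every Taylor coefficient except the linear
      one, which is \<open>f x\<close>.\<close>
    also have "\<dots> = (\<Sum>m\<le>k. if m = 1 then h *\<^sub>R c m else 0)"
      unfolding w_def by (intro sum.cong) (auto simp: sum_lagrange_basis_coeff)
    also have "\<dots> = h *\<^sub>R f x"
      using assms(1) c(2) by simp
    finally have exact: "(\<Sum>i\<le>k. w i *\<^sub>R (\<Sum>m\<le>k. (real i * h) ^ m *\<^sub>R c m)) = h *\<^sub>R f x" .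
    have "(\<Sum>i\<le>k. w i *\<^sub>R y i) = (\<Sum>i\<le>k. w i *\<^sub>R e i + w i *\<^sub>R R i
        + w i *\<^sub>R (\<Sum>m\<le>k. (real i * h) ^ m *\<^sub>R c m))"
      by (intro sum.cong refl) (simp add: e_def R_def flip: scaleR_add_right)
    then have "(\<Sum>i\<le>k. w i *\<^sub>R y i) = (\<Sum>i\<le>k. w i *\<^sub>R e i) + (\<Sum>i\<le>k. w i *\<^sub>R R i) + h *\<^sub>R f x"
      by (simp add: sum.distrib exact)
    then have "vector_derivative (interpolation_poly d k h y) (at 0) - f x
        = (1 / h) *\<^sub>R ((\<Sum>i\<le>k. w i *\<^sub>R e i) + (\<Sum>i\<le>k. w i *\<^sub>R R i))"
      using h interpolation_poly_derivative[OF h assms(1) y(1)] by (simp add: w_def scaleR_add_right)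
    then have eq: "norm (vector_derivative (interpolation_poly d k h y) (at 0) - f x)
        = inverse h * norm ((\<Sum>i\<le>k. w i *\<^sub>R e i) + (\<Sum>i\<le>k. w i *\<^sub>R R i))"
      using h by (simp add: divide_inverse)
    have 1: "norm (\<Sum>i\<le>k. w i *\<^sub>R e i) \<le> W * (\<Sum>i\<in>{1..k}. norm (e i))"
    proof -
      have "(\<Sum>i\<le>k. w i *\<^sub>R e i) = (\<Sum>i\<in>{1..k}. w i *\<^sub>R e i)"
        by (rule sum.mono_neutral_right) (auto simp: e0 not_less_eq_eq)
      also have "norm \<dots> \<le> (\<Sum>i\<in>{1..k}. W * norm (e i))"
        by (intro sum_norm_le) (auto intro!: mult_right_mono W)
      finally show ?thesis by (simp add: sum_distrib_left)
    qed
    have 2: "norm (\<Sum>i\<le>k. w i *\<^sub>R R i) \<le> B * h ^ Suc k"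
    proof -
      have "norm (\<Sum>i\<le>k. w i *\<^sub>R R i) \<le> (\<Sum>i\<le>k. \<bar>w i\<bar> * (A * (real i * h) ^ Suc k))"
        unfolding R_def using h
        by (intro sum_norm_le) (auto intro!: mult_left_mono c(3) simp del: power_Suc)
      also have "\<dots> = B * h ^ Suc k"
        unfolding B_def sum_distrib_right by (simp add: power_mult_distrib mult_ac)
      finally show ?thesis .
    qed
    have "(norm ((\<Sum>i\<le>k. w i *\<^sub>R e i) + (\<Sum>i\<le>k. w i *\<^sub>R R i)))\<^sup>2
        \<le> (W * (\<Sum>i\<in>{1..k}. norm (e i)) + B * h ^ Suc k)\<^sup>2"
      using 1 2 by (intro power_mono norm_triangle_le add_mono) auto
    also have "\<dots> \<le> 2 * (W * (\<Sum>i\<in>{1..k}. norm (e i)))\<^sup>2 + 2 * (B * h ^ Suc k)\<^sup>2"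
      using sum_squares_bound[of "W * (\<Sum>i\<in>{1..k}. norm (e i))" "B * h ^ Suc k"]
      unfolding power2_sum by linarith
    also have "\<dots> \<le> 2 * (W\<^sup>2 * (S * real k)) + 2 * (B * h ^ Suc k)\<^sup>2"
      using sum_squared_le_sum_of_squares[of "\<lambda>i. norm (e i)" "{1..k}"]
      unfolding power_mult_distrib S_def by (intro add_mono mult_left_mono) auto
    finally have "(norm (vector_derivative (interpolation_poly d k h y) (at 0) - f x))\<^sup>2
        \<le> (inverse h)\<^sup>2 * (2 * (W\<^sup>2 * (S * real k)) + 2 * (B * h ^ Suc k)\<^sup>2)"
      unfolding eq power_mult_distrib by (intro mult_left_mono) auto
    also have "\<dots> = 2 * (W\<^sup>2 * real k) * (inverse (h\<^sup>2) * S) + 2 * B\<^sup>2 * (inverse (h\<^sup>2) * h\<^sup>2) * h ^ (2 * k)"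
      by (simp add: power_mult_distrib power_inverse distrib_left power_mult mult_ac)
    also have "\<dots> = 2 * (W\<^sup>2 * real k) * (inverse (h\<^sup>2) * S) + 2 * B\<^sup>2 * h ^ (2 * k)"
      using h by simp
    also have "\<dots> \<le> K * (inverse (h\<^sup>2) * S) + K * h ^ (2 * k)"
      using h by (intro add_mono mult_right_mono mult_nonneg_nonneg)
        (auto simp: K_def S_def intro!: sum_nonneg)
    finally show ?thesis by (simp add: S_def e_def distrib_left)
  qed
  with \<open>K > 0\<close> show ?thesis by blast
qed

section \<open>Passage from the model and regression classes to the bounds in use\<close>

lemma smooth_class_bounded_smooth:
  assumes "f \<in> smooth_class d k L" and L: "\<And>j. j \<le> k \<Longrightarrow> L j > 0 \<and> L j \<le> M"
  shows "bounded_smooth d k M f"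
  unfolding bounded_smooth_def
proof (intro conjI allI impI)
  show "f \<in> Rn d \<rightarrow> Rn d" "k_times_differentiable d k f"
    using assms(1) by (auto simp: smooth_class_def k_times_cont_differentiable_def)
  fix vs x assume vs: "set vs \<subseteq> usph d" "length vs \<le> k" and x: "x \<in> Rn d"
  have "ennreal (norm (Dk d f vs x)) \<le> opnorm d (length vs) (\<lambda>vs. Dk d f vs x)"
    unfolding opnorm_def by (rule SUP_upper2[of vs]) (use vs in \<open>auto simp: usph_def\<close>)
  also have "\<dots> \<le> (SUP x\<in>Rn d. opnorm d (length vs) (\<lambda>vs. Dk d f vs x))"
    using x by (rule SUP_upper)
  also have "\<dots> \<le> ennreal (L (length vs))"
    using assms(1) vs(2) by (simp add: smooth_class_def)
  also have "\<dots> \<le> ennreal M"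
    using L[OF vs(2)] by (intro ennreal_leI) simp
  finally show "norm (Dk d f vs x) \<le> M"
    using L[OF vs(2)] by (simp add: ennreal_le_iff)
qed

lemma holder_class_mono:
  assumes "L \<le> L'"
  shows "holder_class d k L \<subseteq> holder_class d k L'"
proof -
  have le: "ennreal (L * norm (x - y)) \<le> ennreal (L' * norm (x - y))" for x y :: ell2
    using assms by (intro ennreal_leI mult_right_mono) auto
  then show ?thesis
    unfolding holder_class_def by (auto intro: order_trans[OF _ le])
qed

section \<open>Risk of the estimator\<close>

lemma measurable_noise:
  assumes "sets \<nu> = sets (borel_Rn d)"
  shows "(\<lambda>e. e) \<in> \<nu> \<rightarrow>\<^sub>M borel"
proof -
  have "(\<lambda>e. e) \<in> borel_Rn d \<rightarrow>\<^sub>M borel"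
    by (intro measurable_restrict_space1) simp
  then show ?thesis using measurable_cong_sets[OF assms refl] by blast
qed

lemma space_noise:
  assumes "sets \<nu> = sets (borel_Rn d)"
  shows "space \<nu> = Rn d"
  using sets_eq_imp_space_eq[OF assms] by (simp add: space_restrict_space)

lemma measurable_regression_data:
  assumes \<nu>: "\<And>j. j \<in> {1..m} \<Longrightarrow> sets (\<nu> j) = sets (borel_Rn d)"
    and x: "\<And>j. j \<in> {1..m} \<Longrightarrow> x j \<in> Rn d \<and> g (x j) \<in> Rn d" and "x\<^sub>0 \<in> Rn d"
  shows "(\<lambda>\<xi>. (\<lambda>j\<in>{1..m}. (x j, g (x j) + \<xi> j), x\<^sub>0)) \<in>
    (\<Pi>\<^sub>M j\<in>{1..m}. \<nu> j) \<rightarrow>\<^sub>M (\<Pi>\<^sub>M j\<in>{1..m}. borel_Rn d \<Otimes>\<^sub>M borel_Rn d) \<Otimes>\<^sub>M borel_Rn d"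
proof (intro measurable_Pair measurable_restrict)
  fix j assume j: "j \<in> {1..m}"
  show "(\<lambda>\<xi>. x j) \<in> (\<Pi>\<^sub>M j\<in>{1..m}. \<nu> j) \<rightarrow>\<^sub>M borel_Rn d"
    using x[OF j] by (simp add: space_restrict_space)
  show "(\<lambda>\<xi>. g (x j) + \<xi> j) \<in> (\<Pi>\<^sub>M j\<in>{1..m}. \<nu> j) \<rightarrow>\<^sub>M borel_Rn d"
  proof (rule measurable_restrict_space2)
    show "(\<lambda>\<xi>. g (x j) + \<xi> j) \<in> space (\<Pi>\<^sub>M j\<in>{1..m}. \<nu> j) \<rightarrow> Rn d"
      using x[OF j] j space_noise[OF \<nu>[OF j]] by (auto simp: space_PiM PiE_def Pi_def intro!: Rn_add)
    have "(\<lambda>\<xi>. \<xi> j) \<in> (\<Pi>\<^sub>M j\<in>{1..m}. \<nu> j) \<rightarrow>\<^sub>M borel"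
      using measurable_compose[where g = "\<lambda>e. e", OF measurable_component_singleton[OF j, of \<nu>]
          measurable_noise[OF \<nu>[OF j]]] by simp
    then show "(\<lambda>\<xi>. g (x j) + \<xi> j) \<in> borel_measurable (\<Pi>\<^sub>M j\<in>{1..m}. \<nu> j)"
      by (intro borel_measurable_add borel_measurable_const)
  qed
next
  show "(\<lambda>\<xi>. x\<^sub>0) \<in> (\<Pi>\<^sub>M j\<in>{1..m}. \<nu> j) \<rightarrow>\<^sub>M borel_Rn d"
    using assms(3) by (simp add: space_restrict_space)
qed

lemma unit_cube_subset: "unit_cube d \<subseteq> Rn d"
  by (auto simp: unit_cube_def)

text \<open>The noise entering the regression for one observation time is a marginal of the whole noise.\<close>

lemma regression_risk:
  fixes \<nu> :: "nat \<Rightarrow> nat \<Rightarrow> ell2 measure"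
  assumes E: "regression_estimator d m E" and i: "i \<in> {1..k}"
    and \<nu>: "\<And>j i. j \<in> {1..m} \<Longrightarrow> i \<in> {1..k} \<Longrightarrow> noise_law d \<sigma> (\<nu> j i)"
    and x: "\<And>j. j \<in> {1..m} \<Longrightarrow> x j \<in> unit_cube d" and x0: "x\<^sub>0 \<in> unit_cube d"
    and g: "g \<in> holder_class d k L"
  defines "P \<equiv> (\<Pi>\<^sub>M (j, i) \<in> {1..m} \<times> {1..k}. \<nu> j i)"
    and "\<Phi> \<equiv> (\<lambda>\<xi>. ennreal ((norm (E (\<lambda>j\<in>{1..m}. (x j, g (x j) + \<xi> j), x\<^sub>0) - g x\<^sub>0))\<^sup>2))"
  shows "(\<lambda>\<epsilon>. \<Phi> (\<lambda>j. \<epsilon> (j, i))) \<in> borel_measurable P"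
    and "(\<integral>\<^sup>+\<epsilon>. \<Phi> (\<lambda>j. \<epsilon> (j, i)) \<partial>P) \<le> max_risk d k L \<sigma> m E x"
    and "\<epsilon> \<in> space P \<Longrightarrow> E (\<lambda>j\<in>{1..m}. (x j, g (x j) + \<epsilon> (j, i)), x\<^sub>0) \<in> Rn d"
proof -
  let ?Q = "\<Pi>\<^sub>M j\<in>{1..m}. \<nu> j i"
  let ?r = "\<lambda>\<epsilon> :: nat \<times> nat \<Rightarrow> ell2. \<lambda>j\<in>{1..m}. \<epsilon> (j, i)"
  have sets: "sets (\<nu> j i) = sets (borel_Rn d)" if "j \<in> {1..m}" for j
    using \<nu>[OF that i] by (simp add: noise_law_def)
  have gR: "g \<in> Rn d \<rightarrow> Rn d" using g by (simp add: holder_class_def)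
  have xg: "x j \<in> Rn d \<and> g (x j) \<in> Rn d" if "j \<in> {1..m}" for j
    using x[OF that] unit_cube_subset gR by blast
  have x0R: "x\<^sub>0 \<in> Rn d" using x0 unit_cube_subset by blast
  have "(\<lambda>\<xi>. E (\<lambda>j\<in>{1..m}. (x j, g (x j) + \<xi> j), x\<^sub>0)) \<in> ?Q \<rightarrow>\<^sub>M borel_Rn d"
    by (rule measurable_compose[OF _ E[unfolded regression_estimator_def]])
      (rule measurable_regression_data, erule sets, erule xg, rule x0R)
  then have mE: "(\<lambda>\<xi>. E (\<lambda>j\<in>{1..m}. (x j, g (x j) + \<xi> j), x\<^sub>0)) \<in> borel_measurable ?Q"
    and ER: "\<And>\<xi>. \<xi> \<in> space ?Q \<Longrightarrow> E (\<lambda>j\<in>{1..m}. (x j, g (x j) + \<xi> j), x\<^sub>0) \<in> Rn d"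
    by (auto simp: measurable_restrict_space2_iff)
  have m\<Phi>: "\<Phi> \<in> borel_measurable ?Q"
    unfolding \<Phi>_def using mE by measurable
  have "(\<lambda>\<omega>. \<lambda>n\<in>{1..m}. \<omega> (n, i)) \<in> P \<rightarrow>\<^sub>M ?Q"
    unfolding P_def
  proof (rule measurable_restrict)
    fix j assume "j \<in> {1..m}"
    then show "(\<lambda>\<omega>. \<omega> (j, i)) \<in> (\<Pi>\<^sub>M (j, i) \<in> {1..m} \<times> {1..k}. \<nu> j i) \<rightarrow>\<^sub>M \<nu> j i"
      using measurable_component_singleton[of "(j, i)" "{1..m} \<times> {1..k}" "case_prod \<nu>"] i by simp
  qed
  then have mr: "?r \<in> P \<rightarrow>\<^sub>M ?Q" .
  \<comment> \<open>\<open>\<Phi>\<close> reads its argument at the indices from 1 to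
    \<open>m\<close> only, so the restriction, which makes the selected noise a point of the product
    space, does not change the value.\<close>
  have \<Phi>r: "\<Phi> (?r \<epsilon>) = \<Phi> (\<lambda>j. \<epsilon> (j, i))" for \<epsilon>
    unfolding \<Phi>_def by (simp cong: restrict_cong)
  show "(\<lambda>\<epsilon>. \<Phi> (\<lambda>j. \<epsilon> (j, i))) \<in> borel_measurable P"
    using measurable_compose[OF mr m\<Phi>] by (simp only: \<Phi>r)
  have "distr P ?Q ?r = ?Q"
    using distr_PiM_reindex[of "{1..m} \<times> {1..k}" "case_prod \<nu>" "\<lambda>j. (j, i)" "{1..m}"] \<nu> i
    by (auto simp: P_def noise_law_def inj_on_def)
  then have "(\<integral>\<^sup>+\<epsilon>. \<Phi> (\<lambda>j. \<epsilon> (j, i)) \<partial>P) = (\<integral>\<^sup>+\<xi>. \<Phi> \<xi> \<partial>?Q)"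
    using nn_integral_distr[OF mr, of \<Phi>] m\<Phi> by (simp only: \<Phi>r)
  also have "\<dots> \<le> max_risk d k L \<sigma> m E x"
    unfolding max_risk_def
  proof (rule SUP_upper2[OF x0], rule SUP_upper2)
    show "(g, \<lambda>j. \<nu> j i) \<in> holder_class d k L \<times> {\<nu>. \<forall>j\<in>{1..m}. noise_law d \<sigma> (\<nu> j)}"
      using g \<nu> i by simp
  qed (simp add: \<Phi>_def)
  finally show "(\<integral>\<^sup>+\<epsilon>. \<Phi> (\<lambda>j. \<epsilon> (j, i)) \<partial>P) \<le> max_risk d k L \<sigma> m E x" .
  \<comment> \<open>That the estimates lie in \<open>Rn d\<close> is required of data to be
    interpolated with coefficients in \<open>Rn d\<close>.\<close>
  assume "\<epsilon> \<in> space P"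
  then have "?r \<epsilon> \<in> space ?Q" using measurable_space[OF mr] by blast
  from ER[OF this] show "E (\<lambda>j\<in>{1..m}. (x j, g (x j) + \<epsilon> (j, i)), x\<^sub>0) \<in> Rn d"
    by (simp cong: restrict_cong)
qed

section \<open>From bounds at a fixed sample size to the asymptotic comparison\<close>

lemma asymp_le_of_eventually_le:
  assumes "\<forall>\<^sub>F n in sequentially. a n \<le> ennreal K * b n \<and> b n > 0"
  shows "a \<preceq>\<^sub>\<infinity> b"
proof -
  have "\<forall>\<^sub>F n in sequentially. a n / b n \<le> ennreal K"
    using assms by eventually_elim (auto intro: divide_le_posI_ennreal simp: mult.commute)
  then have "limsup (\<lambda>n. a n / b n) \<le> ennreal K" by (rule Limsup_bounded)
  then show ?thesis unfolding asymp_le_def by (simp add: order_le_less_trans)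
qed

text \<open>Valid at every sample size, with constants fixed before the dimension, the noise, the
  model function and the estimator, so the theorem only has to pass to the limit superior. The
  estimate is in \<open>ennreal\<close> because the maximal risk may be infinite.\<close>

lemma mean_squared_error_le:
  fixes M T :: real
  assumes "k \<ge> 1" "M \<ge> 1" "T \<ge> 0"
  shows "\<exists>C>0. \<exists>K\<ge>0. \<forall>d \<sigma> f x h \<nu> E x\<^sub>0 m.
    bounded_smooth d k M f \<and> (\<forall>j\<in>{1..m}. x j \<in> unit_cube d) \<and> 0 < h \<and> h \<le> T \<and>
    (\<forall>j\<in>{1..m}. \<forall>i\<in>{1..k}. noise_law d \<sigma> (\<nu> j i)) \<and> regression_estimator d m E \<and> x\<^sub>0 \<in> unit_cube d \<longrightarrow>
    mean_squared_error d k m f x h \<nu> E x\<^sub>0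
      \<le> ennreal K * (ennreal (inverse (h\<^sup>2)) * max_risk d k (C * h) \<sigma> m E x + ennreal (h ^ (2 * k)))"
proof -
  \<comment> \<open>The last observation is made at time \<open>real k * h\<close>, so the flow must
    be controlled up to \<open>real k * T\<close>.\<close>
  obtain C where C: "C > 0" "\<And>d f t. bounded_smooth d k M f \<Longrightarrow> 0 < t \<Longrightarrow> t \<le> real k * T \<Longrightarrow>
      (\<lambda>x. flow d f x t - x) \<in> holder_class d k (C * t)"
    using flow_increment_holder[of M "real k * T" k] assms by fastforce
  obtain K where K: "K > 0" "\<And>d f x h y. bounded_smooth d k M f \<Longrightarrow> x \<in> Rn d \<Longrightarrow> h > 0 \<Longrightarrow>
    (\<And>i. i \<le> k \<Longrightarrow> y i \<in> Rn d) \<Longrightarrow> y 0 = 0 \<Longrightarrow>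
    (norm (vector_derivative (interpolation_poly d k h y) (at 0) - f x))\<^sup>2
      \<le> K * (inverse (h\<^sup>2) * (\<Sum>i\<in>{1..k}. (norm (y i - (flow d f x (real i * h) - x)))\<^sup>2) + h ^ (2 * k))"
    using interpolation_error[OF assms(1,2)] by blast
  have "mean_squared_error d k m f x h \<nu> E x\<^sub>0 \<le> ennreal (K * real k) *
      (ennreal (inverse (h\<^sup>2)) * max_risk d k (C * real k * h) \<sigma> m E x + ennreal (h ^ (2 * k)))"
    if f: "bounded_smooth d k M f" and x: "\<And>j. j \<in> {1..m} \<Longrightarrow> x j \<in> unit_cube d" and h: "0 < h" "h \<le> T"
      and \<nu>: "\<And>j i. j \<in> {1..m} \<Longrightarrow> i \<in> {1..k} \<Longrightarrow> noise_law d \<sigma> (\<nu> j i)"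
      and E: "regression_estimator d m E" and x0: "x\<^sub>0 \<in> unit_cube d" for d \<sigma> f x h \<nu> E x\<^sub>0 m
  proof -
    define P where "P = (\<Pi>\<^sub>M (j, i) \<in> {1..m} \<times> {1..k}. \<nu> j i)"
    define g where "g = (\<lambda>i x. flow d f x (real i * h) - x)"
    define \<Phi> where "\<Phi> = (\<lambda>i \<xi>. ennreal ((norm (E (\<lambda>j\<in>{1..m}. (x j, g i (x j) + \<xi> j), x\<^sub>0) - g i x\<^sub>0))\<^sup>2))"
    define r where "r = max_risk d k (C * real k * h) \<sigma> m E x"
    have x0R: "x\<^sub>0 \<in> Rn d" using x0 unit_cube_subset by blast
    interpret P: prob_space P
      unfolding P_def using \<nu> by (intro prob_space_PiM) (auto simp: noise_law_def)
    \<comment> \<open>All observation times share the Hoelder constant of the last one, so a single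
      maximal risk bounds every term. This is the origin of the factor \<open>real k\<close> in the
      final constant.\<close>
    have g: "g i \<in> holder_class d k (C * real k * h)" if "i \<in> {1..k}" for i
    proof -
      have ik: "real i * h \<le> real k * h" using that h by (intro mult_right_mono) auto
      also have "\<dots> \<le> real k * T" using h by (intro mult_left_mono) auto
      finally have "g i \<in> holder_class d k (C * (real i * h))"
        unfolding g_def using that h by (intro C(2) f) auto
      moreover have "C * (real i * h) \<le> C * real k * h"
        using ik C(1) by (simp add: mult.assoc)
      ultimately show ?thesis using holder_class_mono by blast
    qed
    have risk: "(\<lambda>\<epsilon>. \<Phi> i (\<lambda>j. \<epsilon> (j, i))) \<in> borel_measurable P"
      "(\<integral>\<^sup>+\<epsilon>. \<Phi> i (\<lambda>j. \<epsilon> (j, i)) \<partial>P) \<le> r"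
      "\<epsilon> \<in> space P \<Longrightarrow> E (\<lambda>j\<in>{1..m}. (x j, g i (x j) + \<epsilon> (j, i)), x\<^sub>0) \<in> Rn d"
      if i: "i \<in> {1..k}" for i \<epsilon>
      unfolding P_def \<Phi>_def r_def
      by (rule regression_risk[OF E i], erule (1) \<nu>, erule x, rule x0, rule g[OF i], assumption?)+
    have iota: "iota_hat m E x (observation d f x h \<epsilon>) i x\<^sub>0
        = E (\<lambda>j\<in>{1..m}. (x j, g i (x j) + \<epsilon> (j, i)), x\<^sub>0)" if "i \<in> {1..k}" for i \<epsilon>
      using that by (simp add: iota_hat_def observation_def g_def algebra_simps)
    have le: "ennreal ((norm (f_hat d k m E x h (observation d f x h \<epsilon>) x\<^sub>0 - f x\<^sub>0))\<^sup>2)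
        \<le> ennreal K * (ennreal (inverse (h\<^sup>2)) * (\<Sum>i\<in>{1..k}. \<Phi> i (\<lambda>j. \<epsilon> (j, i))) + ennreal (h ^ (2 * k)))"
      if \<epsilon>: "\<epsilon> \<in> space P" for \<epsilon>
    proof -
      let ?y = "\<lambda>i. iota_hat m E x (observation d f x h \<epsilon>) i x\<^sub>0"
      have y: "?y i \<in> Rn d" if "i \<le> k" for i
      proof (cases "i = 0")
        case False
        then have "i \<in> {1..k}" using that by auto
        then show ?thesis
          unfolding iota[OF \<open>i \<in> {1..k}\<close>] using risk(3) \<epsilon> by blast
      qed (simp add: iota_hat_def)
      have "(norm (f_hat d k m E x h (observation d f x h \<epsilon>) x\<^sub>0 - f x\<^sub>0))\<^sup>2
          \<le> K * (inverse (h\<^sup>2) * (\<Sum>i\<in>{1..k}. (norm (?y i - g i x\<^sub>0))\<^sup>2) + h ^ (2 * k))"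
        unfolding f_hat_def p_hat_def g_def
        by (rule K(2)[OF f x0R h(1)]) (use y in \<open>auto simp: iota_hat_def\<close>)
      also have "(\<Sum>i\<in>{1..k}. (norm (?y i - g i x\<^sub>0))\<^sup>2) = (\<Sum>i\<in>{1..k}.
          (norm (E (\<lambda>j\<in>{1..m}. (x j, g i (x j) + \<epsilon> (j, i)), x\<^sub>0) - g i x\<^sub>0))\<^sup>2)"
        by (rule sum.cong) (auto simp: iota)
      finally have "ennreal ((norm (f_hat d k m E x h (observation d f x h \<epsilon>) x\<^sub>0 - f x\<^sub>0))\<^sup>2)
          \<le> ennreal (K * (inverse (h\<^sup>2) * (\<Sum>i\<in>{1..k}.
          (norm (E (\<lambda>j\<in>{1..m}. (x j, g i (x j) + \<epsilon> (j, i)), x\<^sub>0) - g i x\<^sub>0))\<^sup>2) + h ^ (2 * k)))"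
        by (rule ennreal_leI)
      then show ?thesis
        using K(1) h by (simp add: \<Phi>_def ennreal_mult ennreal_plus sum_nonneg flip: sum_ennreal)
    qed
    have "mean_squared_error d k m f x h \<nu> E x\<^sub>0
        \<le> (\<integral>\<^sup>+\<epsilon>. ennreal K * (ennreal (inverse (h\<^sup>2)) * (\<Sum>i\<in>{1..k}. \<Phi> i (\<lambda>j. \<epsilon> (j, i)))
            + ennreal (h ^ (2 * k))) \<partial>P)"
      unfolding mean_squared_error_def P_def[symmetric] by (rule nn_integral_mono) (rule le)
    also have "\<dots> = ennreal K * (ennreal (inverse (h\<^sup>2)) * (\<Sum>i\<in>{1..k}. \<integral>\<^sup>+\<epsilon>. \<Phi> i (\<lambda>j. \<epsilon> (j, i)) \<partial>P)
            + ennreal (h ^ (2 * k)))"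
      by (subst nn_integral_sum[symmetric])
        (use risk(1) in \<open>auto simp: nn_integral_cmult nn_integral_add P.emeasure_space_1\<close>)
    also have "\<dots> \<le> ennreal K * (ennreal (inverse (h\<^sup>2)) * (\<Sum>i\<in>{1..k}. r) + ennreal (h ^ (2 * k)))"
      by (intro mult_left_mono add_right_mono sum_mono risk(2)) auto
    also have "\<dots> = ennreal K * (ennreal (real k) * (ennreal (inverse (h\<^sup>2)) * r) + ennreal (h ^ (2 * k)))"
      by (simp add: mult_ac ennreal_of_nat_eq_real_of_nat)
    also have "\<dots> \<le> ennreal K * (ennreal (real k) * (ennreal (inverse (h\<^sup>2)) * r) + ennreal (real k) * ennreal (h ^ (2 * k)))"
    proof (intro mult_left_mono add_left_mono)
      have "ennreal 1 * ennreal (h ^ (2 * k)) \<le> ennreal (real k) * ennreal (h ^ (2 * k))"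
        using assms(1) by (intro mult_right_mono ennreal_leI) auto
      then show "ennreal (h ^ (2 * k)) \<le> ennreal (real k) * ennreal (h ^ (2 * k))" by simp
    qed auto
    also have "\<dots> = ennreal (K * real k) * (ennreal (inverse (h\<^sup>2)) * r + ennreal (h ^ (2 * k)))"
      using K(1) by (simp add: ennreal_mult distrib_left mult_ac)
    finally show ?thesis by (simp only: r_def)
  qed
  moreover have "C * real k > 0" "K * real k \<ge> 0" using C(1) K(1) assms(1) by auto
  ultimately show ?thesis by (intro exI[of _ "C * real k"] conjI exI[of _ "K * real k"]) blast+
qed

theorem theorem3p11:
  fixes \<beta> :: nat and L :: "nat \<Rightarrow> real" and T :: real
  assumes "\<beta> \<ge> 1" and "\<And>k. k \<le> \<beta> \<Longrightarrow> L k > 0"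
  shows "\<exists>C>0. \<forall>(d::nat) (\<sigma>::real) (f :: nat \<Rightarrow> ell2 \<Rightarrow> ell2) (x :: nat \<Rightarrow> nat \<Rightarrow> ell2)
      (\<Delta>t :: nat \<Rightarrow> real) (\<nu> :: nat \<Rightarrow> nat \<Rightarrow> nat \<Rightarrow> ell2 measure)
      (E :: nat \<Rightarrow> estimator) (x\<^sub>0 :: nat \<Rightarrow> ell2).
    d \<ge> 1 \<and> \<sigma> \<ge> 0 \<and>
    (\<forall>m\<ge>1. f m \<in> smooth_class d \<beta> L \<and>
       (\<forall>j\<in>{1..m}. x m j \<in> unit_cube d) \<and>
       \<Delta>t m > 0 \<and>
       (\<forall>j\<in>{1..m}. \<forall>i\<in>{1..\<beta>}. noise_law d \<sigma> (\<nu> m j i)) \<and>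
       regression_estimator d m (E m) \<and>
       x\<^sub>0 m \<in> unit_cube d) \<and>
    (\<lambda>m. ennreal (\<Delta>t m)) \<preceq>\<^sub>\<infinity> (\<lambda>m. 1) \<and>
    limsup (\<lambda>m. ennreal (\<Delta>t m)) \<le> ennreal T
    \<longrightarrow>
    (\<lambda>m. mean_squared_error d \<beta> m (f m) (x m) (\<Delta>t m) (\<nu> m) (E m) (x\<^sub>0 m))
    \<preceq>\<^sub>\<infinity>
    (\<lambda>m. ennreal (inverse ((\<Delta>t m)\<^sup>2)) * max_risk d \<beta> (C * \<Delta>t m) \<sigma> m (E m) (x m)
          + ennreal (\<Delta>t m ^ (2 * \<beta>)))"
proof -
  \<comment> \<open>The maximum dominates all \<open>L k\<close>; the summand 1 ensures
    \<open>M \<ge> 1\<close>, as the estimates for trajectories assume.\<close>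
  define M where "M = Max (L ` {..\<beta>}) + 1"
  have LM: "L k > 0 \<and> L k \<le> M" if "k \<le> \<beta>" for k
  proof -
    have "L k \<le> Max (L ` {..\<beta>})" using that by (intro Max_ge) auto
    then show ?thesis using assms(2)[OF that] by (simp add: M_def)
  qed
  have "0 < Max (L ` {..\<beta>})"
    using assms(2)[of 0] by (subst Max_gr_iff) auto
  then have M: "M \<ge> 1" by (simp add: M_def)
  \<comment> \<open>A value strictly above the limit superior bounds the time step from some index
    on; the maximum with 0 covers a negative \<open>T\<close>.\<close>
  define S where "S = max T 0 + 1"
  have S: "S \<ge> 0" by (simp add: S_def)
  obtain C K where C: "C > 0" and le: "\<forall>d \<sigma> f x h \<nu> E x\<^sub>0 m.
    bounded_smooth d \<beta> M f \<and> (\<forall>j\<in>{1..m}. x j \<in> unit_cube d) \<and> 0 < h \<and> h \<le> S \<and>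
    (\<forall>j\<in>{1..m}. \<forall>i\<in>{1..\<beta>}. noise_law d \<sigma> (\<nu> j i)) \<and> regression_estimator d m E \<and> x\<^sub>0 \<in> unit_cube d \<longrightarrow>
    mean_squared_error d \<beta> m f x h \<nu> E x\<^sub>0
      \<le> ennreal K * (ennreal (inverse (h\<^sup>2)) * max_risk d \<beta> (C * h) \<sigma> m E x + ennreal (h ^ (2 * \<beta>)))"
    using mean_squared_error_le[OF assms(1) M S] by (elim exE conjE) (rule that)
  show ?thesis
  proof (intro exI[of _ C] conjI allI impI, fact C, elim conjE, rule asymp_le_of_eventually_le)
    fix d \<sigma> f x \<Delta>t \<nu> E x\<^sub>0
    assume H: "\<forall>m\<ge>1. f m \<in> smooth_class d \<beta> L \<and> (\<forall>j\<in>{1..m}. x m j \<in> unit_cube d) \<and> \<Delta>t m > 0 \<and>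
       (\<forall>j\<in>{1..m}. \<forall>i\<in>{1..\<beta>}. noise_law d \<sigma> (\<nu> m j i)) \<and> regression_estimator d m (E m) \<and>
       x\<^sub>0 m \<in> unit_cube d"
      and lim: "limsup (\<lambda>m. ennreal (\<Delta>t m)) \<le> ennreal T"
    have "ennreal T < ennreal S" by (intro ennreal_lessI) (auto simp: S_def)
    then have "\<forall>\<^sub>F m in sequentially. ennreal (\<Delta>t m) < ennreal S"
      using lim by (intro Limsup_lessD) simp
    with eventually_ge_at_top[of 1]
    show "\<forall>\<^sub>F m in sequentially.
        mean_squared_error d \<beta> m (f m) (x m) (\<Delta>t m) (\<nu> m) (E m) (x\<^sub>0 m) \<le> ennreal K *
          (ennreal (inverse ((\<Delta>t m)\<^sup>2)) * max_risk d \<beta> (C * \<Delta>t m) \<sigma> m (E m) (x m)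
            + ennreal (\<Delta>t m ^ (2 * \<beta>))) \<and>
        0 < ennreal (inverse ((\<Delta>t m)\<^sup>2)) * max_risk d \<beta> (C * \<Delta>t m) \<sigma> m (E m) (x m)
            + ennreal (\<Delta>t m ^ (2 * \<beta>))"
    proof eventually_elim
      case (elim m)
      with H have m: "f m \<in> smooth_class d \<beta> L" "\<forall>j\<in>{1..m}. x m j \<in> unit_cube d" "\<Delta>t m > 0"
        "\<forall>j\<in>{1..m}. \<forall>i\<in>{1..\<beta>}. noise_law d \<sigma> (\<nu> m j i)" "regression_estimator d m (E m)"
        "x\<^sub>0 m \<in> unit_cube d"
        by auto
      have "\<Delta>t m \<le> S" using elim(2) m(3) by (simp add: ennreal_less_iff)
      moreover have "bounded_smooth d \<beta> M (f m)"
        by (rule smooth_class_bounded_smooth[OF m(1) LM])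
      ultimately have "mean_squared_error d \<beta> m (f m) (x m) (\<Delta>t m) (\<nu> m) (E m) (x\<^sub>0 m) \<le> ennreal K *
          (ennreal (inverse ((\<Delta>t m)\<^sup>2)) * max_risk d \<beta> (C * \<Delta>t m) \<sigma> m (E m) (x m)
            + ennreal (\<Delta>t m ^ (2 * \<beta>)))"
        by (intro le[rule_format] conjI m)
      \<comment> \<open>The power of the time step is positive whatever the risk, so the right-hand
        side is positive.\<close>
      then show ?case using m(3) by (simp add: add_nonneg_pos)
    qed
  qed
qed

end
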